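(* Let $F$ be an integral linear recurrence, let $G$ be an integer-valued polynomial all of whose (complex) roots lie in $\mathbb{Q}$, and let $h$ be a positive integer. Then the set $$\mathcal{A}_{F,G,h} := \{ n \in \mathbb{N} : \gcd(F(n), G(n)) = h \}$$ has a natural density. Moreover, if $F$ is non-degenerate and $G$ has no fixed divisors, then, writing $\mathcal{A}_{F,G} := \mathcal{A}_{F,G,1}$, we have $\mathbf{d}(\mathcal{A}_{F,G}) = 0$ if and only if $\mathcal{A}_{F,G}$ is finite.
   Context: $\mathbb{N}$ denotes the set of positive integers. An integral linear recurrence is a sequence of integers $(F(n))_{n \ge 0}$ such that $F(n) = a_1F(n-1) + \cdots + a_kF(n-k)$ for all integers $n \ge k$, for some fixed $a_1,\dots,a_k \in \mathbb{Z}$ with $a_k \neq 0$. Its characteristic polynomial is $\psi_F(X) = X^k - a_1X^{k-1} - \cdots - a_k$, and $F$ is non-degenerate if no ratio $\alpha_i/\alpha_j$ ($i\neq j$) of two distinct roots of $\psi_F$ is a root of unity. An integer-valued polynomial is a polynomial $G \in \mathbb{Q}[X]$ with $G(n) \in \mathbb{Z}$ for all integers $n$; $G$ has a fixed divisor if there is an integer $d>1$ dividing $G(n)$ for every integer $n$. The natural density of $\mathcal{S} \subseteq \mathbb{N}$ is $\mathbf{d}(\mathcal{S}) = \lim_{x\to+\infty} \#(\mathcal{S}\cap[1,x])/x$ when this limit exists. *)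

theory Defs
  imports Complex_Main "HOL-Computational_Algebra.Polynomial"
begin

text \<open>
  The order \<open>k\<close> and the coefficients \<open>a 1, \<dots>, a k\<close> are explicit parameters, because
  the characteristic polynomial, and hence non-degeneracy, depends on them.  Values of \<open>a\<close>
  outside \<open>{1..k}\<close> are irrelevant.
\<close>

definition integral_linear_recurrence :: "nat \<Rightarrow> (nat \<Rightarrow> int) \<Rightarrow> (nat \<Rightarrow> int) \<Rightarrow> bool" where
  "integral_linear_recurrence k a F \<longleftrightarrow>
     k \<ge> 1 \<and> a k \<noteq> 0 \<and> (\<forall>n\<ge>k. F n = (\<Sum>i=1..k. a i * F (n - i)))"

definition recurrence_char_poly :: "nat \<Rightarrow> (nat \<Rightarrow> int) \<Rightarrow> int poly" where
  "recurrence_char_poly k a = monom 1 k - (\<Sum>i=1..k. monom (a i) (k - i))"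

definition root_of_unity :: "complex \<Rightarrow> bool" where
  "root_of_unity z \<longleftrightarrow> (\<exists>m::nat. m \<ge> 1 \<and> z ^ m = 1)"

text \<open>
  When \<open>a k \<noteq> 0\<close>, zero is not a root of the characteristic polynomial, so the quotient
  below is a genuine one.
\<close>

definition nondegenerate_recurrence :: "nat \<Rightarrow> (nat \<Rightarrow> int) \<Rightarrow> bool" where
  "nondegenerate_recurrence k a \<longleftrightarrow>
     (\<forall>\<alpha> \<beta>::complex.
        poly (map_poly of_int (recurrence_char_poly k a)) \<alpha> = 0 \<and>
        poly (map_poly of_int (recurrence_char_poly k a)) \<beta> = 0 \<and> \<alpha> \<noteq> \<beta>
        \<longrightarrow> \<not> root_of_unity (\<alpha> / \<beta>))"

definition integer_valued_poly :: "rat poly \<Rightarrow> bool" where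
  "integer_valued_poly G \<longleftrightarrow> (\<forall>n::int. poly G (of_int n) \<in> \<int>)"

text \<open>This excludes the zero polynomial, of which every complex number is a root.\<close>

definition all_complex_roots_rational :: "rat poly \<Rightarrow> bool" where
  "all_complex_roots_rational G \<longleftrightarrow>
     (\<forall>z::complex. poly (map_poly of_rat G) z = 0 \<longrightarrow> z \<in> \<rat>)"

text \<open>
  For an integer-valued polynomial the floor only converts the value from type \<^typ>\<open>rat\<close>
  to type \<^typ>\<open>int\<close>.
\<close>

definition int_value :: "rat poly \<Rightarrow> int \<Rightarrow> int" where
  "int_value G n = \<lfloor>poly G (of_int n)\<rfloor>"

definition has_fixed_divisor :: "rat poly \<Rightarrow> bool" where
  "has_fixed_divisor G \<longleftrightarrow> (\<exists>d::int. d > 1 \<and> (\<forall>n::int. d dvd int_value G n))"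

definition gcd_set :: "(nat \<Rightarrow> int) \<Rightarrow> rat poly \<Rightarrow> nat \<Rightarrow> nat set" where
  "gcd_set F G h = {n. n \<ge> 1 \<and> gcd (F n) (int_value G (int n)) = int h}"

definition has_natural_density :: "nat set \<Rightarrow> real \<Rightarrow> bool" where
  "has_natural_density S \<delta> \<longleftrightarrow>
     ((\<lambda>x::real. real (card {n \<in> S. 1 \<le> n \<and> real n \<le> x}) / x) \<longlongrightarrow> \<delta>) at_top"

end

theory Submission
  imports Defs "Jordan_Normal_Form.Char_Poly" "HOL-Computational_Algebra.Computational_Algebra"
    "HOL-Number_Theory.Number_Theory"
begin

text \<open>
  Write \<open>F(n) = \<Sum> P\<^sub>\<alpha>(n) \<alpha>\<^sup>n\<close> over the roots of the characteristic polynomial.  Passing to residue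
  classes \<open>n \<equiv> s (mod l)\<close> makes the bases multiplicatively non-degenerate.  If a prime \<open>p\<close> divides
  \<open>gcd(F(n), G(n))\<close>, then \<open>p\<close> divides \<open>c n - b\<close> for some root \<open>b/c\<close> of \<open>G\<close>, so modulo \<open>p\<close> the
  polynomials \<open>P\<^sub>\<alpha>(n)\<close> may be replaced by the constants \<open>P\<^sub>\<alpha>(b/c)\<close>.  If these all vanish, \<open>c n - b\<close>
  essentially divides \<open>F(n)\<close>, and the set is finite on the class.  Otherwise \<open>F\<close> restricted to
  \<open>n = r + p m\<close> is, by Frobenius, a nonzero simple exponential sum modulo \<open>p\<close>.  Many zeros \<open>m\<close> in a
  short window would produce pairs of zeros at a common distance \<open>d\<close>; replacing \<open>f(m)\<close> by
  \<open>f(m + d) - \<gamma>\<^sup>d f(m)\<close> removes one base, and after finitely many steps one term remains, which is never zero.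
  This fails only for primes dividing \<open>\<gamma>\<^sup>d - \<delta>\<^sup>d\<close> for a small \<open>d\<close>, and these are sparse.  Hence the
  \<open>n\<close> for which \<open>gcd(F(n), G(n))\<close> has a prime factor above \<open>z\<close> have upper density \<open>O(z\<^sup>-\<^sup>\<eta>)\<close>, while the
  conditions at primes up to \<open>z\<close> are eventually periodic; this gives the density.

  For positivity, fix one \<open>n\<^sub>0\<close> in the set and keep \<open>n\<close> congruent to \<open>n\<^sub>0\<close> modulo a fixed modulus, with
  \<open>G(n)\<close> free of the remaining primes up to \<open>z\<close>.  By a Chebyshev-type bound this sieved set has, for
  every \<open>\<epsilon> > 0\<close>, density at least a constant times \<open>z\<^sup>-\<^sup>\<epsilon>\<close>, which beats the tail \<open>O(z\<^sup>-\<^sup>\<eta>)\<close>.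
\<close>

text \<open>No number field, norm or prime ideal appears. Congruences are taken in the ring of all
  algebraic integers modulo a rational prime \<open>p\<close>. The ideal of \<open>p\<close> is not
  prime there, so being nonzero modulo \<open>p\<close> does not survive multiplication;
  nonvanishing is therefore proved as invertibility (\<open>unit_mod\<close>). The norm is replaced
  by any nonzero rational integer multiple: if \<open>c\<close> divides the integer
  \<open>b\<close>, then \<open>c\<close> is a unit modulo every prime not dividing
  \<open>b\<close>. For \<open>g ^ d - h ^ d\<close> there is such a multiple of size exponential in
  \<open>d\<close>, so a shift \<open>d\<close> spoils only O(d) primes. Shifts go up to p^(1/4)
  only; then the spoilt primes above \<open>z\<close> have reciprocal sum O(z^(-1/4)). Each removed
  base costs a square root, whence the exponents \<open>1 - 1 / 2 ^ k\<close>. The tail runs over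
  primes up to a constant times \<open>X\<close>, where the windows are too short to help. There it
  is only used that the primes have density zero; this is one source of the extra \<epsilon> in
  every tail bound.\<close>

hide_const (open) up_ring.coeff up_ring.monom Coset.order

section \<open>Algebraic integers\<close>

text \<open>Multiplication by \<open>x\<close> maps the group generated by \<open>W\<close> into
  itself, through an integer matrix with entries at most \<open>K\<close>; \<open>W\<close> may be
  linearly dependent. The explicit \<open>K\<close> later bounds the rational integer multiples of
  \<open>g ^ d - h ^ d\<close>.\<close>

definition int_acts :: "complex set \<Rightarrow> int \<Rightarrow> complex \<Rightarrow> bool" where
  "int_acts W K x \<longleftrightarrow>
     (\<forall>w\<in>W. \<exists>c. x * w = (\<Sum>v\<in>W. of_int (c v) * v) \<and> (\<forall>v\<in>W. \<bar>c v\<bar> \<le> K))"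

lemma int_actsE:
  assumes "int_acts W K x"
  obtains c where "\<And>w. w \<in> W \<Longrightarrow> x * w = (\<Sum>v\<in>W. of_int (c w v) * v)"
    "\<And>w v. w \<in> W \<Longrightarrow> v \<in> W \<Longrightarrow> \<bar>c w v\<bar> \<le> K"
  using assms unfolding int_acts_def by metis

text \<open>Multiplying by \<open>[:a, b:]\<close> enlarges the largest absolute coefficient at most
  by the factor |a| + |b|. The terms of the Leibniz expansion of a characteristic polynomial are
  such products.\<close>

lemma abs_coeff_prod_linear_le:
  fixes a b :: "nat \<Rightarrow> int"
  assumes "finite I" "\<And>i. i \<in> I \<Longrightarrow> \<bar>a i\<bar> + \<bar>b i\<bar> \<le> C"
  shows "\<bar>coeff (\<Prod>i\<in>I. [:a i, b i:]) j\<bar> \<le> C ^ card I"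
  using assms
proof (induction I arbitrary: j rule: finite_induct)
  case empty
  then show ?case by (auto simp: coeff_1)
next
  case (insert i I)
  define q where "q = (\<Prod>i\<in>I. [:a i, b i:])"
  have IH: "\<bar>coeff q j\<bar> \<le> C ^ card I" for j
    unfolding q_def using insert by auto
  have C: "\<bar>a i\<bar> + \<bar>b i\<bar> \<le> C" using insert by auto
  have "\<bar>coeff ([:a i, b i:] * q) j\<bar> \<le> \<bar>a i\<bar> * C ^ card I + \<bar>b i\<bar> * C ^ card I"
  proof (cases j)
    case 0
    have "\<bar>a i * coeff q 0\<bar> \<le> \<bar>a i\<bar> * C ^ card I"
      by (simp add: abs_mult IH mult_left_mono)
    moreover have "0 \<le> \<bar>b i\<bar> * C ^ card I"
      using IH[of 0] by (meson abs_ge_zero mult_nonneg_nonneg order_trans)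
    ultimately show ?thesis by (simp add: 0)
  next
    case (Suc j')
    have "\<bar>a i * coeff q j\<bar> \<le> \<bar>a i\<bar> * C ^ card I" "\<bar>b i * coeff q j'\<bar> \<le> \<bar>b i\<bar> * C ^ card I"
      by (simp_all add: abs_mult IH mult_left_mono)
    then show ?thesis by (simp add: Suc)
  qed
  also have "\<dots> = (\<bar>a i\<bar> + \<bar>b i\<bar>) * C ^ card I" by (simp add: algebra_simps)
  also have "\<dots> \<le> C * C ^ card I"
    by (rule mult_right_mono[OF C]) (use C in auto)
  finally show ?case using insert by (simp add: q_def)
qed

text \<open>The determinant trick: the vector of the elements of \<open>W\<close> is an eigenvector,
  with eigenvalue \<open>x\<close>, of the integer matrix of the action, and \<open>w0\<close> makes
  it nonzero. So \<open>x\<close> is a root of the characteristic polynomial. Its Leibniz expansion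
  has n! terms, each a product of \<open>n\<close> linear factors of absolute coefficient sum at
  most \<open>1 + K\<close>.\<close>

lemma int_acts_imp_monic_root:
  assumes W: "finite W" "w0 \<in> W" "w0 \<noteq> 0" and act: "int_acts W K x"
  obtains q :: "int poly" where "lead_coeff q = 1" "poly (map_poly of_int q) x = 0"
    "\<And>i. \<bar>coeff q i\<bar> \<le> fact (card W) * (1 + K) ^ card W"
proof -
  define n where "n = card W"
  obtain e where e: "bij_betw e {0..<n} W"
    using ex_bij_betw_nat_finite[OF W(1)] by (auto simp: n_def)
  obtain c where c: "\<And>w. w \<in> W \<Longrightarrow> x * w = (\<Sum>v\<in>W. of_int (c w v) * v)"
    "\<And>w v. w \<in> W \<Longrightarrow> v \<in> W \<Longrightarrow> \<bar>c w v\<bar> \<le> K"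
    using int_actsE[OF act] by blast
  have eW: "e i \<in> W" if "i < n" for i using e that by (auto simp: bij_betw_def)
  define A :: "int mat" where "A = mat n n (\<lambda>(i,j). c (e i) (e j))"
  have A: "A \<in> carrier_mat n n" by (simp add: A_def)
  define q where "q = char_poly A"
  have q1: "degree q = n" "coeff q n = 1" using degree_monic_char_poly[OF A] by (auto simp: q_def)
  let ?B = "map_mat of_int A :: complex mat"
  have B: "?B \<in> carrier_mat n n" using A by auto
  define v where "v = vec n e"
  have "eigenvector ?B v x"
    unfolding eigenvector_def
  proof (intro conjI)
    show "v \<in> carrier_vec (dim_row ?B)" using B by (auto simp: v_def)
    obtain i where i: "i < n" "e i = w0" using e W(2) by (auto simp: bij_betw_def)
    show "v \<noteq> 0\<^sub>v (dim_row ?B)"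
    proof
      assume "v = 0\<^sub>v (dim_row ?B)"
      then have "v $ i = 0" using i A by auto
      then show False using i W(3) by (simp add: v_def)
    qed
    show "?B *\<^sub>v v = x \<cdot>\<^sub>v v"
    proof (rule eq_vecI)
      fix i assume "i < dim_vec (x \<cdot>\<^sub>v v)"
      then have i: "i < n" by (simp add: v_def)
      have "(?B *\<^sub>v v) $ i = (\<Sum>j\<in>{0..<n}. of_int (c (e i) (e j)) * e j)"
        using i A by (simp add: scalar_prod_def v_def A_def)
      also have "\<dots> = (\<Sum>v\<in>W. of_int (c (e i) v) * v)"
        by (rule sum.reindex_bij_betw[OF e])
      also have "\<dots> = x * e i" using c(1)[OF eW[OF i]] by simp
      finally show "(?B *\<^sub>v v) $ i = (x \<cdot>\<^sub>v v) $ i" using i by (simp add: v_def)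
    qed (use A in \<open>auto simp: v_def\<close>)
  qed
  then have "eigenvalue ?B x" unfolding eigenvalue_def by blast
  then have "poly (char_poly ?B) x = 0" using eigenvalue_root_char_poly[OF B] by simp
  moreover have "char_poly ?B = map_poly of_int q"
    unfolding q_def by (rule of_int_hom.char_poly_hom[OF A])
  ultimately have root: "poly (map_poly of_int q) x = 0" by simp
  have K: "K \<ge> 0" using c(2)[OF W(2) W(2)] by linarith
  have bd: "\<bar>coeff q k\<bar> \<le> fact n * (1 + K) ^ n" for k
  proof -
    have cp: "char_poly_matrix A \<in> carrier_mat n n" using A by simp
    have "coeff q k = (\<Sum>p | p permutes {0..<n}. coeff (signof p * (\<Prod>i=0..<n. char_poly_matrix A $$ (i, p i))) k)"
      unfolding q_def char_poly_def det_def'[OF cp] by (simp add: coeff_sum)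
    also have "\<bar>\<dots>\<bar> \<le> (\<Sum>p | p permutes {0..<n}. \<bar>coeff (signof p * (\<Prod>i=0..<n. char_poly_matrix A $$ (i, p i))) k\<bar>)"
      by (rule sum_abs)
    also have "\<dots> \<le> (\<Sum>p | p permutes {0..<n}. (1 + K) ^ n)"
    proof (rule sum_mono)
      fix p assume "p \<in> {p. p permutes {0..<n}}"
      then have p: "p permutes {0..<n}" by simp
      have pi: "p i < n" if "i < n" for i using p that permutes_in_image[OF p, of i] by auto
      have "(\<Prod>i=0..<n. char_poly_matrix A $$ (i, p i)) =
          (\<Prod>i=0..<n. [: - A $$ (i, p i), if i = p i then 1 else 0 :])"
        by (rule prod.cong) (use A pi in \<open>auto simp: char_poly_matrix_def\<close>)
      moreover have "\<bar>coeff (\<Prod>i=0..<n. [: - A $$ (i, p i), if i = p i then 1 else 0 :]) k\<bar> \<le> (1 + K) ^ card {0..<n}"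
      proof (rule abs_coeff_prod_linear_le)
        fix i assume "i \<in> {0..<n}"
        then have "\<bar>A $$ (i, p i)\<bar> \<le> K" using pi eW c(2) by (auto simp: A_def)
        then show "\<bar>- A $$ (i, p i)\<bar> + \<bar>if i = p i then 1 else 0\<bar> \<le> 1 + K" by auto
      qed auto
      ultimately show "\<bar>coeff (signof p * (\<Prod>i=0..<n. char_poly_matrix A $$ (i, p i))) k\<bar> \<le> (1 + K) ^ n"
        by (cases p rule: sign_cases) auto
    qed
    also have "\<dots> = fact n * (1 + K) ^ n"
      by (simp add: card_permutations[OF refl])
    finally show ?thesis .
  qed
  show ?thesis
    by (rule that[of q]) (use q1 root bd in \<open>auto simp: n_def\<close>)
qed

lemma int_acts_imp_algebraic_int:
  assumes "finite W" "w0 \<in> W" "w0 \<noteq> 0" "int_acts W K x"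
  shows "algebraic_int x"
  by (rule int_acts_imp_monic_root[OF assms]) (auto simp: algebraic_int_altdef_ipoly)

lemma int_acts_diff:
  assumes "int_acts W K x" "int_acts W L y"
  shows "int_acts W (K + L) (x - y)"
  unfolding int_acts_def
proof
  fix w assume w: "w \<in> W"
  obtain c where "x * w = (\<Sum>v\<in>W. of_int (c v) * v)" "\<forall>v\<in>W. \<bar>c v\<bar> \<le> K"
    using assms(1) w unfolding int_acts_def by blast
  moreover obtain d where "y * w = (\<Sum>v\<in>W. of_int (d v) * v)" "\<forall>v\<in>W. \<bar>d v\<bar> \<le> L"
    using assms(2) w unfolding int_acts_def by blast
  ultimately have "(x - y) * w = (\<Sum>v\<in>W. of_int (c v - d v) * v) \<and> (\<forall>v\<in>W. \<bar>c v - d v\<bar> \<le> K + L)"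
    by (fastforce simp: ring_distribs sum_subtractf)
  then show "\<exists>c. (x - y) * w = (\<Sum>v\<in>W. of_int (c v) * v) \<and> (\<forall>v\<in>W. \<bar>c v\<bar> \<le> K + L)"
    by (intro exI[of _ "\<lambda>v. c v - d v"])
qed

lemma int_acts_mult:
  assumes "finite W" "int_acts W K x" "int_acts W L y"
  shows "int_acts W (int (card W) * K * L) (x * y)"
  unfolding int_acts_def
proof
  fix w assume w: "w \<in> W"
  obtain c where c: "\<And>w. w \<in> W \<Longrightarrow> x * w = (\<Sum>v\<in>W. of_int (c w v) * v)"
    "\<And>w v. w \<in> W \<Longrightarrow> v \<in> W \<Longrightarrow> \<bar>c w v\<bar> \<le> K"
    using int_actsE[OF assms(2)] by blast
  obtain d where d: "\<And>w. w \<in> W \<Longrightarrow> y * w = (\<Sum>v\<in>W. of_int (d w v) * v)"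
    "\<And>w v. w \<in> W \<Longrightarrow> v \<in> W \<Longrightarrow> \<bar>d w v\<bar> \<le> L"
    using int_actsE[OF assms(3)] by blast
  define b where "b v = (\<Sum>u\<in>W. d w u * c u v)" for v
  have "x * y * w = (\<Sum>u\<in>W. of_int (d w u) * (x * u))"
    by (simp add: mult.assoc d(1)[OF w] sum_distrib_left mult.left_commute[of x])
  also have "\<dots> = (\<Sum>u\<in>W. \<Sum>v\<in>W. of_int (d w u) * of_int (c u v) * v)"
    by (rule sum.cong) (simp_all add: c(1) sum_distrib_left mult.assoc)
  also have "\<dots> = (\<Sum>v\<in>W. of_int (b v) * v)"
    by (subst sum.swap) (simp add: b_def sum_distrib_right)
  finally have 1: "x * y * w = (\<Sum>v\<in>W. of_int (b v) * v)" .
  have "\<bar>b v\<bar> \<le> int (card W) * K * L" if v: "v \<in> W" for v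
  proof -
    have "\<bar>b v\<bar> \<le> (\<Sum>u\<in>W. \<bar>d w u * c u v\<bar>)" unfolding b_def by (rule sum_abs)
    also have "\<dots> \<le> (\<Sum>u\<in>W. K * L)"
    proof (rule sum_mono)
      fix u assume u: "u \<in> W"
      have "\<bar>d w u\<bar> * \<bar>c u v\<bar> \<le> L * K"
        by (rule mult_mono) (use d(2)[OF w u] c(2)[OF u v] in auto)
      then show "\<bar>d w u * c u v\<bar> \<le> K * L" by (simp add: abs_mult mult_ac)
    qed
    finally show ?thesis by simp
  qed
  with 1 show "\<exists>c. x * y * w = (\<Sum>v\<in>W. of_int (c v) * v) \<and> (\<forall>v\<in>W. \<bar>c v\<bar> \<le> int (card W) * K * L)"
    by blast
qed

text \<open>The growth in \<open>n\<close> is only exponential; on this rests the linear count of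
  spoilt primes per shift.\<close>

lemma int_acts_power:
  assumes "finite W" "W \<noteq> {}" "int_acts W K x" "K \<ge> 1"
  shows "int_acts W ((int (card W) * K) ^ n) (x ^ n)"
proof (induction n)
  case 0
  show ?case unfolding int_acts_def
  proof
    fix w assume w: "w \<in> W"
    have "x ^ 0 * w = (\<Sum>v\<in>W. of_int (if v = w then 1 else 0) * v)"
      using w assms(1) by (subst sum.remove[of W w]) auto
    then show "\<exists>c. x ^ 0 * w = (\<Sum>v\<in>W. of_int (c v) * v) \<and> (\<forall>v\<in>W. \<bar>c v\<bar> \<le> (int (card W) * K) ^ 0)"
      by (intro exI[of _ "\<lambda>v. if v = w then 1 else 0"]) auto
  qed
next
  case (Suc n)
  show ?case using int_acts_mult[OF assms(1,3) Suc.IH] by (simp add: mult_ac)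
qed

section \<open>Integer spans, and a module on which two algebraic integers act\<close>

definition int_span :: "complex set \<Rightarrow> complex set" where
  "int_span W = range (\<lambda>c. \<Sum>v\<in>W. of_int (c v) * v)"

lemma int_span_add: "a \<in> int_span W \<Longrightarrow> b \<in> int_span W \<Longrightarrow> a + b \<in> int_span W"
proof -
  assume "a \<in> int_span W" "b \<in> int_span W"
  then obtain c d where "a = (\<Sum>v\<in>W. of_int (c v) * v)" "b = (\<Sum>v\<in>W. of_int (d v) * v)"
    by (auto simp: int_span_def)
  then have "a + b = (\<Sum>v\<in>W. of_int (c v + d v) * v)"
    by (simp add: ring_distribs sum.distrib)
  then show ?thesis unfolding int_span_def by (rule range_eqI[where x = "\<lambda>v. c v + d v"])
qed

lemma int_span_scale: "a \<in> int_span W \<Longrightarrow> of_int m * a \<in> int_span W"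
proof -
  assume "a \<in> int_span W"
  then obtain c where "a = (\<Sum>v\<in>W. of_int (c v) * v)" by (auto simp: int_span_def)
  then have "of_int m * a = (\<Sum>v\<in>W. of_int (m * c v) * v)"
    by (simp add: sum_distrib_left mult_ac)
  then show ?thesis unfolding int_span_def by (rule range_eqI[where x = "\<lambda>v. m * c v"])
qed

lemma int_span_base: "finite W \<Longrightarrow> w \<in> W \<Longrightarrow> w \<in> int_span W"
proof -
  assume "finite W" "w \<in> W"
  then have "w = (\<Sum>v\<in>W. of_int (if v = w then 1 else 0) * v)"
    by (subst sum.remove[of W w]) auto
  then show ?thesis unfolding int_span_def by (rule range_eqI[where x = "\<lambda>v. if v = w then 1 else 0"])
qed

lemma int_span_sum:
  "(\<And>i. i \<in> I \<Longrightarrow> f i \<in> int_span W) \<Longrightarrow> (\<Sum>i\<in>I. f i) \<in> int_span W"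
proof (induction I rule: infinite_finite_induct)
  case (insert x F)
  then show ?case by (auto intro: int_span_add)
next
  case empty
  show ?case unfolding int_span_def by (rule range_eqI[where x = "\<lambda>_. 0"]) simp
next
  case (infinite A)
  show ?case unfolding int_span_def by (rule range_eqI[where x = "\<lambda>_. 0"]) (simp add: infinite)
qed

lemma int_acts_ex_bound:
  assumes "finite W" "\<And>w. w \<in> W \<Longrightarrow> x * w \<in> int_span W"
  obtains K where "int_acts W K x" "K \<ge> 1"
proof -
  have "\<forall>w\<in>W. \<exists>c. x * w = (\<Sum>v\<in>W. of_int (c v) * v)"
    using assms(2) by (auto simp: int_span_def)
  then obtain c where c: "\<forall>w\<in>W. x * w = (\<Sum>v\<in>W. of_int (c w v) * v)" by metis
  define K where "K = 1 + (\<Sum>w\<in>W. \<Sum>v\<in>W. \<bar>c w v\<bar>)"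
  have "\<bar>c w v\<bar> \<le> K" if "w \<in> W" "v \<in> W" for w v
  proof -
    have "\<bar>c w v\<bar> \<le> (\<Sum>v\<in>W. \<bar>c w v\<bar>)" using assms(1) that by (intro member_le_sum) auto
    also have "\<dots> \<le> (\<Sum>w\<in>W. \<Sum>v\<in>W. \<bar>c w v\<bar>)"
      using assms(1) that by (intro member_le_sum[of w W "\<lambda>w. \<Sum>v\<in>W. \<bar>c w v\<bar>"]) (auto intro: sum_nonneg)
    finally show ?thesis by (simp add: K_def)
  qed
  moreover have "K \<ge> 1" by (auto simp: K_def intro!: sum_nonneg)
  ultimately show ?thesis using c by (intro that[of K]) (auto simp: int_acts_def)
qed

lemma monic_root_power_eq:
  assumes "algebraic_int (x :: complex)"
  obtains m a where "m > 0" "x ^ m = (\<Sum>i<m. of_int (a i) * x ^ i)"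
proof -
  obtain p where p: "poly (map_poly of_int p) x = 0" "lead_coeff p = 1"
    using assms algebraic_int_altdef_ipoly by blast
  define m where "m = degree p"
  have "m > 0"
  proof (rule ccontr)
    assume "\<not> m > 0"
    then obtain c where "p = [:c:]" unfolding m_def using degree_eq_zeroE by blast
    then show False using p by (auto simp: one_pCons[symmetric] split: if_splits)
  qed
  have "0 = (\<Sum>i\<le>m. of_int (coeff p i) * x ^ i)"
    using p(1) by (simp add: poly_altdef m_def)
  also have "\<dots> = x ^ m + (\<Sum>i<m. of_int (coeff p i) * x ^ i)"
    using p(2) by (simp add: lessThan_Suc_atMost[symmetric] m_def)
  finally have "x ^ m = (\<Sum>i<m. of_int (- coeff p i) * x ^ i)"
    by (simp add: sum_negf eq_neg_iff_add_eq_0)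
  then show ?thesis by (rule that[OF \<open>m > 0\<close>])
qed

text \<open>The monomials x^i y^j with i < m and j < n work: when an exponent overflows, the monic
  equations rewrite x^m or y^n. The module has to be common to \<open>x\<close> and \<open>y\<close>
  so that differences and products are represented by matrices of one fixed size.\<close>

lemma ex_common_int_module:
  assumes "algebraic_int (x :: complex)" "algebraic_int y"
  obtains W K where "finite W" "1 \<in> W" "int_acts W K x" "int_acts W K y" "K \<ge> 1"
proof -
  obtain m a where m: "m > 0" "x ^ m = (\<Sum>i<m. of_int (a i) * x ^ i)"
    using monic_root_power_eq[OF assms(1)] .
  obtain n b where n: "n > 0" "y ^ n = (\<Sum>i<n. of_int (b i) * y ^ i)"
    using monic_root_power_eq[OF assms(2)] .
  define W where "W = (\<lambda>(i,j). x ^ i * y ^ j) ` ({..<m} \<times> {..<n})"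
  have fin: "finite W" by (simp add: W_def)
  have inW: "x ^ i * y ^ j \<in> W" if "i < m" "j < n" for i j using that by (force simp: W_def)
  have 1: "1 \<in> W" using inW[of 0 0] m n by simp
  have X: "x * w \<in> int_span W" if "w \<in> W" for w
  proof -
    obtain i j where ij: "i < m" "j < n" "w = x ^ i * y ^ j" using \<open>w \<in> W\<close> by (auto simp: W_def)
    show ?thesis
    proof (cases "Suc i < m")
      case True
      have "x * w = x ^ Suc i * y ^ j" using ij by simp
      also have "\<dots> \<in> int_span W" by (rule int_span_base[OF fin inW]) (use True ij in auto)
      finally show ?thesis .
    next
      case False
      then have "m = Suc i" using ij by simp
      then have "x * w = x ^ m * y ^ j" using ij by simp
      also have "\<dots> = (\<Sum>i<m. of_int (a i) * (x ^ i * y ^ j))"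
        by (simp add: m(2) sum_distrib_left sum_distrib_right mult_ac)
      also have "\<dots> \<in> int_span W"
        by (intro int_span_sum int_span_scale int_span_base[OF fin inW]) (use ij in auto)
      finally show ?thesis .
    qed
  qed
  have Y: "y * w \<in> int_span W" if "w \<in> W" for w
  proof -
    obtain i j where ij: "i < m" "j < n" "w = x ^ i * y ^ j" using \<open>w \<in> W\<close> by (auto simp: W_def)
    show ?thesis
    proof (cases "Suc j < n")
      case True
      have "y * w = x ^ i * y ^ Suc j" using ij by simp
      also have "\<dots> \<in> int_span W" by (rule int_span_base[OF fin inW]) (use True ij in auto)
      finally show ?thesis .
    next
      case False
      then have "n = Suc j" using ij by simp
      then have "y * w = x ^ i * y ^ n" using ij by simp
      also have "\<dots> = (\<Sum>j<n. of_int (b j) * (x ^ i * y ^ j))"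
        by (simp add: n(2) sum_distrib_left sum_distrib_right mult_ac)
      also have "\<dots> \<in> int_span W"
        by (intro int_span_sum int_span_scale int_span_base[OF fin inW]) (use ij in auto)
      finally show ?thesis .
    qed
  qed
  obtain K1 where K1: "int_acts W K1 x" "K1 \<ge> 1" using int_acts_ex_bound[OF fin X] by blast
  obtain K2 where K2: "int_acts W K2 y" "K2 \<ge> 1" using int_acts_ex_bound[OF fin Y] by blast
  have "int_acts W (max K1 K2) x" "int_acts W (max K1 K2) y"
    using K1 K2 unfolding int_acts_def by (meson max.coboundedI1 max.coboundedI2)+
  then show ?thesis using that fin 1 K1 by (meson max.coboundedI1)
qed

section \<open>The ring of algebraic integers\<close>

lemma algebraic_int_diff [intro]:
  "algebraic_int (x :: complex) \<Longrightarrow> algebraic_int y \<Longrightarrow> algebraic_int (x - y)"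
  by (rule ex_common_int_module[of x y])
     (auto intro: int_acts_imp_algebraic_int[OF _ _ one_neq_zero] dest: int_acts_diff)

lemma algebraic_int_mult [intro]:
  "algebraic_int (x :: complex) \<Longrightarrow> algebraic_int y \<Longrightarrow> algebraic_int (x * y)"
  by (rule ex_common_int_module[of x y])
     (auto intro: int_acts_imp_algebraic_int[OF _ _ one_neq_zero] dest: int_acts_mult)

lemma algebraic_int_add [intro]:
  assumes "algebraic_int (x :: complex)" "algebraic_int y" shows "algebraic_int (x + y)"
  using algebraic_int_diff[OF assms(1), of "- y"] assms(2) by (simp add: algebraic_int_minus)

lemma algebraic_int_of_int [simp, intro]: "algebraic_int (of_int n :: complex)"
  by (rule int_imp_algebraic_int) auto

lemma algebraic_int_1 [simp, intro]: "algebraic_int (1 :: complex)"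
  using algebraic_int_of_int[of 1] by simp

lemma algebraic_int_of_nat [simp, intro]: "algebraic_int (of_nat n :: complex)"
  using algebraic_int_of_int[of "int n"] by simp

lemma algebraic_int_power [intro]: "algebraic_int (x :: complex) \<Longrightarrow> algebraic_int (x ^ n)"
  by (induction n) auto

lemma algebraic_int_sum [intro]:
  "(\<And>i. i \<in> I \<Longrightarrow> algebraic_int (f i :: complex)) \<Longrightarrow> algebraic_int (\<Sum>i\<in>I. f i)"
  by (induction I rule: infinite_finite_induct) auto

lemma algebraic_int_poly:
  "algebraic_int (x :: complex) \<Longrightarrow> algebraic_int (poly (map_poly of_int q) x)"
  by (auto simp: poly_altdef coeff_map_poly intro!: algebraic_int_sum algebraic_int_mult)

text \<open>A substitute for the norm. Cancelling the power of X in \<open>q\<close> leaves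
  \<open>r\<close> with r(0) nonzero, and r(x) = 0 exhibits r(0) as \<open>x\<close> times an
  algebraic integer. Naming r(0) as a coefficient of the given \<open>q\<close> lets size bounds for
  \<open>q\<close> carry over.\<close>

lemma monic_root_divides_coeff:
  fixes q :: "int poly"
  assumes "lead_coeff q = 1" "poly (map_poly of_int q) x = 0" "x \<noteq> (0 :: complex)"
  obtains i where "coeff q i \<noteq> 0" "algebraic_int (of_int (coeff q i) / x)"
proof -
  have xint: "algebraic_int x" using assms algebraic_int_altdef_ipoly by blast
  have "q \<noteq> 0" using assms by auto
  then obtain r where r: "q = [:-0,1:] ^ order 0 q * r" "\<not> [:-0,1:] dvd r"
    using order_decomp by blast
  define k where "k = order 0 q"
  have q: "q = monom 1 k * r" using r(1) by (simp add: k_def monom_altdef)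
  have r0: "coeff r 0 \<noteq> 0" using r(2) by (simp add: dvd_iff_poly_eq_0 poly_0_coeff_0)
  have ck: "coeff q k = coeff r 0" by (simp add: q coeff_monom_mult)
  have "poly (map_poly of_int q) x = x ^ k * poly (map_poly of_int r) x"
    by (simp add: q of_int_hom.map_poly_hom_monom of_int_poly_hom.hom_mult poly_monom)
  then have rx: "poly (map_poly of_int r) x = 0" using assms by simp
  obtain c s where r_eq: "r = pCons c s" by (cases r)
  have "of_int c + x * poly (map_poly of_int s) x = 0" using rx by (simp add: r_eq of_int_hom.map_poly_pCons_hom)
  then have "of_int c / x = - poly (map_poly of_int s) x"
    using assms(3) by (simp add: field_simps eq_neg_iff_add_eq_0)
  then have "algebraic_int (of_int (coeff q k) / x)"
    using algebraic_int_poly[OF xint, of s] by (simp add: ck r_eq algebraic_int_minus)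
  then show ?thesis using that[of k] r0 ck by simp
qed

lemma algebraic_int_dvd_int:
  assumes "algebraic_int (x :: complex)" "x \<noteq> 0"
  obtains b :: int where "b \<noteq> 0" "algebraic_int (of_int b / x)"
proof -
  obtain q where "poly (map_poly of_int q) x = 0" "lead_coeff q = 1"
    using assms(1) algebraic_int_altdef_ipoly by blast
  from monic_root_divides_coeff[OF this(2,1) assms(2)] that show ?thesis by blast
qed

text \<open>The matrix of \<open>x ^ d - y ^ d\<close> has entries at most 2 M^d while its size
  \<open>r\<close> stays fixed, so the coefficients of its characteristic polynomial are exponential
  in \<open>d\<close>. A power of two is the form in which prime divisors are counted later.\<close>

lemma power_diff_dvd_small_int:
  assumes "algebraic_int (x :: complex)" "algebraic_int y"
  obtains C :: nat where
    "\<And>d. x ^ d \<noteq> y ^ d \<Longrightarrow> \<exists>b::int. b \<noteq> 0 \<and> \<bar>b\<bar> \<le> 2 ^ (C * (d + 1)) \<and> algebraic_int (of_int b / (x ^ d - y ^ d))"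
proof -
  obtain W K where W: "finite W" "1 \<in> W" "int_acts W K x" "int_acts W K y" "K \<ge> 1"
    using ex_common_int_module[OF assms] .
  define r where "r = card W"
  have r: "r > 0" using W by (auto simp: r_def card_gt_0_iff)
  define M where "M = int r * K"
  have M: "M \<ge> 1" using r W(5) unfolding M_def by (simp add: int_one_le_iff_zero_less mult_pos_pos)
  \<comment> \<open>One constant bounds both the factor \<open>fact r * (3 * M) ^ r\<close> and the
    base \<open>(3 * M) ^ r\<close> of the power in \<open>d\<close>; base 2 is then reached through
    C < 2^C.\<close>
  define C where "C = nat (fact r * (3 * M) ^ r)"
  show ?thesis
  proof (rule that[of C])
    fix d assume ne: "x ^ d \<noteq> y ^ d"
    have act: "int_acts W (M ^ d + M ^ d) (x ^ d - y ^ d)"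
      unfolding M_def r_def by (intro int_acts_diff int_acts_power) (use W in auto)
    obtain q where q: "lead_coeff q = 1" "poly (map_poly of_int q) (x ^ d - y ^ d) = 0"
      "\<And>i. \<bar>coeff q i\<bar> \<le> fact r * (1 + (M ^ d + M ^ d)) ^ r"
      using int_acts_imp_monic_root[OF W(1,2) one_neq_zero act] unfolding r_def by blast
    obtain i where i: "coeff q i \<noteq> 0" "algebraic_int (of_int (coeff q i) / (x ^ d - y ^ d))"
      using monic_root_divides_coeff[OF q(1,2)] ne by auto
    have M1: "1 \<le> M ^ d" using M by simp
    have "\<bar>coeff q i\<bar> \<le> fact r * (1 + (M ^ d + M ^ d)) ^ r" by (rule q(3))
    also have "\<dots> \<le> fact r * (3 * M ^ d) ^ r"
      by (intro mult_left_mono power_mono) (use M1 in auto)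
    also have "\<dots> \<le> fact r * (3 * M) ^ r * ((3 * M) ^ r) ^ d"
    proof -
      have "(3 * M ^ d) ^ r \<le> (3 * M * (3 * M) ^ d) ^ r"
      proof (rule power_mono)
        have "M ^ d \<le> (3 * M) ^ d" by (rule power_mono) (use M in auto)
        moreover have "(3 * M) ^ d \<le> M * (3 * M) ^ d" using M by simp
        ultimately show "3 * M ^ d \<le> 3 * M * (3 * M) ^ d" by linarith
      qed (use M in auto)
      also have "\<dots> = (3 * M) ^ r * ((3 * M) ^ r) ^ d"
        by (simp add: power_mult_distrib flip: power_mult) (simp add: mult_ac)
      finally have "(3 * M ^ d) ^ r \<le> (3 * M) ^ r * ((3 * M) ^ r) ^ d" .
      then have "fact r * (3 * M ^ d) ^ r \<le> fact r * ((3 * M) ^ r * ((3 * M) ^ r) ^ d)"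
        by (intro mult_left_mono) auto
      then show ?thesis by (simp only: mult.assoc)
    qed
    also have "\<dots> \<le> int C * int C ^ d"
    proof (rule mult_mono)
      have "1 \<le> (3 * M) ^ r" using M by (intro one_le_power) auto
      then have C: "int C = fact r * (3 * M) ^ r" by (simp add: C_def)
      then show "fact r * (3 * M) ^ r \<le> int C" by simp
      have "(3 * M) ^ r \<le> int C" unfolding C using \<open>1 \<le> (3 * M) ^ r\<close>
        by (metis fact_ge_1 mult_right_mono mult_1 order_trans zero_le_one)
      then show "((3 * M) ^ r) ^ d \<le> int C ^ d" by (intro power_mono) (use M in auto)
    qed (use M in auto)
    also have "\<dots> = int C ^ (d + 1)" by simp
    also have "\<dots> \<le> (2 ^ C) ^ (d + 1)"
      by (rule power_mono) (use of_nat_less_two_power[of C, where 'a = int] in auto)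
    also have "\<dots> = 2 ^ (C * (d + 1))" by (simp only: power_mult)
    finally show "\<exists>b::int. b \<noteq> 0 \<and> \<bar>b\<bar> \<le> 2 ^ (C * (d + 1)) \<and> algebraic_int (of_int b / (x ^ d - y ^ d))"
      using i by blast
  qed
qed

section \<open>Zeros of exponential sums modulo a prime\<close>

text \<open>Membership in the ideal generated by \<open>p\<close> in the ring of all algebraic integers.\<close>

definition in_pO :: "nat \<Rightarrow> complex \<Rightarrow> bool" where
  "in_pO p x \<longleftrightarrow> algebraic_int (x / of_nat p)"

text \<open>Unlike membership in the complement of the ideal, invertibility is closed under
  products: the square root of \<open>p\<close> lies outside the ideal, its square inside.\<close>

definition unit_mod :: "nat \<Rightarrow> complex \<Rightarrow> bool" where
  "unit_mod p c \<longleftrightarrow> algebraic_int c \<and> (\<exists>t. algebraic_int t \<and> in_pO p (c * t - 1))"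

lemma in_pO_0 [simp]: "in_pO p 0"
  by (simp add: in_pO_def)

lemma in_pO_add: "in_pO p x \<Longrightarrow> in_pO p y \<Longrightarrow> in_pO p (x + y)"
  by (auto simp: in_pO_def add_divide_distrib)

lemma in_pO_diff: "in_pO p x \<Longrightarrow> in_pO p y \<Longrightarrow> in_pO p (x - y)"
  by (auto simp: in_pO_def diff_divide_distrib)

lemma in_pO_mult: "algebraic_int a \<Longrightarrow> in_pO p x \<Longrightarrow> in_pO p (a * x)"
  unfolding in_pO_def by (metis algebraic_int_mult times_divide_eq_right)

lemma in_pO_sum: "(\<And>i. i \<in> I \<Longrightarrow> in_pO p (f i)) \<Longrightarrow> in_pO p (\<Sum>i\<in>I. f i)"
  by (induction I rule: infinite_finite_induct) (auto intro: in_pO_add)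

text \<open>A rational algebraic integer is an integer, so the ideal meets the rational integers in
  the multiples of \<open>p\<close>. This is the bridge from divisibility of values of the
  recurrence to congruences of exponential sums.\<close>

lemma in_pO_of_int_iff:
  assumes "p > 0"
  shows "in_pO p (of_int b) \<longleftrightarrow> int p dvd b"
proof
  assume "in_pO p (of_int b)"
  then have "algebraic_int (of_int b / of_nat p :: complex)" by (simp add: in_pO_def)
  moreover have "of_int b / of_nat p \<in> (\<rat> :: complex set)" by simp
  ultimately have "of_int b / of_nat p \<in> (\<int> :: complex set)"
    by (rule rational_algebraic_int_is_int)
  then obtain m where "of_int b / of_nat p = (of_int m :: complex)" by (auto elim: Ints_cases)
  then have "of_int b = (of_int (m * int p) :: complex)" using assms by (simp add: field_simps)
  then have "b = m * int p" by (simp only: of_int_eq_iff)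
  then show "int p dvd b" by simp
next
  assume "int p dvd b"
  then obtain m where "b = int p * m" by auto
  then show "in_pO p (of_int b)" using assms by (simp add: in_pO_def)
qed

lemma in_pO_of_nat_mult: "p > 0 \<Longrightarrow> algebraic_int x \<Longrightarrow> in_pO p (of_nat p * x)"
  by (simp add: in_pO_def)

lemma unit_mod_1: "unit_mod p 1"
  unfolding unit_mod_def by (auto intro!: exI[of _ 1])

lemma unit_mod_mult:
  assumes "unit_mod p c" "unit_mod p d"
  shows "unit_mod p (c * d)"
proof -
  obtain s t where st: "algebraic_int c" "algebraic_int d" "algebraic_int s" "algebraic_int t"
    "in_pO p (c * s - 1)" "in_pO p (d * t - 1)"
    using assms by (auto simp: unit_mod_def)
  have "in_pO p ((d * t) * (c * s - 1) + (d * t - 1))"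
    using st by (intro in_pO_add in_pO_mult) auto
  also have "(d * t) * (c * s - 1) + (d * t - 1) = c * d * (s * t) - 1" by (simp add: algebra_simps)
  finally show ?thesis using st unfolding unit_mod_def by blast
qed

lemma unit_mod_power: "unit_mod p c \<Longrightarrow> unit_mod p (c ^ n)"
  by (induction n) (auto intro: unit_mod_mult unit_mod_1)

lemma unit_mod_cong:
  assumes "unit_mod p c" "algebraic_int d" "in_pO p (c - d)"
  shows "unit_mod p d"
proof -
  obtain t where t: "algebraic_int t" "in_pO p (c * t - 1)" using assms by (auto simp: unit_mod_def)
  have "in_pO p ((c * t - 1) - t * (c - d))" by (intro in_pO_diff in_pO_mult t assms)
  also have "(c * t - 1) - t * (c - d) = d * t - 1" by (simp add: algebra_simps)
  finally show ?thesis using t assms unfolding unit_mod_def by blast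
qed

text \<open>If \<open>b * s\<close> is 1 modulo \<open>p\<close>, then
  \<open>of_int b / c * of_int s\<close> is an inverse of \<open>c\<close>.\<close>

lemma unit_mod_if_dvd_int:
  assumes "algebraic_int c" "c \<noteq> 0" "algebraic_int (of_int b / c)" "prime p" "\<not> int p dvd b"
  shows "unit_mod p c"
proof -
  have "coprime b (int p)"
    using assms(4,5) by (metis coprime_commute prime_imp_coprime prime_nat_int_transfer)
  then obtain s where "[b * s = 1] (mod int p)" using cong_solve_coprime_int by blast
  then have "int p dvd b * s - 1" by (simp add: cong_iff_dvd_diff)
  then have "in_pO p (of_int (b * s - 1))"
    using assms(4) by (subst in_pO_of_int_iff) (auto simp: prime_gt_0_nat)
  then have "in_pO p (c * (of_int b / c * of_int s) - 1)" using assms(2) by simp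
  moreover have "algebraic_int (of_int b / c * of_int s)" using assms by blast
  ultimately show ?thesis using assms unfolding unit_mod_def by blast
qed

lemma not_in_pO_if_unit_mod:
  assumes "unit_mod p c" "p > 1"
  shows "\<not> in_pO p c"
proof
  assume *: "in_pO p c"
  obtain t where t: "algebraic_int t" "in_pO p (c * t - 1)" using assms by (auto simp: unit_mod_def)
  have "in_pO p (t * c - (c * t - 1))" by (intro in_pO_diff in_pO_mult * t)
  then have "in_pO p (of_int 1)" by (simp add: mult.commute)
  then show False using assms(2) by (subst (asm) in_pO_of_int_iff) auto
qed

text \<open>The inner binomial coefficients are multiples of \<open>p\<close>, and oddness of
  \<open>p\<close> turns \<open>(- y) ^ p\<close> into \<open>- y ^ p\<close>.\<close>

lemma frobenius_diff_mod:
  assumes "prime p" "odd p" "algebraic_int x" "algebraic_int y"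
  shows "in_pO p ((x - y) ^ p - (x ^ p - y ^ p))"
proof -
  have p: "p > 1" using assms(1) prime_gt_1_nat by blast
  have "(x - y) ^ p = (\<Sum>k\<le>p. of_nat (p choose k) * x ^ k * (- y) ^ (p - k))"
    using binomial_ring[of x "- y" p] by simp
  also have "{..p} = insert 0 (insert p {0<..<p})" using p by auto
  also have "(\<Sum>k\<in>insert 0 (insert p {0<..<p}). of_nat (p choose k) * x ^ k * (- y) ^ (p - k)) =
     (- y) ^ p + (x ^ p + (\<Sum>k\<in>{0<..<p}. of_nat (p choose k) * x ^ k * (- y) ^ (p - k)))"
    using p by simp
  finally have "(x - y) ^ p - (x ^ p - y ^ p) = (\<Sum>k\<in>{0<..<p}. of_nat (p choose k) * x ^ k * (- y) ^ (p - k))"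
    using assms(2) by simp
  also have "in_pO p \<dots>"
  proof (rule in_pO_sum)
    fix k assume "k \<in> {0<..<p}"
    then have "p dvd (p choose k)" using assms(1) by (intro dvd_choose_prime) auto
    then obtain m where "p choose k = p * m" by auto
    then have "of_nat (p choose k) * x ^ k * (- y) ^ (p - k) = of_nat p * (of_nat m * x ^ k * (- y) ^ (p - k))"
      by (simp only: of_nat_mult mult.assoc)
    moreover have "in_pO p (of_nat p * (of_nat m * x ^ k * (- y) ^ (p - k)))"
      using p assms by (intro in_pO_of_nat_mult algebraic_int_mult algebraic_int_power algebraic_int_minus) auto
    ultimately show "in_pO p (of_nat (p choose k) * x ^ k * (- y) ^ (p - k))" by (simp only:)
  qed
  finally show ?thesis .
qed

text \<open>Turns a condition on \<open>g ^ d - h ^ d\<close> into one on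
  \<open>g ^ (d * p) - h ^ (d * p)\<close>. The exceptional primes are therefore governed by the
  small shift \<open>d\<close> alone, although the sums along m -> r + p m have the bases
  g^p.\<close>

lemma unit_mod_frobenius_diff:
  assumes "prime p" "odd p" "algebraic_int x" "algebraic_int y" "unit_mod p (x - y)"
  shows "unit_mod p (x ^ p - y ^ p)"
  by (rule unit_mod_cong[OF unit_mod_power[OF assms(5), of p]])
     (use frobenius_diff_mod[OF assms(1-4)] assms in auto)

text \<open>Count the ordered pairs of elements of \<open>Z\<close>: the diagonal, and for each
  distance \<open>d\<close> at most \<open>B\<close> pairs in either order. So |Z|^2 is at most |Z|
  + 2 L B, and with two or more points the diagonal takes at most half of |Z|^2.\<close>

lemma card_le_of_few_differences:
  fixes Z :: "nat set"
  assumes "Z \<subseteq> {u..<u+L}" "\<And>d. 1 \<le> d \<Longrightarrow> d < L \<Longrightarrow> real (card {m\<in>Z. m + d \<in> Z}) \<le> B"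
  shows "card Z \<le> 1 \<or> real (card Z) ^ 2 \<le> 4 * real L * B"
proof (cases "card Z \<le> 1")
  case False
  have fin: "finite Z" using assms(1) finite_subset by blast
  define Zd where "Zd d = {m\<in>Z. m + d \<in> Z}" for d
  have finZd: "finite (Zd d)" for d using fin by (simp add: Zd_def)
  obtain m1 m2 where m12: "m1 \<in> Z" "m2 \<in> Z" "m1 < m2"
  proof -
    obtain a b where "a \<in> Z" "b \<in> Z" "a \<noteq> b"
      using False fin card_le_Suc0_iff_eq[OF fin] by auto
    then show ?thesis using that by (cases "a < b") auto
  qed
  \<comment> \<open>Two distinct points supply an admissible distance, which yields the sign of
    \<open>B\<close>.\<close>
  have "m1 \<in> {u..<u + L}" "m2 \<in> {u..<u + L}" using m12 assms(1) by auto
  then have "m2 - m1 \<ge> 1 \<and> m2 - m1 < L" using m12(3) by auto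
  then have L: "L > 1" and B0: "B \<ge> 0" using assms(2)[of "m2 - m1"]
    by (auto intro: order_trans[OF of_nat_0_le_iff])
  define D1 where "D1 = (\<Union>d\<in>{1..<L}. (\<lambda>m. (m, m + d)) ` Zd d)"
  define D2 where "D2 = (\<Union>d\<in>{1..<L}. (\<lambda>m. (m + d, m)) ` Zd d)"
  have sub: "Z \<times> Z \<subseteq> (\<lambda>m. (m, m)) ` Z \<union> (D1 \<union> D2)"
  proof (rule subsetI, rule ccontr)
    fix z assume "z \<in> Z \<times> Z" and nz: "z \<notin> (\<lambda>m. (m, m)) ` Z \<union> (D1 \<union> D2)"
    then obtain a b where z: "z = (a, b)" and ab: "a \<in> Z" "b \<in> Z" by auto
    have nz1: "(a, b) \<notin> D1"
      and nz2: "(a, b) \<notin> D2"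
      using nz unfolding z by blast+
    have range: "u \<le> a" "a < u + L" "u \<le> b" "b < u + L" using ab assms(1) by auto
    have "\<not> a < b"
    proof
      assume "a < b"
      then have "(a, b) = (\<lambda>m. (m, m + (b - a))) a" "a \<in> Zd (b - a)" "b - a \<in> {1..<L}"
        using ab range by (auto simp: Zd_def)
      then show False using nz1 unfolding D1_def by (metis (no_types, lifting) UN_I image_eqI)
    qed
    moreover have "\<not> b < a"
    proof
      assume "b < a"
      then have "(a, b) = (\<lambda>m. (m + (a - b), m)) b" "b \<in> Zd (a - b)" "a - b \<in> {1..<L}"
        using ab range by (auto simp: Zd_def)
      then show False using nz2 unfolding D2_def by (metis (no_types, lifting) UN_I image_eqI)
    qed
    ultimately have "a = b" by simp
    then show False using ab nz unfolding z by blast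
  qed
  have bd: "card (\<Union>d\<in>{1..<L}. f d ` Zd d) \<le> (\<Sum>d\<in>{1..<L}. card (Zd d))" for f :: "nat \<Rightarrow> nat \<Rightarrow> nat \<times> nat"
  proof -
    have "card (\<Union>d\<in>{1..<L}. f d ` Zd d) \<le> (\<Sum>d\<in>{1..<L}. card (f d ` Zd d))"
      by (rule card_UN_le) simp
    also have "\<dots> \<le> (\<Sum>d\<in>{1..<L}. card (Zd d))" by (intro sum_mono card_image_le finZd)
    finally show ?thesis .
  qed
  have "card Z * card Z = card (Z \<times> Z)" by (simp add: card_cartesian_product)
  also have "\<dots> \<le> card ((\<lambda>m. (m, m)) ` Z \<union> (D1 \<union> D2))"
    by (rule card_mono[OF _ sub]) (use fin finZd in \<open>auto simp: D1_def D2_def\<close>)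
  also have "\<dots> \<le> card ((\<lambda>m. (m, m)) ` Z) + (card D1 + card D2)"
    by (meson card_Un_le order_trans add_mono order_refl)
  also have "\<dots> \<le> card Z + ((\<Sum>d\<in>{1..<L}. card (Zd d)) + (\<Sum>d\<in>{1..<L}. card (Zd d)))"
    unfolding D1_def D2_def by (intro add_mono bd card_image_le fin)
  finally have "real (card Z * card Z) \<le> real (card Z + ((\<Sum>d\<in>{1..<L}. card (Zd d)) + (\<Sum>d\<in>{1..<L}. card (Zd d))))"
    by (simp only: of_nat_le_iff)
  also have "\<dots> = real (card Z) + 2 * (\<Sum>d\<in>{1..<L}. real (card (Zd d)))" by simp
  also have "(\<Sum>d\<in>{1..<L}. real (card (Zd d))) \<le> (\<Sum>d\<in>{1..<L}. B)"
    by (rule sum_mono) (use assms(2) in \<open>auto simp: Zd_def\<close>)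
  also have "(\<Sum>d\<in>{1..<L}. B) \<le> real L * B" using L B0 by (simp add: mult_right_mono)
  finally have "real (card Z * card Z) \<le> real (card Z) + 2 * (real L * B)" by simp
  moreover have "2 * real (card Z) \<le> real (card Z) * real (card Z)"
    using False by (intro mult_right_mono) auto
  ultimately show ?thesis by (simp add: power2_eq_square)
qed simp

text \<open>Induction on the number of bases. If the sum f vanishes modulo \<open>p\<close> at m and
  m + d, then so does f(m + d) - g^(dp) f(m); the base \<open>g\<close> is gone from it, and the
  coefficient of each other \<open>h\<close> has been multiplied by the unit h^(dp) - g^(dp). Only
  the coefficient of \<delta>, which is never removed, has to be a unit; the others may vanish
  modulo \<open>p\<close>. A bound B for one base fewer turns into the square root of 4 L B: this
  halves the saving in the exponent and reproduces the constant 4.\<close>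

lemma exp_sum_zeros_in_window:
  fixes c :: "complex \<Rightarrow> complex"
  assumes "prime p" "odd p" "finite \<Gamma>" "card \<Gamma> = Suc k" "\<delta> \<in> \<Gamma>" "\<And>g. g \<in> \<Gamma> \<Longrightarrow> algebraic_int g"
    and "\<And>g. g \<in> \<Gamma> \<Longrightarrow> algebraic_int (c g)" "unit_mod p \<delta>" "unit_mod p (c \<delta>)"
    and units: "\<And>g h d. g \<in> \<Gamma> \<Longrightarrow> h \<in> \<Gamma> \<Longrightarrow> g \<noteq> h \<Longrightarrow> 1 \<le> d \<Longrightarrow> d < L \<Longrightarrow> unit_mod p (g ^ d - h ^ d)"
    and "L \<ge> 1" "Z \<subseteq> {u..<u+L}"
    and "\<And>m. m \<in> Z \<Longrightarrow> in_pO p (\<Sum>g\<in>\<Gamma>. c g * g ^ (p * m))"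
  shows "real (card Z) \<le> 4 * real L powr (1 - 1 / 2 ^ k)"
  using assms(3-9) units assms(12,13)
proof (induction k arbitrary: \<Gamma> c Z)
  case 0
  then have "\<Gamma> = {\<delta>}" by (metis card_1_singletonE One_nat_def singletonD)
  have "Z = {}"
  proof (rule ccontr)
    assume "Z \<noteq> {}"
    then obtain m where "m \<in> Z" by blast
    then have "in_pO p (c \<delta> * \<delta> ^ (p * m))" using 0(10)[of m] \<open>\<Gamma> = {\<delta>}\<close> by simp
    moreover have "unit_mod p (c \<delta> * \<delta> ^ (p * m))"
      using 0 by (intro unit_mod_mult unit_mod_power)
    ultimately show False using not_in_pO_if_unit_mod assms(1) prime_gt_1_nat by blast
  qed
  then show ?case by simp
next
  case (Suc k)
  define B where "B = 4 * real L powr (1 - 1 / 2 ^ k)"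
  have "\<Gamma> \<noteq> {\<delta>}" using Suc.prems(2) by auto
  then obtain g where g: "g \<in> \<Gamma>" "g \<noteq> \<delta>" using Suc.prems(3) by blast
  have "real (card {m\<in>Z. m + d \<in> Z}) \<le> B" if d: "1 \<le> d" "d < L" for d
    unfolding B_def
  proof (rule Suc.IH[where \<Gamma> = "\<Gamma> - {g}" and c = "\<lambda>h. c h * (h ^ (d * p) - g ^ (d * p))"])
    show "card (\<Gamma> - {g}) = Suc k" using Suc.prems(1,2) g by simp
    have gh: "unit_mod p (h ^ (d * p) - g ^ (d * p))" if "h \<in> \<Gamma>" "h \<noteq> g" for h
      unfolding power_mult using that g d Suc.prems(4)
      by (intro unit_mod_frobenius_diff assms(1,2) algebraic_int_power Suc.prems(8)) auto
    show "unit_mod p (c \<delta> * (\<delta> ^ (d * p) - g ^ (d * p)))"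
      using g Suc.prems by (intro unit_mod_mult gh) auto
    show "algebraic_int (c h * (h ^ (d * p) - g ^ (d * p)))" if "h \<in> \<Gamma> - {g}" for h
      using that g Suc.prems by (intro algebraic_int_mult algebraic_int_diff algebraic_int_power) auto
    show "in_pO p (\<Sum>h\<in>\<Gamma> - {g}. c h * (h ^ (d * p) - g ^ (d * p)) * h ^ (p * m))"
      if "m \<in> {m \<in> Z. m + d \<in> Z}" for m
    proof -
      have "in_pO p ((\<Sum>h\<in>\<Gamma>. c h * h ^ (p * (m + d))) - g ^ (d * p) * (\<Sum>h\<in>\<Gamma>. c h * h ^ (p * m)))"
        using that g Suc.prems(4) by (intro in_pO_diff in_pO_mult Suc.prems(10) algebraic_int_power) auto
      also have "(\<Sum>h\<in>\<Gamma>. c h * h ^ (p * (m + d))) - g ^ (d * p) * (\<Sum>h\<in>\<Gamma>. c h * h ^ (p * m)) =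
          (\<Sum>h\<in>\<Gamma>. c h * (h ^ (d * p) - g ^ (d * p)) * h ^ (p * m))"
        by (simp add: sum_distrib_left sum_subtractf[symmetric] power_add algebra_simps)
      also have "\<dots> = (\<Sum>h\<in>\<Gamma> - {g}. c h * (h ^ (d * p) - g ^ (d * p)) * h ^ (p * m))"
        by (rule sum.mono_neutral_right) (use Suc.prems(1) in auto)
      finally show ?thesis .
    qed
  qed (use Suc.prems g in auto)
  from card_le_of_few_differences[OF Suc.prems(9) this]
  have "card Z \<le> 1 \<or> real (card Z) ^ 2 \<le> 4 * real L * B" .
  then show ?case
  proof
    assume "card Z \<le> 1"
    then have "real (card Z) \<le> 4 * 1" by simp
    also have "\<dots> \<le> 4 * real L powr (1 - 1 / 2 ^ Suc k)"
      using assms(11) one_le_power[of "2 :: real" "Suc k"]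
      by (intro mult_left_mono ge_one_powr_ge_zero) (auto simp del: power_Suc simp: divide_le_eq)
    finally show ?thesis .
  next
    assume *: "real (card Z) ^ 2 \<le> 4 * real L * B"
    have e: "1 + (1 - 1 / 2 ^ k) = (1 - 1 / 2 ^ Suc k) + (1 - 1 / 2 ^ Suc k :: real)" by simp
    have "4 * real L * B = 16 * (real L powr 1 * real L powr (1 - 1 / 2 ^ k))"
      using assms(11) by (simp add: B_def)
    also have "\<dots> = 16 * (real L powr (1 - 1 / 2 ^ Suc k) * real L powr (1 - 1 / 2 ^ Suc k))"
      by (simp only: powr_add[symmetric] e)
    also have "\<dots> = (4 * real L powr (1 - 1 / 2 ^ Suc k)) ^ 2"
      by (simp add: power2_eq_square)
    finally show ?thesis using * by (metis powr_ge_zero mult_nonneg_nonneg power2_le_imp_le zero_le_numeral)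
  qed
qed

section \<open>Prime counting\<close>

lemma prod_primes_dvd:
  fixes N :: nat
  assumes "finite P" "\<And>p. p \<in> P \<Longrightarrow> prime p \<and> p dvd N"
  shows "\<Prod>P dvd N"
  using assms
proof (induction P rule: finite_induct)
  case (insert p P)
  have "coprime p (\<Prod>P)"
    by (rule prod_coprime_right) (use insert in \<open>auto intro!: primes_coprime\<close>)
  then show ?case using insert by (auto intro: divides_mult)
qed simp

lemma card_prime_divisors_le:
  assumes "b \<noteq> 0" "\<bar>b\<bar> \<le> (2 :: int) ^ C"
  shows "finite {p. prime p \<and> int p dvd b}" "card {p. prime p \<and> int p dvd b} \<le> C"
proof -
  define P where "P = {p. prime p \<and> int p dvd b}"
  define N where "N = nat \<bar>b\<bar>"
  have N: "N > 0" "N \<le> 2 ^ C" using assms by (auto simp: N_def nat_le_iff)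
  have dv: "p dvd N" if "p \<in> P" for p
    using that by (auto simp: P_def N_def nat_dvd_iff int_dvd_int_iff[symmetric])
  show fin: "finite {p. prime p \<and> int p dvd b}"
    by (rule finite_subset[of _ "{..N}"]) (use dv N in \<open>auto simp: P_def dest!: dvd_imp_le\<close>)
  have "2 ^ card P \<le> \<Prod>P"
    by (subst prod_constant[symmetric], rule prod_mono) (auto simp: P_def prime_ge_2_nat)
  also have "\<dots> \<le> N"
  proof (rule dvd_imp_le)
    show "\<Prod>P dvd N"
      by (rule prod_primes_dvd) (use dv fin in \<open>auto simp: P_def\<close>)
  qed (rule N)
  finally have "2 ^ card P \<le> (2 ^ C :: nat)" using N by linarith
  then show "card {p. prime p \<and> int p dvd b} \<le> C"
    unfolding P_def by (rule power_le_imp_le_exp[rotated]) simp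
qed

definition dyadic_primes :: "nat \<Rightarrow> nat set" where
  "dyadic_primes j = {p. prime p \<and> 2 ^ j < p \<and> p \<le> 2 ^ Suc j}"

lemma finite_dyadic_primes [simp]: "finite (dyadic_primes j)"
  by (rule finite_subset[of _ "{..2 ^ Suc j}"]) (auto simp: dyadic_primes_def)

text \<open>Chebyshev's argument: with n = 2^j, each prime in the block exceeds n and divides the
  central binomial coefficient of 2n, which is at most 2^(2n).\<close>

lemma card_dyadic_primes: "card (dyadic_primes j) * j \<le> 2 ^ Suc j"
proof -
  define n where "n = (2 :: nat) ^ j"
  define N where "N = (2 * n) choose n"
  have dv: "p dvd N" if "p \<in> dyadic_primes j" for p
  proof -
    have p: "prime p" "n < p" "p \<le> 2 * n" using that by (auto simp: dyadic_primes_def n_def)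
    have "fact n * fact (2 * n - n) * N = fact (2 * n)"
      unfolding N_def by (rule binomial_fact_lemma) simp
    moreover have "p dvd fact (2 * n)" using p prime_dvd_fact_iff[of p "2 * n"] by simp
    ultimately have "p dvd fact n * fact n * N" by simp
    then show ?thesis using p by (auto simp: prime_dvd_mult_iff prime_dvd_fact_iff)
  qed
  have "(2 ^ j) ^ card (dyadic_primes j) \<le> \<Prod>(dyadic_primes j)"
    by (subst prod_constant[symmetric], rule prod_mono) (auto simp: dyadic_primes_def)
  also have "\<dots> \<le> N"
  proof (rule dvd_imp_le)
    show "\<Prod>(dyadic_primes j) dvd N"
      by (rule prod_primes_dvd) (use dv in \<open>auto simp: dyadic_primes_def\<close>)
    show "N > 0" unfolding N_def by (rule zero_less_binomial) simp
  qed
  also have "N \<le> 2 ^ (2 * n)" unfolding N_def by (rule binomial_le_pow2)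
  finally have "(2 :: nat) ^ (j * card (dyadic_primes j)) \<le> 2 ^ (2 * n)" by (simp only: power_mult)
  then have "j * card (dyadic_primes j) \<le> 2 * n" by (rule power_le_imp_le_exp[rotated]) simp
  then show ?thesis by (simp add: n_def mult.commute)
qed

lemma primes_le_two_power_Suc:
  "{p. prime p \<and> p \<le> 2 ^ Suc J} = {p. prime p \<and> p \<le> 2 ^ J} \<union> dyadic_primes J"
  "{p. prime p \<and> p \<le> (2 :: nat) ^ J} \<inter> dyadic_primes J = {}"
  using power_increasing[of J "Suc J" "2 :: nat"] by (auto simp: dyadic_primes_def)

lemma finite_primes_le [simp]: "finite {p::nat. prime p \<and> p \<le> x}"
  by (rule finite_subset[of _ "{..x}"]) auto

lemma sum_inverse_dyadic_primes:
  assumes "j > 0"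
  shows "(\<Sum>p\<in>dyadic_primes j. 1 / real p) \<le> 2 / real j"
proof -
  have "(\<Sum>p\<in>dyadic_primes j. 1 / real p) \<le> (\<Sum>p\<in>dyadic_primes j. 1 / 2 ^ j)"
  proof (rule sum_mono)
    fix p assume "p \<in> dyadic_primes j"
    then have "2 ^ j \<le> p" by (simp add: dyadic_primes_def)
    then have "2 ^ j \<le> real p" by (metis of_nat_le_iff of_nat_numeral of_nat_power)
    then show "1 / real p \<le> 1 / 2 ^ j" by (simp add: frac_le)
  qed
  also have "\<dots> = real (card (dyadic_primes j)) / 2 ^ j" by simp
  also have "\<dots> \<le> 2 / real j"
  proof -
    have "real (card (dyadic_primes j) * j) \<le> real (2 ^ Suc j)"
      using card_dyadic_primes by (simp only: of_nat_le_iff)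
    then show ?thesis using assms by (simp add: field_simps)
  qed
  finally show ?thesis .
qed

text \<open>Block j contributes at most 2 / j, hence at most \<epsilon> from some block on. A sum of
  size o(J) is all that the sieve needs: exponentiated, it is an arbitrarily small power of
  2^J.\<close>

lemma sum_inverse_primes_le:
  assumes "\<epsilon> > 0"
  shows "\<exists>C. \<forall>J. (\<Sum>p | prime p \<and> p \<le> 2 ^ J. 1 / real p) \<le> C + \<epsilon> * real J"
proof -
  define S where "S J = (\<Sum>p | prime p \<and> p \<le> (2::nat) ^ J. 1 / real p)" for J
  define K where "K = nat \<lceil>2 / \<epsilon>\<rceil> + 1"
  have K: "2 / real j \<le> \<epsilon>" if "j \<ge> K" for j
  proof -
    have "2 / \<epsilon> \<le> real j" using that unfolding K_def by linarith
    moreover have "j > 0" using that by (simp add: K_def)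
    ultimately show ?thesis using assms by (simp add: field_simps)
  qed
  have step: "S (Suc J) = S J + (\<Sum>p\<in>dyadic_primes J. 1 / real p)" for J
    unfolding S_def primes_le_two_power_Suc by (rule sum.union_disjoint) (auto simp: primes_le_two_power_Suc)
  have mono: "S J \<le> S (Suc J)" for J unfolding step by (simp add: sum_nonneg)
  have "S J \<le> S K + \<epsilon> * real J" for J
  proof (induction J)
    case 0
    have "S 0 \<le> S K" using mono lift_Suc_mono_le[of S 0 K] by simp
    then show ?case by simp
  next
    case (Suc J)
    show ?case
    proof (cases "Suc J \<le> K")
      case True
      then have "S (Suc J) \<le> S K" using mono lift_Suc_mono_le[of S "Suc J" K] by simp
      moreover have "0 \<le> \<epsilon> * real (Suc J)" using assms by simp
      ultimately show ?thesis by linarith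
    next
      case False
      then have "J \<ge> K" by simp
      then have "(\<Sum>p\<in>dyadic_primes J. 1 / real p) \<le> \<epsilon>"
        using sum_inverse_dyadic_primes[of J] K[of J] by (simp add: K_def)
      moreover have "\<epsilon> * real (Suc J) = \<epsilon> * real J + \<epsilon>" by (simp add: algebra_simps)
      ultimately show ?thesis using Suc.IH step[of J] by linarith
    qed
  qed
  then show ?thesis unfolding S_def by blast
qed

text \<open>From some block on, block J holds at most \<epsilon> / 2 times 2^J primes, and these
  bounds add up geometrically. The factor 1/2 is spent on rounding \<open>x\<close> up to a power of
  two.\<close>

lemma card_primes_le:
  assumes "\<epsilon> > 0"
  shows "\<exists>C. \<forall>x. real (card {p. prime p \<and> p \<le> x}) \<le> C + \<epsilon> * real x"
proof -
  define S where "S J = real (card {p. prime p \<and> p \<le> (2::nat) ^ J})" for J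
  define K where "K = nat \<lceil>4 / \<epsilon>\<rceil> + 1"
  have step: "S (Suc J) = S J + real (card (dyadic_primes J))" for J
    unfolding S_def primes_le_two_power_Suc by (subst card_Un_disjoint) (auto simp: primes_le_two_power_Suc)
  have mono: "S J \<le> S (Suc J)" for J unfolding step by simp
  have dy: "real (card (dyadic_primes J)) \<le> \<epsilon> / 2 * 2 ^ J" if "J \<ge> K" for J
  proof -
    have J: "4 / \<epsilon> \<le> real J" "J > 0" using that unfolding K_def by linarith+
    have "real (card (dyadic_primes J) * J) \<le> real (2 ^ Suc J)"
      using card_dyadic_primes by (simp only: of_nat_le_iff)
    then have "real (card (dyadic_primes J)) \<le> 2 * 2 ^ J / real J" using J by (simp add: field_simps)
    also have "\<dots> \<le> \<epsilon> / 2 * 2 ^ J"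
      using J assms by (simp add: field_simps)
    finally show ?thesis .
  qed
  have main: "S J \<le> S K + \<epsilon> / 2 * 2 ^ J" for J
  proof (induction J)
    case 0
    have "S 0 \<le> S K" using mono lift_Suc_mono_le[of S 0 K] by simp
    then show ?case using assms by simp
  next
    case (Suc J)
    show ?case
    proof (cases "Suc J \<le> K")
      case True
      then have "S (Suc J) \<le> S K" using mono lift_Suc_mono_le[of S "Suc J" K] by simp
      then show ?thesis using assms by (simp add: add_increasing2)
    next
      case False
      then have "J \<ge> K" by simp
      then have "real (card (dyadic_primes J)) \<le> \<epsilon> / 2 * 2 ^ J" by (rule dy)
      moreover have "\<epsilon> / 2 * 2 ^ Suc J = \<epsilon> / 2 * 2 ^ J + \<epsilon> / 2 * 2 ^ J" by simp
      ultimately show ?thesis using Suc.IH step[of J] by linarith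
    qed
  qed
  have "real (card {p. prime p \<and> p \<le> x}) \<le> (S K + \<epsilon>) + \<epsilon> * real x" for x
  proof (cases "x = 0")
    case True
    then have "{p. prime p \<and> p \<le> x} = {}" by (auto dest: prime_gt_0_nat)
    then have "real (card {p. prime p \<and> p \<le> x}) = 0" by (simp only: card.empty of_nat_0)
    moreover have "S K \<ge> 0" "\<epsilon> * real x = 0" by (simp_all add: S_def True)
    ultimately show ?thesis using assms by linarith
  next
    case False
    obtain J where J: "2 ^ J \<le> x" "x < 2 ^ Suc J" using ex_power_ivl1[of 2 x] False by auto
    have "card {p. prime p \<and> p \<le> x} \<le> card {p. prime p \<and> p \<le> (2::nat) ^ Suc J}"
      by (rule card_mono) (use J in auto)
    then have "real (card {p. prime p \<and> p \<le> x}) \<le> S (Suc J)" by (simp add: S_def)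
    also have "\<dots> \<le> S K + \<epsilon> / 2 * 2 ^ Suc J" by (rule main)
    also have "\<dots> \<le> S K + \<epsilon> * real x"
    proof -
      have "2 ^ J \<le> real x" using J(1) by (metis of_nat_le_iff of_nat_numeral of_nat_power)
      then show ?thesis using assms by simp
    qed
    finally show ?thesis using assms by simp
  qed
  then show ?thesis by blast
qed

section \<open>Power sums compared with integrals\<close>

lemma sum_powr_le:
  assumes "0 < \<gamma>" "\<gamma> \<le> 1"
  shows "(\<Sum>n=1..N. real n powr (\<gamma> - 1)) \<le> real N powr \<gamma> / \<gamma>"
proof (induction N)
  case 0
  then show ?case by simp
next
  case (Suc N)
  have "\<gamma> * real (Suc N) powr (\<gamma> - 1) \<le> real (Suc N) powr \<gamma> - real N powr \<gamma>"
  proof (cases "N = 0")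
    case True
    then show ?thesis using assms by simp
  next
    case False
    then have N: "real N > 0" by simp
    have "\<exists>t. real N < t \<and> t < real (Suc N) \<and>
        real (Suc N) powr \<gamma> - real N powr \<gamma> = (real (Suc N) - real N) * (\<gamma> * t powr (\<gamma> - 1))"
      by (rule MVT2[where f = "\<lambda>t. t powr \<gamma>"]) (use N in \<open>auto intro!: derivative_eq_intros\<close>)
    then obtain t where t: "real N < t" "t < real (Suc N)"
        "real (Suc N) powr \<gamma> - real N powr \<gamma> = \<gamma> * t powr (\<gamma> - 1)" by auto
    have "real (Suc N) powr (\<gamma> - 1) \<le> t powr (\<gamma> - 1)"
      by (rule powr_mono2') (use t N assms in auto)
    then show ?thesis using t(3) assms by simp
  qed
  then have "real (Suc N) powr (\<gamma> - 1) \<le> real (Suc N) powr \<gamma> / \<gamma> - real N powr \<gamma> / \<gamma>"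
    using assms by (simp add: field_simps)
  then show ?case using Suc by simp
qed

text \<open>The induction carries the sharper bound with the value at \<open>z + m\<close>
  subtracted, so that it telescopes.\<close>

lemma sum_powr_tail_le:
  assumes "0 < \<eta>" "1 \<le> z"
  shows "(\<Sum>n\<in>{z<..N}. real n powr (- \<eta> - 1)) \<le> real z powr (- \<eta>) / \<eta>"
proof -
  have "(\<Sum>n\<in>{z<..z+m}. real n powr (- \<eta> - 1)) \<le> real z powr (- \<eta>) / \<eta> - real (z + m) powr (- \<eta>) / \<eta>" for m
  proof (induction m)
    case 0
    then show ?case by simp
  next
    case (Suc m)
    define n where "n = z + m"
    have n: "real n > 0" using assms by (simp add: n_def)
    have "\<exists>t. real n < t \<and> t < real (Suc n) \<and>
        real (Suc n) powr (- \<eta>) - real n powr (- \<eta>) = (real (Suc n) - real n) * (- \<eta> * t powr (- \<eta> - 1))"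
      by (rule MVT2[where f = "\<lambda>t. t powr (- \<eta>)"]) (use n in \<open>auto intro!: derivative_eq_intros\<close>)
    then obtain t where t: "real n < t" "t < real (Suc n)"
      "real (Suc n) powr (- \<eta>) - real n powr (- \<eta>) = - \<eta> * t powr (- \<eta> - 1)" by auto
    have "real (Suc n) powr (- \<eta> - 1) \<le> t powr (- \<eta> - 1)"
      by (rule powr_mono2') (use t n assms in auto)
    then have "\<eta> * real (Suc n) powr (- \<eta> - 1) \<le> \<eta> * t powr (- \<eta> - 1)"
      using assms by (intro mult_left_mono) auto
    then have "\<eta> * real (Suc n) powr (- \<eta> - 1) \<le> real n powr (- \<eta>) - real (Suc n) powr (- \<eta>)"
      using t(3) by linarith
    then have "real (Suc n) powr (- \<eta> - 1) \<le> real n powr (- \<eta>) / \<eta> - real (Suc n) powr (- \<eta>) / \<eta>"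
      using assms by (simp add: field_simps)
    moreover have "{z<..z + Suc m} = insert (Suc n) {z<..z + m}" by (auto simp: n_def)
    ultimately show ?case using Suc by (simp add: n_def)
  qed
  note * = this[of "N - z"]
  have "{z<..N} \<subseteq> {z<..z + (N - z)}" by auto
  then have "(\<Sum>n\<in>{z<..N}. real n powr (- \<eta> - 1)) \<le> (\<Sum>n\<in>{z<..z + (N - z)}. real n powr (- \<eta> - 1))"
    by (intro sum_mono2) auto
  also have "\<dots> \<le> real z powr (- \<eta>) / \<eta>"
    using * assms by (rule_tac order_trans[OF *]) simp
  finally show ?thesis .
qed

section \<open>Summation over primes\<close>

text \<open>
  The bound on windows is only available for lengths \<open>L \<le> p powr (1/4)\<close>: the primes for which it fails
  at such a length are sparse, see \<open>sum_inverse_bad_primes_le\<close>.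
\<close>

lemma card_residue_class_le:
  fixes V :: "nat set"
  assumes "p > 0" "V \<subseteq> {..X}" "\<And>m n. m \<in> V \<Longrightarrow> n \<in> V \<Longrightarrow> m mod p = n mod p"
    and "0 < \<gamma>" "\<gamma> \<le> 1"
    and windows: "\<And>L u Z. L \<ge> 1 \<Longrightarrow> L ^ 4 \<le> p \<Longrightarrow> Z \<subseteq> {u..<u+L} \<Longrightarrow> Z \<subseteq> (\<lambda>m. m div p) ` V \<Longrightarrow>
        real (card Z) \<le> 4 * real L powr (1 - \<gamma>)"
  shows "real (card V) \<le> 16 * (real X / real p + 1) * real p powr (- \<gamma> / 4)
           + 16 * (real X / real p + 1) powr (1 - \<gamma>)"
proof -
  define J where "J = (\<lambda>m. m div p) ` V"
  define M where "M = X div p"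
  define N where "N = real X / real p + 1"
  have finV: "finite V" using assms(2) finite_subset by blast
  \<comment> \<open>Within one residue class an element is determined by its quotient, so it
    suffices to count quotients up to X / p.\<close>
  have "inj_on (\<lambda>m. m div p) V"
    by (rule inj_onI) (metis assms(3) div_mult_mod_eq)
  then have cV: "card V = card J" by (simp add: J_def card_image)
  have JM: "J \<subseteq> {..M}" using assms(2) by (auto simp: J_def M_def intro!: div_le_mono)
  have MN: "real M + 1 \<le> N" unfolding M_def N_def
    using of_nat_div_le_of_nat[of X p, where 'a = real] by simp
  have NM: "N \<le> 2 * (real M + 1)"
  proof -
    have "real X / real p \<le> real M + 1"
      using of_nat_of_nat_div_aux[of X p, where 'a = real] mod_less_divisor[OF assms(1), of X] assms(1)
      by (simp add: M_def)
    then show ?thesis by (simp add: N_def)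
  qed
  have N1: "N \<ge> 1" by (simp add: N_def)
  \<comment> \<open>The largest window length whose fourth power is at most
    \<open>p\<close>.\<close>
  define Q where "Q = nat \<lfloor>real p powr (1 / 4)\<rfloor>"
  have p1: "1 \<le> real p powr (1 / 4)" using assms(1) by (intro ge_one_powr_ge_zero) auto
  then have Q1: "Q \<ge> 1" unfolding Q_def by linarith
  have Qle: "real Q \<le> real p powr (1 / 4)" unfolding Q_def using p1 by linarith
  have Qge: "real p powr (1 / 4) \<le> 2 * real Q"
  proof -
    have "real p powr (1 / 4) \<le> real Q + 1" unfolding Q_def using p1 by linarith
    then show ?thesis using Q1 by linarith
  qed
  have "real (Q ^ 4) \<le> (real p powr (1 / 4)) ^ 4" using power_mono[OF Qle, of 4] by simp
  also have "\<dots> = real p" using assms(1) by (simp add: powr_realpow[symmetric] powr_powr)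
  finally have Q4: "Q ^ 4 \<le> p" by (simp only: of_nat_le_iff)
  \<comment> \<open>If all quotients up to \<open>M\<close> fit into one admissible window, nothing
    is gained by a longer one.\<close>
  define L where "L = min Q (M + 1)"
  have L: "L \<ge> 1" "L ^ 4 \<le> p" "real L \<le> N"
  proof -
    show "L \<ge> 1" using Q1 by (simp add: L_def)
    show "L ^ 4 \<le> p" using power_mono[of L Q 4] Q4 unfolding L_def by linarith
    have "real L \<le> real (M + 1)" unfolding L_def by simp
    then show "real L \<le> N" using MN by simp
  qed
  define B where "B = 4 * real L powr (1 - \<gamma>)"
  have sub: "J \<subseteq> (\<Union>i\<in>{..M div L}. J \<inter> {i * L..<i * L + L})"
  proof
    fix j assume j: "j \<in> J"
    have "j div L \<le> M div L" using j JM by (auto intro: div_le_mono)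
    moreover have "j div L * L \<le> j" by simp
    moreover have "j < j div L * L + L"
      using L(1) dividend_less_div_times[of L j] by simp
    ultimately show "j \<in> (\<Union>i\<in>{..M div L}. J \<inter> {i * L..<i * L + L})"
      using j by (intro UN_I[of "j div L"]) auto
  qed
  have "card J \<le> card (\<Union>i\<in>{..M div L}. J \<inter> {i * L..<i * L + L})"
    by (rule card_mono[OF _ sub]) auto
  also have "\<dots> \<le> (\<Sum>i\<in>{..M div L}. card (J \<inter> {i * L..<i * L + L}))" by (rule card_UN_le) simp
  finally have "real (card J) \<le> (\<Sum>i\<in>{..M div L}. real (card (J \<inter> {i * L..<i * L + L})))"
    by (metis of_nat_le_iff of_nat_sum)
  also have "\<dots> \<le> (\<Sum>i\<in>{..M div L}. B)"
    by (intro sum_mono) (unfold B_def, rule windows[OF L(1,2)], auto simp: J_def)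
  also have "\<dots> = (real (M div L) + 1) * B" by simp
  also have "\<dots> \<le> (2 * N / real L) * B"
  proof (rule mult_right_mono)
    have "real (M div L) \<le> real M / real L" by (rule of_nat_div_le_of_nat)
    also have "\<dots> \<le> N / real L" using MN by (intro divide_right_mono) auto
    finally show "real (M div L) + 1 \<le> 2 * N / real L" using L(1,3) by (simp add: field_simps)
  qed (simp add: B_def)
  also have "\<dots> = 8 * N * real L powr (- \<gamma>)"
  proof -
    have "real L powr (1 - \<gamma>) = real L * real L powr (- \<gamma>)"
      using L(1) powr_add[of "real L" 1 "- \<gamma>"] by simp
    then show ?thesis using L(1) by (simp add: B_def)
  qed
  \<comment> \<open>The two terms of the conclusion come from the two cases of the minimum:
    \<open>L\<close> is comparable to p^(1/4) or to \<open>N\<close>.\<close>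
  also have "real L powr (- \<gamma>) \<le> 2 * real p powr (- \<gamma> / 4) + 2 * N powr (- \<gamma>)"
  proof -
    have half: "y powr (- \<gamma>) \<le> 2 * x powr (- \<gamma>)" if "0 < x" "x \<le> 2 * y" for x y :: real
    proof -
      have "y powr (- \<gamma>) \<le> (x / 2) powr (- \<gamma>)" using that assms by (intro powr_mono2') auto
      also have "\<dots> = 2 powr \<gamma> * x powr (- \<gamma>)"
        using that by (simp add: powr_divide powr_minus_divide)
      also have "2 powr \<gamma> \<le> (2 :: real) powr 1" using assms by (intro powr_mono) auto
      finally show ?thesis by (simp add: mult_right_mono)
    qed
    have p4: "(real p powr (1 / 4)) powr (- \<gamma>) = real p powr (- \<gamma> / 4)" by (simp add: powr_powr)
    show ?thesis
    proof (cases "Q \<le> M + 1")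
      case True
      then have "real L powr (- \<gamma>) \<le> 2 * (real p powr (1 / 4)) powr (- \<gamma>)"
        using Qge p1 assms(1) by (intro half) (auto simp: L_def)
      moreover have "0 \<le> 2 * N powr (- \<gamma>)" by simp
      ultimately show ?thesis unfolding p4 by linarith
    next
      case False
      then have "real L powr (- \<gamma>) \<le> 2 * N powr (- \<gamma>)"
        using NM N1 by (intro half) (auto simp: L_def)
      moreover have "0 \<le> 2 * real p powr (- \<gamma> / 4)" by simp
      ultimately show ?thesis by linarith
    qed
  qed
  finally have "real (card J) \<le> 8 * N * (2 * real p powr (- \<gamma> / 4) + 2 * N powr (- \<gamma>))"
    using N1 by (simp add: mult_left_mono)
  also have "\<dots> = 16 * N * real p powr (- \<gamma> / 4) + 16 * (N * N powr (- \<gamma>))" by (simp add: algebra_simps)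
  also have "N * N powr (- \<gamma>) = N powr (1 - \<gamma>)"
    using N1 powr_add[of N 1 "- \<gamma>"] by simp
  finally show ?thesis unfolding cV N_def .
qed

lemma card_residue_class_le':
  fixes V :: "nat set"
  assumes "p > 0" "V \<subseteq> {..X}" "\<And>m n. m \<in> V \<Longrightarrow> n \<in> V \<Longrightarrow> m mod p = n mod p"
  shows "real (card V) \<le> real X / real p + 1"
proof -
  have "inj_on (\<lambda>m. m div p) V"
    by (rule inj_onI) (metis assms(3) div_mult_mod_eq)
  then have "card V = card ((\<lambda>m. m div p) ` V)" by (simp add: card_image)
  also have "\<dots> \<le> card {..X div p}"
    by (rule card_mono) (use assms(2) in \<open>auto intro!: div_le_mono\<close>)
  finally have "real (card V) \<le> real (X div p) + 1" by simp
  then show ?thesis using of_nat_div_le_of_nat[of X p, where 'a = real] by linarith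
qed

lemma sum_UN_le:
  fixes f :: "'a \<Rightarrow> real"
  assumes "finite A" "\<And>x. x \<in> A \<Longrightarrow> finite (B x)" "\<And>p. f p \<ge> 0"
  shows "(\<Sum>p\<in>(\<Union>x\<in>A. B x). f p) \<le> (\<Sum>x\<in>A. \<Sum>p\<in>B x. f p)"
  using assms
proof (induction A rule: finite_induct)
  case (insert a A)
  have "sum f (B a \<union> (\<Union>x\<in>A. B x)) + sum f (B a \<inter> (\<Union>x\<in>A. B x)) = sum f (B a) + sum f (\<Union>x\<in>A. B x)"
    by (rule sum.union_inter) (use insert in auto)
  moreover have "sum f (B a \<inter> (\<Union>x\<in>A. B x)) \<ge> 0" by (rule sum_nonneg) (rule insert.prems)
  moreover have "sum f (\<Union>x\<in>A. B x) \<le> (\<Sum>x\<in>A. sum f (B x))" using insert by simp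
  ultimately show ?case using insert.hyps by simp
qed (simp_all)

lemma sum_inverse_squares_le: "(\<Sum>d=1..N. 1 / (real d)\<^sup>2) \<le> 2"
proof -
  have "(\<Sum>d=1..Suc N. 1 / (real d)\<^sup>2) \<le> 2 - 1 / real (Suc N)" for N
  proof (induction N)
    case (Suc N)
    have "1 / (real (Suc (Suc N)))\<^sup>2 \<le> 1 / real (Suc N) - 1 / real (Suc (Suc N))"
      by (simp add: divide_simps power2_eq_square)
    then show ?case using Suc by simp
  qed simp
  note * = this
  show ?thesis
  proof (cases N)
    case (Suc M)
    have "1 / real (Suc M) \<ge> 0" by simp
    then show ?thesis unfolding Suc using *[of M] by linarith
  qed simp
qed

text \<open>A shift \<open>d\<close> accounts for at most 2 C d primes per index, each at least d^4
  and above \<open>z\<close>. Writing 1/p as p^(-1/4) p^(-3/4) bounds their contribution by 2 C d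
  z^(-1/4) d^(-3), which is summable over \<open>d\<close>. Any power of \<open>d\<close> above the
  square would give convergence; the fourth leaves a quarter power of \<open>z\<close>.\<close>

lemma sum_inverse_bad_primes_le:
  fixes S :: "'i \<Rightarrow> nat \<Rightarrow> nat set"
  assumes "finite I"
    and S: "\<And>i d. i \<in> I \<Longrightarrow> d \<ge> 1 \<Longrightarrow> finite (S i d) \<and> card (S i d) \<le> C * (d + 1)"
    and bad: "\<And>p. bad p \<Longrightarrow> \<exists>i\<in>I. \<exists>d\<ge>1. d ^ 4 \<le> p \<and> p \<in> S i d"
    and "z \<ge> 1"
  shows "(\<Sum>p | bad p \<and> z < p \<and> p \<le> N. 1 / real p) \<le> 4 * real C * real (card I) * real z powr (- 1 / 4)"
proof -
  define T where "T i d = {p \<in> S i d. d ^ 4 \<le> p \<and> z < p}" for i d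
  have finT: "finite (T i d)" if "i \<in> I" "d \<ge> 1" for i d
    using S[OF that] by (simp add: T_def)
  have "(\<Sum>p | bad p \<and> z < p \<and> p \<le> N. 1 / real p) \<le> (\<Sum>p\<in>(\<Union>x\<in>I \<times> {1..N}. T (fst x) (snd x)). 1 / real p)"
  proof (rule sum_mono2)
    show "finite (\<Union>x\<in>I \<times> {1..N}. T (fst x) (snd x))" using assms(1) finT by auto
    show "{p. bad p \<and> z < p \<and> p \<le> N} \<subseteq> (\<Union>x\<in>I \<times> {1..N}. T (fst x) (snd x))"
    proof
      fix p assume p: "p \<in> {p. bad p \<and> z < p \<and> p \<le> N}"
      then obtain i d where id: "i \<in> I" "d \<ge> 1" "d ^ 4 \<le> p" "p \<in> S i d" using bad by blast
      have "d \<le> d ^ 4" using id(2) self_le_power[of d 4] by simp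
      then have "d \<le> N" using id p by auto
      then show "p \<in> (\<Union>x\<in>I \<times> {1..N}. T (fst x) (snd x))" using id p by (force simp: T_def)
    qed
  qed simp
  also have "\<dots> \<le> (\<Sum>x\<in>I \<times> {1..N}. \<Sum>p\<in>T (fst x) (snd x). 1 / real p)"
    by (rule sum_UN_le) (use assms(1) finT in auto)
  also have "\<dots> \<le> (\<Sum>x\<in>I \<times> {1..N}. 2 * real C * real z powr (- 1 / 4) * (1 / (real (snd x))\<^sup>2))"
  proof (rule sum_mono)
    fix x assume x: "x \<in> I \<times> {1..N}"
    define d where "d = snd x"
    have d: "d \<ge> 1" "fst x \<in> I" using x by (auto simp: d_def)
    have "(\<Sum>p\<in>T (fst x) d. 1 / real p) \<le> (\<Sum>p\<in>T (fst x) d. real z powr (- 1 / 4) * (1 / real d ^ 3))"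
    proof (rule sum_mono)
      fix p assume p: "p \<in> T (fst x) d"
      have p0: "real p > 0" using p by (auto simp: T_def)
      have "1 / real p = real p powr (- 1 / 4) * real p powr (- 3 / 4)"
        using p0 by (simp add: powr_add[symmetric] powr_minus_divide)
      also have "\<dots> \<le> real z powr (- 1 / 4) * real (d ^ 4) powr (- 3 / 4)"
        using p assms(4) d(1) by (intro mult_mono powr_mono2') (auto simp: T_def simp del: of_nat_power)
      also have "real (d ^ 4) powr (- 3 / 4) = 1 / real d ^ 3"
      proof -
        have "real (d ^ 4) powr (- 3 / 4) = (real d powr 4) powr (- 3 / 4)" using d by simp
        also have "\<dots> = real d powr (- 3)" by (simp only: powr_powr) simp
        also have "\<dots> = 1 / real d ^ 3" using d by (simp add: powr_minus_divide)
        finally show ?thesis .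
      qed
      finally show "1 / real p \<le> real z powr (- 1 / 4) * (1 / real d ^ 3)" .
    qed
    also have "\<dots> = real (card (T (fst x) d)) * (real z powr (- 1 / 4) * (1 / real d ^ 3))" by simp
    also have "\<dots> \<le> real (2 * C * d) * (real z powr (- 1 / 4) * (1 / real d ^ 3))"
    proof (rule mult_right_mono)
      have "card (T (fst x) d) \<le> card (S (fst x) d)"
        using S[OF d(2,1)] by (intro card_mono) (auto simp: T_def)
      also have "\<dots> \<le> C * (d + 1)" using S[OF d(2,1)] by simp
      also have "\<dots> \<le> 2 * C * d" using d(1) by simp
      finally show "real (card (T (fst x) d)) \<le> real (2 * C * d)" by (simp only: of_nat_le_iff)
    qed simp
    also have "\<dots> = 2 * real C * real z powr (- 1 / 4) * (1 / (real d)\<^sup>2)"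
      using d by (simp add: field_simps power2_eq_square power3_eq_cube)
    finally show "(\<Sum>p\<in>T (fst x) (snd x). 1 / real p) \<le> 2 * real C * real z powr (- 1 / 4) * (1 / (real (snd x))\<^sup>2)"
      by (simp add: d_def)
  qed
  also have "\<dots> = real (card I) * (2 * real C * real z powr (- 1 / 4)) * (\<Sum>d=1..N. 1 / (real d)\<^sup>2)"
    by (simp add: sum.cartesian_product' sum_distrib_left)
  also have "\<dots> \<le> real (card I) * (2 * real C * real z powr (- 1 / 4)) * 2"
    by (intro mult_left_mono sum_inverse_squares_le) auto
  finally show ?thesis by (simp add: mult_ac)
qed

text \<open>The primes are cut at X / W, where \<open>W\<close> depends on \<epsilon> but not on
  \<open>X\<close>. Above the cut (\<open>P1\<close>) each residue class has at most W + 1 members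
  and there are o(X) primes. Below it X/p + 1 is at most 2 X/p. The bad primes (\<open>P2\<close>)
  then have a sparse reciprocal sum. For the others (\<open>P3\<close>) the first term of the window
  bound sums to O(z^(-\<gamma>/4)) X and the second to O(W^(-\<gamma>)) X. This last sum is the
  reason for the cut: taken up to \<open>X\<close>, its bound would be a constant multiple of
  \<open>X\<close>.\<close>

lemma tail_sum_bound:
  fixes v :: "nat \<Rightarrow> nat \<Rightarrow> real"
  assumes \<gamma>: "0 < \<gamma>" "\<gamma> \<le> 1" and C1: "C1 \<ge> 0" and C0: "C0 \<ge> (1 :: nat)"
    and H1: "\<And>X p. prime p \<Longrightarrow> p > z0 \<Longrightarrow> v X p \<le> real X / real p + 1"
    and H2: "\<And>X p. prime p \<Longrightarrow> p > z0 \<Longrightarrow> \<not> bad p \<Longrightarrow>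
       v X p \<le> 16 * (real X / real p + 1) * real p powr (- \<gamma> / 4) + 16 * (real X / real p + 1) powr (1 - \<gamma>)"
    and H3: "\<And>z N. z \<ge> 1 \<Longrightarrow> (\<Sum>p | bad p \<and> z < p \<and> p \<le> N. 1 / real p) \<le> C1 * real z powr (- 1 / 4)"
  shows "\<exists>C. \<forall>z\<ge>max 1 z0. \<forall>\<epsilon>>0. \<exists>X0. \<forall>X\<ge>X0.
     (\<Sum>p | prime p \<and> z < p \<and> p \<le> C0 * X. v X p) \<le> (C * real z powr (- \<gamma> / 4) + \<epsilon>) * real X"
proof (rule exI[of _ "2 * C1 + 128 / \<gamma>"], intro allI impI)
  fix z :: nat and \<epsilon> :: real assume z: "z \<ge> max 1 z0" and \<epsilon>: "\<epsilon> > 0"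
  have "((\<lambda>W. 32 * real W powr (- \<gamma>) / \<gamma>) \<longlongrightarrow> 32 * 0 / \<gamma>) at_top"
    by (intro tendsto_intros tendsto_neg_powr filterlim_real_sequentially) (use \<gamma> in auto)
  then have "eventually (\<lambda>W. 32 * real W powr (- \<gamma>) / \<gamma> < \<epsilon> / 3) at_top"
    using \<epsilon> by (intro order_tendstoD(2)) auto
  then have "eventually (\<lambda>W. 32 * real W powr (- \<gamma>) / \<gamma> < \<epsilon> / 3 \<and> W \<ge> 1) at_top"
    using eventually_conj eventually_ge_at_top by blast
  then obtain W where W: "32 * real W powr (- \<gamma>) / \<gamma> < \<epsilon> / 3" "W \<ge> 1"
    using eventually_happens' sequentially_bot by blast
  \<comment> \<open>Chosen so that \<epsilon>' C0 X primes with at most W + 1 members each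
    contribute exactly \<epsilon> X / 3.\<close>
  define \<epsilon>' where "\<epsilon>' = \<epsilon> / (3 * (real W + 1) * real C0)"
  have \<epsilon>': "\<epsilon>' > 0" using \<epsilon> C0 by (simp add: \<epsilon>'_def)
  obtain K where K: "\<And>x. real (card {p. prime p \<and> p \<le> x}) \<le> K + \<epsilon>' * real x"
    using card_primes_le[OF \<epsilon>'] by blast
  define X0 where "X0 = nat \<lceil>3 * (real W + 1) * K / \<epsilon>\<rceil> + 1"
  show "\<exists>X0. \<forall>X\<ge>X0. (\<Sum>p | prime p \<and> z < p \<and> p \<le> C0 * X. v X p) \<le> ((2 * C1 + 128 / \<gamma>) * real z powr (- \<gamma> / 4) + \<epsilon>) * real X"
  proof (intro exI[of _ X0] allI impI)
    fix X assume X: "X \<ge> X0"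
    have X1: "X \<ge> 1" using X by (simp add: X0_def)
    have XK: "(real W + 1) * K \<le> \<epsilon> / 3 * real X"
    proof -
      have "3 * (real W + 1) * K / \<epsilon> \<le> real X" using X unfolding X0_def by linarith
      then show ?thesis using \<epsilon> by (simp add: field_simps)
    qed
    define P where "P = {p. prime p \<and> z < p \<and> p \<le> C0 * X}"
    define P1 where "P1 = {p\<in>P. X < p * W}"
    define P2 where "P2 = {p\<in>P. p * W \<le> X \<and> bad p}"
    define P3 where "P3 = {p\<in>P. p * W \<le> X \<and> \<not> bad p}"
    have finP: "finite P" by (rule finite_subset[of _ "{..C0 * X}"]) (auto simp: P_def)
    have fin: "finite P1" "finite P2" "finite P3" using finP by (auto simp: P1_def P2_def P3_def)
    have pP: "prime p \<and> p > z0 \<and> p > z \<and> real p > 0" if "p \<in> P" for p using that z by (auto simp: P_def)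
    have split: "P = P1 \<union> (P2 \<union> P3)" "P1 \<inter> (P2 \<union> P3) = {}" "P2 \<inter> P3 = {}"
      by (auto simp: P1_def P2_def P3_def)
    have s1: "sum (v X) P1 \<le> 2 / 3 * \<epsilon> * real X"
    proof -
      have "sum (v X) P1 \<le> (\<Sum>p\<in>P1. real W + 1)"
      proof (rule sum_mono)
        fix p assume p: "p \<in> P1"
        then have "real X \<le> real (p * W)" by (simp only: of_nat_le_iff P1_def) simp
        then have "real X / real p \<le> real W" using pP p by (simp add: P1_def field_simps)
        then show "v X p \<le> real W + 1" using H1[of p X] pP[of p] p by (simp add: P1_def)
      qed
      also have "\<dots> = real (card P1) * (real W + 1)" by simp
      also have "\<dots> \<le> (K + \<epsilon>' * real (C0 * X)) * (real W + 1)"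
      proof (rule mult_right_mono)
        have "card P1 \<le> card {p. prime p \<and> p \<le> C0 * X}" by (rule card_mono) (auto simp: P1_def P_def)
        then show "real (card P1) \<le> K + \<epsilon>' * real (C0 * X)" using K[of "C0 * X"] by linarith
      qed simp
      also have "\<dots> = (real W + 1) * K + \<epsilon> / 3 * real X"
      proof -
        have "\<epsilon>' * real (C0 * X) * (real W + 1) = \<epsilon> * ((real W + 1) * real C0) / (3 * ((real W + 1) * real C0)) * real X"
          by (simp add: \<epsilon>'_def mult_ac)
        also have "\<dots> = \<epsilon> / 3 * real X" using C0 by simp
        finally show ?thesis by (simp add: algebra_simps)
      qed
      also have "\<dots> \<le> 2 / 3 * \<epsilon> * real X" using XK by simp
      finally show ?thesis .
    qed
    have pX: "p \<le> X \<and> real X / real p + 1 \<le> 2 * (real X / real p)" if "p \<in> P" "p * W \<le> X" for p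
    proof -
      have "p * 1 \<le> p * W" using W(2) by (intro mult_left_mono) auto
      then have "p \<le> X" using that by linarith
      then show ?thesis using pP[OF that(1)] by (simp add: field_simps)
    qed
    have s2: "sum (v X) P2 \<le> 2 * C1 * real z powr (- \<gamma> / 4) * real X"
    proof -
      have "sum (v X) P2 \<le> (\<Sum>p\<in>P2. 2 * real X * (1 / real p))"
      proof (rule sum_mono)
        fix p assume p: "p \<in> P2"
        then show "v X p \<le> 2 * real X * (1 / real p)"
          using H1[of p X] pP[of p] pX[of p] by (simp add: P2_def)
      qed
      also have "\<dots> = 2 * real X * (\<Sum>p\<in>P2. 1 / real p)" by (simp add: sum_distrib_left)
      also have "(\<Sum>p\<in>P2. 1 / real p) \<le> (\<Sum>p | bad p \<and> z < p \<and> p \<le> X. 1 / real p)"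
        by (rule sum_mono2) (use pX in \<open>auto simp: P2_def P_def\<close>)
      also have "\<dots> \<le> C1 * real z powr (- 1 / 4)" using H3 z by simp
      also have "\<dots> \<le> C1 * real z powr (- \<gamma> / 4)"
        using z \<gamma> C1 by (intro mult_left_mono powr_mono) auto
      finally have "sum (v X) P2 \<le> 2 * real X * (C1 * real z powr (- \<gamma> / 4))" by (simp add: mult_left_mono)
      then show ?thesis by (simp add: mult_ac)
    qed
    have s3: "sum (v X) P3 \<le> 128 / \<gamma> * real z powr (- \<gamma> / 4) * real X + \<epsilon> / 3 * real X"
    proof -
      have "sum (v X) P3 \<le> (\<Sum>p\<in>P3. 32 * real X * real p powr (- (\<gamma> / 4) - 1) + 32 * real X powr (1 - \<gamma>) * real p powr (\<gamma> - 1))"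
      proof (rule sum_mono)
        fix p assume p: "p \<in> P3"
        have p0: "real p > 0" "real X / real p + 1 \<le> 2 * (real X / real p)"
          using p pP pX by (auto simp: P3_def)
        have "v X p \<le> 16 * (real X / real p + 1) * real p powr (- \<gamma> / 4) + 16 * (real X / real p + 1) powr (1 - \<gamma>)"
          using p pP by (intro H2) (auto simp: P3_def)
        also have "\<dots> \<le> 16 * (2 * (real X / real p)) * real p powr (- \<gamma> / 4) + 16 * (2 * (real X / real p)) powr (1 - \<gamma>)"
        proof (intro add_mono mult_right_mono mult_left_mono)
          show "(real X / real p + 1) powr (1 - \<gamma>) \<le> (2 * (real X / real p)) powr (1 - \<gamma>)"
            by (rule powr_mono2) (use p0 \<gamma> in auto)
        qed (use p0 in auto)
        also have "16 * (2 * (real X / real p)) * real p powr (- \<gamma> / 4) = 32 * real X * real p powr (- (\<gamma> / 4) - 1)"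
          using p0 by (simp add: powr_diff)
        also have "(2 * (real X / real p)) powr (1 - \<gamma>) = 2 powr (1 - \<gamma>) * (real X powr (1 - \<gamma>) * real p powr (\<gamma> - 1))"
        proof -
          have "(2 * (real X / real p)) powr (1 - \<gamma>) = 2 powr (1 - \<gamma>) * (real X powr (1 - \<gamma>) / real p powr (1 - \<gamma>))"
            using p0 by (simp add: powr_mult powr_divide)
          also have "1 / real p powr (1 - \<gamma>) = real p powr (\<gamma> - 1)"
            by (simp add: powr_minus_divide[symmetric])
          then have "real X powr (1 - \<gamma>) / real p powr (1 - \<gamma>) = real X powr (1 - \<gamma>) * real p powr (\<gamma> - 1)"
            by (metis divide_inverse inverse_eq_divide)
          finally show ?thesis .
        qed
        also have "2 powr (1 - \<gamma>) * (real X powr (1 - \<gamma>) * real p powr (\<gamma> - 1)) \<le> 2 * (real X powr (1 - \<gamma>) * real p powr (\<gamma> - 1))"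
        proof (rule mult_right_mono)
          have "(2 :: real) powr (1 - \<gamma>) \<le> 2 powr 1" using \<gamma> by (intro powr_mono) auto
          then show "(2 :: real) powr (1 - \<gamma>) \<le> 2" by simp
        qed simp
        finally show "v X p \<le> 32 * real X * real p powr (- (\<gamma> / 4) - 1) + 32 * real X powr (1 - \<gamma>) * real p powr (\<gamma> - 1)"
          by simp
      qed
      also have "\<dots> = 32 * real X * (\<Sum>p\<in>P3. real p powr (- (\<gamma> / 4) - 1)) + 32 * real X powr (1 - \<gamma>) * (\<Sum>p\<in>P3. real p powr (\<gamma> - 1))"
        by (simp add: sum.distrib sum_distrib_left)
      also have "\<dots> \<le> 32 * real X * (real z powr (- (\<gamma> / 4)) / (\<gamma> / 4)) + 32 * real X powr (1 - \<gamma>) * (real X powr \<gamma> * real W powr (- \<gamma>) / \<gamma>)"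
      proof (intro add_mono mult_left_mono)
        have "(\<Sum>p\<in>P3. real p powr (- (\<gamma> / 4) - 1)) \<le> (\<Sum>n\<in>{z<..X}. real n powr (- (\<gamma> / 4) - 1))"
          by (rule sum_mono2) (use pP pX in \<open>auto simp: P3_def\<close>)
        also have "\<dots> \<le> real z powr (- (\<gamma> / 4)) / (\<gamma> / 4)"
          by (rule sum_powr_tail_le) (use \<gamma> z in auto)
        finally show "(\<Sum>p\<in>P3. real p powr (- (\<gamma> / 4) - 1)) \<le> real z powr (- (\<gamma> / 4)) / (\<gamma> / 4)" .
        have "(\<Sum>p\<in>P3. real p powr (\<gamma> - 1)) \<le> (\<Sum>n=1..X div W. real n powr (\<gamma> - 1))"
        proof (rule sum_mono2)
          show "P3 \<subseteq> {1..X div W}"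
          proof
            fix p assume p: "p \<in> P3"
            then have "p \<ge> 1" using pP[of p] by (auto simp: P3_def)
            moreover have "p \<le> X div W" using p W(2) by (auto simp: P3_def less_eq_div_iff_mult_less_eq)
            ultimately show "p \<in> {1..X div W}" by simp
          qed
        qed auto
        also have "\<dots> \<le> real (X div W) powr \<gamma> / \<gamma>" by (rule sum_powr_le) (use \<gamma> in auto)
        also have "\<dots> \<le> (real X / real W) powr \<gamma> / \<gamma>"
          by (intro divide_right_mono powr_mono2 of_nat_div_le_of_nat) (use \<gamma> in auto)
        also have "(real X / real W) powr \<gamma> = real X powr \<gamma> * real W powr (- \<gamma>)"
          by (simp add: powr_divide powr_minus_divide)
        finally show "(\<Sum>p\<in>P3. real p powr (\<gamma> - 1)) \<le> real X powr \<gamma> * real W powr (- \<gamma>) / \<gamma>" .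
      qed auto
      also have "32 * real X powr (1 - \<gamma>) * (real X powr \<gamma> * real W powr (- \<gamma>) / \<gamma>) =
         (real X powr (1 - \<gamma>) * real X powr \<gamma>) * (32 * real W powr (- \<gamma>) / \<gamma>)" by simp
      also have "real X powr (1 - \<gamma>) * real X powr \<gamma> = real X"
        using X1 by (simp add: powr_add[symmetric])
      also have "real X * (32 * real W powr (- \<gamma>) / \<gamma>) \<le> real X * (\<epsilon> / 3)"
        using W by (intro mult_left_mono) auto
      finally show ?thesis by (simp add: mult_ac)
    qed
    have "sum (v X) P = sum (v X) P1 + (sum (v X) P2 + sum (v X) P3)"
      unfolding split(1) using fin split(2,3) by (simp add: sum.union_disjoint)
    also have "\<dots> \<le> 2 / 3 * \<epsilon> * real X + (2 * C1 * real z powr (- \<gamma> / 4) * real X + (128 / \<gamma> * real z powr (- \<gamma> / 4) * real X + \<epsilon> / 3 * real X))"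
      by (intro add_mono s1 s2 s3)
    also have "\<dots> = ((2 * C1 + 128 / \<gamma>) * real z powr (- \<gamma> / 4) + \<epsilon>) * real X"
      by (simp add: algebra_simps)
    finally show "(\<Sum>p | prime p \<and> z < p \<and> p \<le> C0 * X. v X p) \<le> ((2 * C1 + 128 / \<gamma>) * real z powr (- \<gamma> / 4) + \<epsilon>) * real X"
      unfolding P_def .
  qed
qed

section \<open>Exponential polynomials\<close>

text \<open>The algebraic numbers, written with a rational integer as denominator. The coefficients
  in the closed form of a recurrence are in general not algebraic integers.\<close>

definition alg :: "complex \<Rightarrow> bool" where
  "alg x \<longleftrightarrow> (\<exists>D::int. D \<noteq> 0 \<and> algebraic_int (of_int D * x))"

lemma algebraic_int_imp_alg: "algebraic_int x \<Longrightarrow> alg x"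
  unfolding alg_def by (auto intro!: exI[of _ 1])

lemma alg_of_int [simp]: "alg (of_int n)"
  by (intro algebraic_int_imp_alg) auto

lemma alg_of_nat [simp]: "alg (of_nat n)"
  by (intro algebraic_int_imp_alg) auto

lemma alg_0 [simp]: "alg 0" and alg_1 [simp]: "alg 1"
  by (auto intro: algebraic_int_imp_alg)

lemma alg_add: "alg x \<Longrightarrow> alg y \<Longrightarrow> alg (x + y)"
proof -
  assume "alg x" "alg y"
  then obtain D E :: int where "D \<noteq> 0" "E \<noteq> 0" "algebraic_int (of_int D * x)" "algebraic_int (of_int E * y)"
    by (auto simp: alg_def)
  then have "algebraic_int (of_int E * (of_int D * x) + of_int D * (of_int E * y))" "D * E \<noteq> 0" by auto
  then show ?thesis unfolding alg_def
    by (intro exI[of _ "D * E"]) (simp add: algebra_simps)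
qed

lemma alg_mult: "alg x \<Longrightarrow> alg y \<Longrightarrow> alg (x * y)"
proof -
  assume "alg x" "alg y"
  then obtain D E :: int where "D \<noteq> 0" "E \<noteq> 0" "algebraic_int (of_int D * x)" "algebraic_int (of_int E * y)"
    by (auto simp: alg_def)
  then have "algebraic_int ((of_int D * x) * (of_int E * y))" "D * E \<noteq> 0" by auto
  then show ?thesis unfolding alg_def
    by (intro exI[of _ "D * E"]) (simp add: algebra_simps)
qed

lemma alg_minus: "alg x \<Longrightarrow> alg (- x)"
  using alg_mult[OF alg_of_int[of "-1"], of x] by simp

lemma alg_diff: "alg x \<Longrightarrow> alg y \<Longrightarrow> alg (x - y)"
  using alg_add[of x "- y"] alg_minus by simp

lemma alg_power: "alg x \<Longrightarrow> alg (x ^ n)"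
  by (induction n) (auto intro: alg_mult)

lemma alg_sum: "(\<And>i. i \<in> I \<Longrightarrow> alg (f i)) \<Longrightarrow> alg (\<Sum>i\<in>I. f i)"
  by (induction I rule: infinite_finite_induct) (auto intro: alg_add)

text \<open>The algebraic integer \<open>D * x\<close> divides some rational integer
  \<open>b\<close>; then \<open>b * inverse x\<close> is \<open>D\<close> times the
  cofactor.\<close>

lemma alg_inverse: "alg x \<Longrightarrow> alg (inverse x)"
proof (cases "x = 0")
  case False
  assume "alg x"
  then obtain D :: int where D: "D \<noteq> 0" "algebraic_int (of_int D * x)" by (auto simp: alg_def)
  obtain b :: int where b: "b \<noteq> 0" "algebraic_int (of_int b / (of_int D * x))"
    using algebraic_int_dvd_int[OF D(2)] D(1) False by auto
  have "algebraic_int (of_int D * (of_int b / (of_int D * x)))" using b by blast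
  also have "of_int D * (of_int b / (of_int D * x)) = of_int b * inverse x"
    using D(1) False by (simp add: field_simps)
  finally show ?thesis using b(1) unfolding alg_def by blast
qed simp

lemma alg_divide: "alg x \<Longrightarrow> alg y \<Longrightarrow> alg (x / y)"
  unfolding divide_inverse by (intro alg_mult alg_inverse)

definition alg_poly :: "complex poly \<Rightarrow> bool" where
  "alg_poly Q \<longleftrightarrow> (\<forall>i. alg (coeff Q i))"

lemma alg_poly_0 [simp]: "alg_poly 0"
  by (simp add: alg_poly_def)

lemma alg_poly_pCons_iff: "alg_poly (pCons a Q) \<longleftrightarrow> alg a \<and> alg_poly Q"
  unfolding alg_poly_def by (metis coeff_pCons_0 coeff_pCons_Suc nat.exhaust)

lemma alg_poly_add: "alg_poly P \<Longrightarrow> alg_poly Q \<Longrightarrow> alg_poly (P + Q)"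
  by (simp add: alg_poly_def alg_add)

lemma alg_poly_diff: "alg_poly P \<Longrightarrow> alg_poly Q \<Longrightarrow> alg_poly (P - Q)"
  by (simp add: alg_poly_def alg_diff)

lemma alg_poly_smult: "alg c \<Longrightarrow> alg_poly Q \<Longrightarrow> alg_poly (Polynomial.smult c Q)"
  by (simp add: alg_poly_def alg_mult)

lemma alg_poly_sum: "(\<And>i. i \<in> I \<Longrightarrow> alg_poly (f i)) \<Longrightarrow> alg_poly (\<Sum>i\<in>I. f i)"
  by (induction I rule: infinite_finite_induct) (auto intro: alg_poly_add)

lemma alg_poly_pcompose_linear:
  assumes "alg_poly Q" "alg u" "alg v"
  shows "alg_poly (Q \<circ>\<^sub>p [:u, v:])"
  using assms(1)
proof (induction Q)
  case (pCons a Q)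
  then have Q: "alg a" "alg_poly (Q \<circ>\<^sub>p [:u, v:])" by (auto simp: alg_poly_pCons_iff)
  have "alg_poly (pCons 0 (Polynomial.smult v (Q \<circ>\<^sub>p [:u, v:])))"
    using Q assms by (auto simp: alg_poly_pCons_iff intro: alg_poly_smult)
  then have "alg_poly ([:a:] + (Polynomial.smult u (Q \<circ>\<^sub>p [:u, v:]) + pCons 0 (Polynomial.smult v (Q \<circ>\<^sub>p [:u, v:]))))"
    using Q assms by (intro alg_poly_add alg_poly_smult) (auto simp: alg_poly_pCons_iff)
  moreover have "[:u, v:] * R = Polynomial.smult u R + pCons 0 (Polynomial.smult v R)" for R
    by simp
  ultimately show ?case by (simp only: pcompose_pCons)
qed simp

text \<open>The congruence of D Q(n) and D Q(b/c) modulo c n - b in the algebraic integers, where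
  \<open>D\<close> clears the denominators of the coefficients and of the powers of b/c. It freezes
  a coefficient polynomial at a root of the polynomial in the gcd.\<close>

definition poly_cong_at :: "complex poly \<Rightarrow> int \<Rightarrow> int \<Rightarrow> int \<Rightarrow> bool" where
  "poly_cong_at Q b c D \<longleftrightarrow> algebraic_int (of_int D * poly Q (of_int b / of_int c)) \<and>
     (\<forall>n::int. \<exists>t. algebraic_int t \<and>
        of_int D * (poly Q (of_int n) - poly Q (of_int b / of_int c)) = of_int (c * n - b) * t)"

lemma poly_cong_at_mult:
  assumes "poly_cong_at Q b c D"
  shows "poly_cong_at Q b c (E * D)"
  unfolding poly_cong_at_def
proof (intro conjI allI)
  show "algebraic_int (of_int (E * D) * poly Q (of_int b / of_int c))"
    using assms algebraic_int_mult[OF algebraic_int_of_int[of E]] by (simp add: poly_cong_at_def mult.assoc)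
  fix n :: int
  obtain t where t: "algebraic_int t"
     "of_int D * (poly Q (of_int n) - poly Q (of_int b / of_int c)) = of_int (c * n - b) * t"
    using assms by (auto simp: poly_cong_at_def)
  have "of_int (E * D) * (poly Q (of_int n) - poly Q (of_int b / of_int c)) =
     of_int E * (of_int D * (poly Q (of_int n) - poly Q (of_int b / of_int c)))"
    by (simp only: of_int_mult mult.assoc)
  also have "\<dots> = of_int (c * n - b) * (of_int E * t)"
    unfolding t(2) by (rule mult.left_commute)
  finally have "of_int (E * D) * (poly Q (of_int n) - poly Q (of_int b / of_int c)) =
      of_int (c * n - b) * (of_int E * t)" .
  moreover have "algebraic_int (of_int E * t)" using t(1) by blast
  ultimately show "\<exists>t. algebraic_int t \<and>
      of_int (E * D) * (poly Q (of_int n) - poly Q (of_int b / of_int c)) = of_int (c * n - b) * t"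
    by (intro exI[of _ "of_int E * t"] conjI)
qed

lemma ex_poly_cong_at:
  assumes "alg_poly Q" "c \<noteq> 0"
  shows "\<exists>D. D \<noteq> 0 \<and> poly_cong_at Q b c D"
  using assms(1)
proof (induction Q)
  case 0
  show ?case unfolding poly_cong_at_def by (intro exI[of _ 1]) (auto intro!: exI[of _ 0])
next
  case (pCons a R)
  then obtain D where D: "D \<noteq> 0" "poly_cong_at R b c D" by (auto simp: alg_poly_pCons_iff)
  obtain A :: int where A: "A \<noteq> 0" "algebraic_int (of_int A * a)"
    using pCons.prems by (auto simp: alg_poly_pCons_iff alg_def)
  define r :: complex where "r = of_int b / of_int c"
  have cr: "of_int c * r = of_int b" using assms(2) by (simp add: r_def)
  have DR: "algebraic_int (of_int D * poly R r)" using D(2) by (simp add: poly_cong_at_def r_def)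
  \<comment> \<open>Horner step: \<open>A\<close> clears the new constant term, and the extra
    \<open>c\<close> turns the factor r of r R(r) into the integer \<open>b\<close>.\<close>
  have "poly_cong_at (pCons a R) b c (A * (c * D))"
    unfolding poly_cong_at_def r_def[symmetric]
  proof (intro conjI allI)
    have "of_int (A * (c * D)) * poly (pCons a R) r =
        of_int (c * D) * (of_int A * a) + of_int A * (of_int c * r) * (of_int D * poly R r)"
      by (simp add: algebra_simps)
    also have "\<dots> = of_int (c * D) * (of_int A * a) + of_int (A * b) * (of_int D * poly R r)"
      by (simp add: cr)
    also have "algebraic_int \<dots>" by (intro algebraic_int_add algebraic_int_mult DR A(2) algebraic_int_of_int)
    finally show "algebraic_int (of_int (A * (c * D)) * poly (pCons a R) r)" .
    fix n :: int
    obtain t where t: "algebraic_int t" "of_int D * (poly R (of_int n) - poly R r) = of_int (c * n - b) * t"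
      using D(2) by (auto simp: poly_cong_at_def r_def)
    have "of_int (A * (c * D)) * (poly (pCons a R) (of_int n) - poly (pCons a R) r) =
      of_int (A * c * n) * (of_int D * (poly R (of_int n) - poly R r)) + of_int A * (of_int c * of_int n - of_int c * r) * (of_int D * poly R r)"
      by (simp add: algebra_simps)
    also have "\<dots> = of_int (c * n - b) * (of_int (A * c * n) * t + of_int A * (of_int D * poly R r))"
      unfolding t(2) cr by (simp add: algebra_simps)
    finally have "of_int (A * (c * D)) * (poly (pCons a R) (of_int n) - poly (pCons a R) r) =
       of_int (c * n - b) * (of_int (A * c * n) * t + of_int A * (of_int D * poly R r))" .
    moreover have "algebraic_int (of_int (A * c * n) * t + of_int A * (of_int D * poly R r))"
      by (intro algebraic_int_add algebraic_int_mult DR t(1) algebraic_int_of_int)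
    ultimately show "\<exists>t. algebraic_int t \<and>
        of_int (A * (c * D)) * (poly (pCons a R) (of_int n) - poly (pCons a R) r) = of_int (c * n - b) * t"
      by blast
  qed
  moreover have "A * (c * D) \<noteq> 0" using A D assms(2) by simp
  ultimately show ?case by blast
qed

lemma ex_poly_cong_at_finite:
  assumes "finite \<Gamma>" "\<And>g. g \<in> \<Gamma> \<Longrightarrow> alg_poly (Q g)" "c \<noteq> 0"
  shows "\<exists>D. D \<noteq> 0 \<and> (\<forall>g\<in>\<Gamma>. poly_cong_at (Q g) b c D)"
  using assms(1,2)
proof (induction \<Gamma> rule: finite_induct)
  case empty
  show ?case by (rule exI[of _ 1]) simp
next
  case (insert g \<Gamma>)
  then obtain D where D: "D \<noteq> 0" "\<forall>g\<in>\<Gamma>. poly_cong_at (Q g) b c D" by auto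
  obtain E where E: "E \<noteq> 0" "poly_cong_at (Q g) b c E" using ex_poly_cong_at[of "Q g" c b] insert assms by auto
  have "\<forall>h\<in>insert g \<Gamma>. poly_cong_at (Q h) b c (E * D)"
    using D E poly_cong_at_mult[of _ b c D E] poly_cong_at_mult[of _ b c E D] by (auto simp: mult.commute)
  then show ?case using D E by (intro exI[of _ "E * D"]) auto
qed

text \<open>Since the bases are nonzero, \<open>nondeg\<close> says that no quotient of distinct
  bases is a root of unity. It is phrased as nonvanishing of the differences whose prime divisors
  are counted.\<close>

locale exp_poly =
  fixes \<Gamma> :: "complex set" and Q :: "complex \<Rightarrow> complex poly" and f :: "nat \<Rightarrow> int"
  assumes fin: "finite \<Gamma>"
    and base_int: "\<And>g. g \<in> \<Gamma> \<Longrightarrow> algebraic_int g"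
    and base_nz: "\<And>g. g \<in> \<Gamma> \<Longrightarrow> g \<noteq> 0"
    and nondeg: "\<And>g h d. g \<in> \<Gamma> \<Longrightarrow> h \<in> \<Gamma> \<Longrightarrow> g \<noteq> h \<Longrightarrow> d \<ge> 1 \<Longrightarrow> g ^ d \<noteq> h ^ d"
    and alg_Q: "\<And>g. g \<in> \<Gamma> \<Longrightarrow> alg_poly (Q g)"
    and rep: "\<And>n. of_int (f n) = (\<Sum>g\<in>\<Gamma>. poly (Q g) (of_nat n) * g ^ n)"
begin

lemma cong_at_root:
  assumes "c \<noteq> 0"
  obtains D where "D \<noteq> 0" "\<And>g. g \<in> \<Gamma> \<Longrightarrow> algebraic_int (of_int D * poly (Q g) (of_int b / of_int c))"
    "\<And>n. \<exists>t. algebraic_int t \<and> of_int (D * f n) =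
        (\<Sum>g\<in>\<Gamma>. of_int D * poly (Q g) (of_int b / of_int c) * g ^ n) + of_int (c * int n - b) * t"
proof -
  have "\<exists>D. D \<noteq> 0 \<and> (\<forall>g\<in>\<Gamma>. poly_cong_at (Q g) b c D)"
    by (rule ex_poly_cong_at_finite[OF fin alg_Q assms])
  then obtain D where D: "D \<noteq> 0" "\<And>g. g \<in> \<Gamma> \<Longrightarrow> poly_cong_at (Q g) b c D" by auto
  define r :: complex where "r = of_int b / of_int c"
  have "\<exists>t. algebraic_int t \<and> of_int (D * f n) =
        (\<Sum>g\<in>\<Gamma>. of_int D * poly (Q g) r * g ^ n) + of_int (c * int n - b) * t" for n
  proof -
    have "\<forall>g\<in>\<Gamma>. \<exists>t. algebraic_int t \<and> of_int D * (poly (Q g) (of_int (int n)) - poly (Q g) r) = of_int (c * int n - b) * t"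
      using D(2) unfolding poly_cong_at_def r_def by blast
    then obtain t where t: "\<forall>g\<in>\<Gamma>. algebraic_int (t g) \<and> of_int D * (poly (Q g) (of_int (int n)) - poly (Q g) r) = of_int (c * int n - b) * t g"
      by metis
    have "of_int (D * f n) = (\<Sum>g\<in>\<Gamma>. of_int D * poly (Q g) (of_nat n) * g ^ n)"
      by (simp add: rep sum_distrib_left mult.assoc)
    also have "\<dots> = (\<Sum>g\<in>\<Gamma>. of_int D * poly (Q g) r * g ^ n + of_int D * (poly (Q g) (of_nat n) - poly (Q g) r) * g ^ n)"
      by (simp add: algebra_simps)
    also have "\<dots> = (\<Sum>g\<in>\<Gamma>. of_int D * poly (Q g) r * g ^ n + of_int (c * int n - b) * (t g * g ^ n))"
      by (rule sum.cong) (use t in \<open>auto simp: mult.assoc\<close>)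
    also have "\<dots> = (\<Sum>g\<in>\<Gamma>. of_int D * poly (Q g) r * g ^ n) + of_int (c * int n - b) * (\<Sum>g\<in>\<Gamma>. t g * g ^ n)"
      by (simp add: sum.distrib sum_distrib_left)
    finally have "of_int (D * f n) = (\<Sum>g\<in>\<Gamma>. of_int D * poly (Q g) r * g ^ n) + of_int (c * int n - b) * (\<Sum>g\<in>\<Gamma>. t g * g ^ n)" .
    moreover have "algebraic_int (\<Sum>g\<in>\<Gamma>. t g * g ^ n)"
      using t base_int by (intro algebraic_int_sum algebraic_int_mult algebraic_int_power) blast+
    ultimately show ?thesis by (intro exI[of _ "\<Sum>g\<in>\<Gamma>. t g * g ^ n"] conjI)
  qed
  then show ?thesis using D unfolding poly_cong_at_def r_def by (intro that[of D]) auto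
qed

text \<open>When the constant coefficients all vanish, the cofactor of c n - b is both an algebraic
  integer and a quotient of rational integers, hence an integer.\<close>

lemma vanishing_at_root:
  assumes "c \<noteq> 0" "\<And>g. g \<in> \<Gamma> \<Longrightarrow> poly (Q g) (of_int b / of_int c) = 0"
  shows "\<exists>D. D \<noteq> 0 \<and> (\<forall>n. (c * int n - b) dvd D * f n)"
proof -
  obtain D where D: "D \<noteq> 0"
    "\<And>g. g \<in> \<Gamma> \<Longrightarrow> algebraic_int (of_int D * poly (Q g) (of_int b / of_int c))"
    "\<And>n. \<exists>t. algebraic_int t \<and> of_int (D * f n) =
        (\<Sum>g\<in>\<Gamma>. of_int D * poly (Q g) (of_int b / of_int c) * g ^ n) + of_int (c * int n - b) * t"
  proof -
    from that show thesis by (rule cong_at_root[OF assms(1), of b])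
  qed
  have "(c * int n - b) dvd D * f n" for n
  proof -
    obtain t :: complex where t: "algebraic_int t" "of_int (D * f n) = of_int (c * int n - b) * t"
      using D(3)[of n] assms(2) by auto
    show ?thesis
    proof (cases "c * int n - b = 0")
      \<comment> \<open>At the root itself the congruence is modulo 0 and forces
        \<open>D * f n = 0\<close>.\<close>
      case True
      then have "(of_int (D * f n) :: complex) = 0" using t(2) by simp
      then have "D * f n = 0" by (simp only: of_int_eq_0_iff)
      then show ?thesis by (simp only: dvd_0_right)
    next
      case False
      then have "(of_int (c * int n - b) :: complex) \<noteq> 0" by (simp only: of_int_eq_0_iff not_False_eq_True)
      then have "t = of_int (D * f n) / of_int (c * int n - b)" using t(2) by simp
      then have "t \<in> \<rat>" by (simp only: Rats_divide Rats_of_int)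
      then have "t \<in> \<int>" using t(1) rational_algebraic_int_is_int by blast
      then obtain m where "t = of_int m" by (auto elim: Ints_cases)
      then have "(of_int (D * f n) :: complex) = of_int ((c * int n - b) * m)" using t(2) by simp
      then have "D * f n = (c * int n - b) * m" by (simp only: of_int_eq_iff)
      then show ?thesis by simp
    qed
  qed
  then show ?thesis using D(1) by blast
qed

text \<open>The exponent is \<eta> = 1 / (4 * 2 ^ k) for k + 1 bases: the saving 1 / 2 ^ k of the
  windows, taken at length p^(1/4). An \<open>m\<close> with c m = b is left out because every prime
  divides 0, so that \<open>p\<close> could not be bounded in terms of \<open>X\<close>.\<close>

lemma tail_bound_at_root:
  assumes c: "c > 0" and \<delta>: "\<delta> \<in> \<Gamma>" "poly (Q \<delta>) (of_int b / of_int c) \<noteq> 0"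
  shows "\<exists>C \<eta> z0. \<eta> > 0 \<and> (\<forall>z\<ge>z0. \<forall>\<epsilon>>0. \<exists>X0. \<forall>X\<ge>X0.
     real (card {m. m \<le> X \<and> c * int m \<noteq> b \<and>
        (\<exists>p. prime p \<and> z < p \<and> int p dvd c * int m - b \<and> int p dvd f m)})
      \<le> (C * real z powr (- \<eta>) + \<epsilon>) * real X)"
proof -
  define r :: complex where "r = of_int b / of_int c"
  obtain D where D: "D \<noteq> 0" "\<And>g. g \<in> \<Gamma> \<Longrightarrow> algebraic_int (of_int D * poly (Q g) r)"
    "\<And>n. \<exists>t. algebraic_int t \<and> of_int (D * f n) =
        (\<Sum>g\<in>\<Gamma>. of_int D * poly (Q g) r * g ^ n) + of_int (c * int n - b) * t"
  proof -
    have "c \<noteq> 0" using c by simp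
    from that show thesis unfolding r_def by (rule cong_at_root[OF \<open>c \<noteq> 0\<close>, of b])
  qed
  define \<kappa> where "\<kappa> g = of_int D * poly (Q g) r" for g
  have \<kappa>\<delta>: "\<kappa> \<delta> \<noteq> 0" using D(1) \<delta> by (simp add: \<kappa>_def r_def)
  have \<kappa>_int: "algebraic_int (\<kappa> g)" if "g \<in> \<Gamma>" for g using D(2) that by (simp add: \<kappa>_def)
  \<comment> \<open>\<open>b1\<close> certifies that the coefficient of \<delta> is a unit modulo
    primes not dividing \<open>b1\<close>; \<open>b2\<close> does the same for \<delta>
    itself.\<close>
  obtain b1 :: int where b1: "b1 \<noteq> 0" "algebraic_int (of_int b1 / \<kappa> \<delta>)"
    using algebraic_int_dvd_int[OF \<kappa>_int[OF \<delta>(1)] \<kappa>\<delta>] .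
  obtain b2 :: int where b2: "b2 \<noteq> 0" "algebraic_int (of_int b2 / \<delta>)"
    using algebraic_int_dvd_int[OF base_int[OF \<delta>(1)] base_nz[OF \<delta>(1)]] .
  define I where "I = {i \<in> \<Gamma> \<times> \<Gamma>. fst i \<noteq> snd i}"
  have finI: "finite I" using fin by (auto simp: I_def)
  have "\<forall>i\<in>I. \<exists>C::nat. \<forall>d\<ge>1. \<exists>b::int. b \<noteq> 0 \<and> \<bar>b\<bar> \<le> 2 ^ (C * (d + 1)) \<and> algebraic_int (of_int b / (fst i ^ d - snd i ^ d))"
  proof
    fix i assume "i \<in> I"
    then have i: "fst i \<in> \<Gamma>" "snd i \<in> \<Gamma>" "fst i \<noteq> snd i" by (auto simp: I_def)
    obtain C where "\<And>d. fst i ^ d \<noteq> snd i ^ d \<Longrightarrow> \<exists>b::int. b \<noteq> 0 \<and> \<bar>b\<bar> \<le> 2 ^ (C * (d + 1)) \<and> algebraic_int (of_int b / (fst i ^ d - snd i ^ d))"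
    proof -
      from that show thesis by (rule power_diff_dvd_small_int[OF base_int[OF i(1)] base_int[OF i(2)]])
    qed
    then show "\<exists>C::nat. \<forall>d\<ge>1. \<exists>b::int. b \<noteq> 0 \<and> \<bar>b\<bar> \<le> 2 ^ (C * (d + 1)) \<and> algebraic_int (of_int b / (fst i ^ d - snd i ^ d))"
      using nondeg[OF i] by blast
  qed
  then obtain Cf where "\<forall>i\<in>I. \<forall>d\<ge>1. \<exists>b::int. b \<noteq> 0 \<and> \<bar>b\<bar> \<le> 2 ^ (Cf i * (d + 1)) \<and> algebraic_int (of_int b / (fst i ^ d - snd i ^ d))"
    by (auto dest!: bchoice)
  \<comment> \<open>\<open>B i d\<close> is the small rational integer multiple of the difference; a
    prime that does not divide it leaves the difference a unit.\<close>
  then obtain B :: "complex \<times> complex \<Rightarrow> nat \<Rightarrow> int" where B: "\<And>i d. i \<in> I \<Longrightarrow> d \<ge> 1 \<Longrightarrow>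
     B i d \<noteq> 0 \<and> \<bar>B i d\<bar> \<le> 2 ^ (Cf i * (d + 1)) \<and> algebraic_int (of_int (B i d) / (fst i ^ d - snd i ^ d))"
    by metis
  define C where "C = (\<Sum>i\<in>I. Cf i)"
  define S where "S i d = {p. prime p \<and> int p dvd B i d}" for i d
  define bad where "bad p \<longleftrightarrow> (\<exists>i\<in>I. \<exists>d\<ge>1. d ^ 4 \<le> p \<and> p \<in> S i d)" for p
  have S: "finite (S i d) \<and> card (S i d) \<le> C * (d + 1)" if "i \<in> I" "d \<ge> 1" for i d
  proof -
    have "card (S i d) \<le> Cf i * (d + 1)" "finite (S i d)"
      using card_prime_divisors_le[of "B i d" "Cf i * (d + 1)"] B[OF that] by (auto simp: S_def)
    moreover have "Cf i \<le> C" unfolding C_def using finI that by (intro member_le_sum) auto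
    ultimately show ?thesis by (meson le_trans mult_le_mono1)
  qed
  define V where "V X p = {m. m \<le> X \<and> c * int m \<noteq> b \<and> int p dvd c * int m - b \<and> int p dvd f m}" for X p
  have finV: "finite (V X p)" for X p by (rule finite_subset[of _ "{..X}"]) (auto simp: V_def)
  \<comment> \<open>Primes above \<open>z0\<close> are odd and divide none of \<open>c\<close>,
    \<open>b1\<close>, \<open>b2\<close>.\<close>
  define z0 where "z0 = 2 + nat c + nat \<bar>b1\<bar> + nat \<bar>b2\<bar>"
  have z0: "2 \<le> z0" "nat c \<le> z0" "nat \<bar>b1\<bar> \<le> z0" "nat \<bar>b2\<bar> \<le> z0" by (auto simp: z0_def)
  have modV: "m mod p = n mod p" if "prime p" "p > z0" "m \<in> V X p" "n \<in> V X p" for p m n X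
  proof -
    have "int p dvd (c * int m - b) - (c * int n - b)"
      by (rule dvd_diff) (use that(3,4) in \<open>simp_all add: V_def\<close>)
    then have "int p dvd c * (int m - int n)" by (simp add: algebra_simps)
    moreover have "\<not> int p dvd c" using that(2) z0(2) c by (auto dest!: zdvd_imp_le)
    ultimately have "int p dvd int m - int n"
      using that(1) prime_dvd_mult_iff[of "int p" c] by simp
    then have "int m mod int p = int n mod int p" by (simp add: mod_eq_dvd_iff)
    then show ?thesis by (metis of_nat_eq_iff zmod_int)
  qed
  obtain k where k: "card \<Gamma> = Suc k" using \<delta>(1) fin by (metis card_gt_0_iff empty_iff gr0_implies_Suc)
  define \<gamma> :: real where "\<gamma> = 1 / 2 ^ k"
  have \<gamma>: "0 < \<gamma>" "\<gamma> \<le> 1" by (auto simp: \<gamma>_def divide_le_eq)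
  have H2: "real (card (V X p)) \<le> 16 * (real X / real p + 1) * real p powr (- \<gamma> / 4) + 16 * (real X / real p + 1) powr (1 - \<gamma>)"
    if p: "prime p" "p > z0" "\<not> bad p" for X p
  proof (rule card_residue_class_le)
    show "p > 0" using p(1) prime_gt_0_nat by blast
    show "V X p \<subseteq> {..X}" by (auto simp: V_def)
    show "m mod p = n mod p" if "m \<in> V X p" "n \<in> V X p" for m n using modV[OF p(1,2) that] .
    show "real (card Z) \<le> 4 * real L powr (1 - \<gamma>)"
      if L: "L \<ge> 1" "L ^ 4 \<le> p" and Z: "Z \<subseteq> {u..<u+L}" "Z \<subseteq> (\<lambda>m. m div p) ` V X p" for L u Z
    proof (cases "V X p = {}")
      case True
      then show ?thesis using Z by simp
    next
      case False
      then obtain m0 where m0: "m0 \<in> V X p" by blast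
      \<comment> \<open>All members of \<open>V X p\<close> share this residue because
        \<open>c\<close> is invertible modulo \<open>p\<close>. The factors \<open>g ^ r0\<close> go
        into the coefficients, and the sum depends on the quotient \<open>m div p\<close>
        alone.\<close>
      define r0 where "r0 = m0 mod p"
      have m_eq: "m = r0 + p * (m div p)" if "m \<in> V X p" for m
        using modV[OF p(1,2) that m0] by (simp add: r0_def) (metis mod_mult_div_eq)
      have unit_if: "unit_mod p x" if "algebraic_int x" "x \<noteq> 0" "algebraic_int (of_int y / x)" "y \<noteq> 0" "nat \<bar>y\<bar> \<le> z0" for x y
      proof (rule unit_mod_if_dvd_int[OF that(1,2,3) p(1)])
        show "\<not> int p dvd y"
        proof
          assume "int p dvd y"
          then have "int p \<le> \<bar>y\<bar>" using dvd_imp_le_int[of y "int p"] that(4) by simp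
          then show False using that(5) p(2) by linarith
        qed
      qed
      have "odd p" using p z0(1) prime_odd_nat[of p] by auto
      show ?thesis unfolding \<gamma>_def
      proof (rule exp_sum_zeros_in_window[OF p(1) \<open>odd p\<close> fin k \<delta>(1) base_int, where c = "\<lambda>g. \<kappa> g * g ^ r0" and Z = Z and u = u])
        have u1: "unit_mod p \<delta>"
          using unit_if[OF base_int[OF \<delta>(1)] base_nz[OF \<delta>(1)] b2(2,1) z0(4)] .
        then show "unit_mod p \<delta>" .
        have "unit_mod p (\<kappa> \<delta>)" using unit_if[OF \<kappa>_int[OF \<delta>(1)] \<kappa>\<delta> b1(2,1) z0(3)] .
        then show "unit_mod p (\<kappa> \<delta> * \<delta> ^ r0)" using u1 by (intro unit_mod_mult unit_mod_power)
        show "algebraic_int (\<kappa> g * g ^ r0)" if "g \<in> \<Gamma>" for g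
          using that \<kappa>_int base_int by blast
        show "unit_mod p (g ^ d - h ^ d)" if gh: "g \<in> \<Gamma>" "h \<in> \<Gamma>" "g \<noteq> h" "1 \<le> d" "d < L" for g h d
        proof -
          have i: "(g, h) \<in> I" using gh by (auto simp: I_def)
          have "d ^ 4 \<le> p" using power_mono[of d L 4] gh L by linarith
          then have "p \<notin> S (g, h) d" using p(3) i gh(4) unfolding bad_def by blast
          then have "\<not> int p dvd B (g, h) d" using p(1) by (simp add: S_def)
          moreover have "algebraic_int (g ^ d - h ^ d)" using gh base_int by blast
          ultimately show ?thesis
            using B[OF i gh(4)] nondeg[OF gh(1-4)] p(1) by (intro unit_mod_if_dvd_int[of _ "B (g, h) d"]) auto
        qed
        show "in_pO p (\<Sum>g\<in>\<Gamma>. \<kappa> g * g ^ r0 * g ^ (p * j))" if "j \<in> Z" for j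
        proof -
          obtain m where m: "m \<in> V X p" "j = m div p" using \<open>j \<in> Z\<close> Z by auto
          obtain t where t: "algebraic_int t" "of_int (D * f m) = (\<Sum>g\<in>\<Gamma>. \<kappa> g * g ^ m) + of_int (c * int m - b) * t"
            using D(3) unfolding \<kappa>_def by blast
          have "(\<Sum>g\<in>\<Gamma>. \<kappa> g * g ^ r0 * g ^ (p * j)) = (\<Sum>g\<in>\<Gamma>. \<kappa> g * g ^ (r0 + p * j))"
            by (simp add: power_add mult.assoc)
          also have "r0 + p * j = m" using m_eq[OF m(1)] m(2) by simp
          also have "(\<Sum>g\<in>\<Gamma>. \<kappa> g * g ^ m) = of_int (D * f m) - t * of_int (c * int m - b)"
            unfolding t(2) by (simp add: algebra_simps)
          also have "in_pO p \<dots>"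
          proof (intro in_pO_diff in_pO_mult t(1))
            have "p > 0" using p(1) prime_gt_0_nat by blast
            then show "in_pO p (of_int (D * f m))" "in_pO p (of_int (c * int m - b))"
              using m(1) by (subst in_pO_of_int_iff; simp add: V_def)+
          qed
          finally show ?thesis .
        qed
      qed (use L Z in auto)
    qed
  qed (use \<gamma> in auto)
  have H1: "real (card (V X p)) \<le> real X / real p + 1" if "prime p" "p > z0" for X p
    by (rule card_residue_class_le') (use modV[OF that] that prime_gt_0_nat in \<open>auto simp: V_def\<close>)
  \<comment> \<open>For m <= X and X >= 1, a prime divisor of a nonzero c m - b is at most C0
    X.\<close>
  define C0 where "C0 = nat (c + \<bar>b\<bar>)"
  have C0: "C0 \<ge> 1" using c by (simp add: C0_def)
  have "\<exists>K. \<forall>z\<ge>max 1 z0. \<forall>\<epsilon>>0. \<exists>X0. \<forall>X\<ge>X0.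
     (\<Sum>p | prime p \<and> z < p \<and> p \<le> C0 * X. real (card (V X p))) \<le> (K * real z powr (- \<gamma> / 4) + \<epsilon>) * real X"
  proof (rule tail_sum_bound[OF \<gamma> _ C0, where bad = bad])
    show "(\<Sum>p | bad p \<and> z < p \<and> p \<le> N. 1 / real p) \<le> (4 * real C * real (card I)) * real z powr (- 1 / 4)" if "z \<ge> 1" for z N
      by (rule sum_inverse_bad_primes_le[OF finI S _ that]) (auto simp: bad_def)
  qed (use H1 H2 in auto)
  then obtain K where K: "\<And>z \<epsilon>. z \<ge> max 1 z0 \<Longrightarrow> \<epsilon> > 0 \<Longrightarrow> \<exists>X0. \<forall>X\<ge>X0.
     (\<Sum>p | prime p \<and> z < p \<and> p \<le> C0 * X. real (card (V X p))) \<le> (K * real z powr (- \<gamma> / 4) + \<epsilon>) * real X"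
    by blast
  have "\<exists>X0. \<forall>X\<ge>X0.
     real (card {m. m \<le> X \<and> c * int m \<noteq> b \<and>
        (\<exists>p. prime p \<and> z < p \<and> int p dvd c * int m - b \<and> int p dvd f m)})
      \<le> (K * real z powr (- (\<gamma> / 4)) + \<epsilon>) * real X" if z: "z \<ge> max 1 z0" and \<epsilon>: "\<epsilon> > 0" for z :: nat and \<epsilon> :: real
  proof -
    obtain X0 where X0: "\<And>X. X \<ge> X0 \<Longrightarrow>
     (\<Sum>p | prime p \<and> z < p \<and> p \<le> C0 * X. real (card (V X p))) \<le> (K * real z powr (- \<gamma> / 4) + \<epsilon>) * real X"
      using K[OF z \<epsilon>] by blast
    show ?thesis
    proof (intro exI[of _ "max 1 X0"] allI impI)
      fix X assume X: "X \<ge> max 1 X0"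
      define P where "P = {p. prime p \<and> z < p \<and> p \<le> C0 * X}"
      have finP: "finite P" by (rule finite_subset[of _ "{..C0 * X}"]) (auto simp: P_def)
      define U where "U = {m. m \<le> X \<and> c * int m \<noteq> b \<and> (\<exists>p. prime p \<and> z < p \<and> int p dvd c * int m - b \<and> int p dvd f m)}"
      have "U \<subseteq> (\<Union>p\<in>P. V X p)"
      proof
        fix m assume "m \<in> U"
        then obtain p where m: "m \<le> X" "c * int m \<noteq> b" and p: "prime p" "z < p" "int p dvd c * int m - b" "int p dvd f m"
          by (auto simp: U_def)
        have "int p \<le> \<bar>c * int m - b\<bar>" using dvd_imp_le_int[OF _ p(3)] m(2) by simp
        also have "\<dots> \<le> c * int m + \<bar>b\<bar>"
          using c abs_triangle_ineq4[of "c * int m" b] by simp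
        also have "\<dots> \<le> c * int X + \<bar>b\<bar> * int X"
        proof (intro add_mono mult_left_mono)
          have "\<bar>b\<bar> * 1 \<le> \<bar>b\<bar> * int X" using X by (intro mult_left_mono) auto
          then show "\<bar>b\<bar> \<le> \<bar>b\<bar> * int X" by simp
        qed (use m c in auto)
        also have "\<dots> = int (C0 * X)" using c by (simp add: C0_def algebra_simps)
        finally have "p \<le> C0 * X" by (simp only: of_nat_le_iff)
        then show "m \<in> (\<Union>p\<in>P. V X p)" using m p by (auto simp: P_def V_def)
      qed
      then have "card U \<le> card (\<Union>p\<in>P. V X p)" using finP finV by (intro card_mono) auto
      also have "\<dots> \<le> (\<Sum>p\<in>P. card (V X p))" by (rule card_UN_le[OF finP])
      finally have "real (card U) \<le> (\<Sum>p\<in>P. real (card (V X p)))" by (metis of_nat_le_iff of_nat_sum)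
      also have "\<dots> \<le> (K * real z powr (- \<gamma> / 4) + \<epsilon>) * real X" using X0[of X] X by (simp add: P_def)
      finally show "real (card U) \<le> (K * real z powr (- (\<gamma> / 4)) + \<epsilon>) * real X" by simp
    qed
  qed
  then show ?thesis using \<gamma>(1)
    by (intro exI[of _ K] exI[of _ "\<gamma> / 4"] exI[of _ "max 1 z0"]) auto
qed

end

section \<open>Closed form of linear recurrences\<close>

text \<open>The action of polynomials on sequences in which X is the shift from f(n) to f(n + 1);
  products of polynomials become compositions.\<close>

definition poly_shift_op :: "complex poly \<Rightarrow> (nat \<Rightarrow> complex) \<Rightarrow> nat \<Rightarrow> complex" where
  "poly_shift_op q f n = (\<Sum>i\<le>degree q. coeff q i * f (n + i))"

lemma poly_shift_op_eq:
  assumes "degree q \<le> N"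
  shows "poly_shift_op q f n = (\<Sum>i\<le>N. coeff q i * f (n + i))"
  unfolding poly_shift_op_def
  by (rule sum.mono_neutral_left) (use assms in \<open>auto simp: coeff_eq_0\<close>)

lemma poly_shift_op_diff: "poly_shift_op (p - q) f n = poly_shift_op p f n - poly_shift_op q f n"
proof -
  define N where "N = max (degree p) (degree q)"
  have "degree (p - q) \<le> N" "degree p \<le> N" "degree q \<le> N" by (auto simp: N_def degree_diff_le)
  then show ?thesis by (simp add: poly_shift_op_eq[of _ N] left_diff_distrib sum_subtractf)
qed

lemma poly_shift_op_add: "poly_shift_op (p + q) f n = poly_shift_op p f n + poly_shift_op q f n"
proof -
  define N where "N = max (degree p) (degree q)"
  have "degree (p + q) \<le> N" "degree p \<le> N" "degree q \<le> N" by (auto simp: N_def degree_add_le)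
  then show ?thesis by (simp add: poly_shift_op_eq[of _ N] distrib_right sum.distrib)
qed

lemma poly_shift_op_sum: "poly_shift_op (\<Sum>i\<in>I. p i) f n = (\<Sum>i\<in>I. poly_shift_op (p i) f n)"
proof (induction I rule: infinite_finite_induct)
  case (insert x F)
  then show ?case by (simp add: poly_shift_op_add)
qed (simp_all add: poly_shift_op_def)

lemma poly_shift_op_monom: "poly_shift_op (monom c d) f n = c * f (n + d)"
proof -
  have "poly_shift_op (monom c d) f n = (\<Sum>i\<le>d. coeff (monom c d) i * f (n + i))"
    by (rule poly_shift_op_eq) (rule degree_monom_le)
  also have "\<dots> = (\<Sum>i\<le>d. if i = d then c * f (n + d) else 0)"
    by (rule sum.cong) auto
  finally show ?thesis by simp
qed

lemma poly_shift_op_linear_mult: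
  "poly_shift_op (q * [:- \<beta>, 1:]) f n = poly_shift_op q (\<lambda>m. f (m + 1) - \<beta> * f m) n"
proof -
  have *: "poly_shift_op (pCons 0 q) f n = (\<Sum>i\<le>degree q. coeff q i * f (n + i + 1))"
  proof -
    have "poly_shift_op (pCons 0 q) f n = (\<Sum>i\<le>Suc (degree q). coeff (pCons 0 q) i * f (n + i))"
      by (rule poly_shift_op_eq) (rule degree_pCons_le)
    also have "\<dots> = (\<Sum>i\<le>degree q. coeff q i * f (n + i + 1))"
      by (subst sum.atMost_Suc_shift) simp
    finally show ?thesis .
  qed
  have sm: "poly_shift_op (Polynomial.smult \<beta> q) f n = \<beta> * poly_shift_op q f n"
    by (subst poly_shift_op_eq[of _ "degree q"])
       (auto simp: poly_shift_op_def sum_distrib_left mult.assoc degree_smult_le)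
  have "q * [:- \<beta>, 1:] = pCons 0 q - Polynomial.smult \<beta> q" by simp
  then have "poly_shift_op (q * [:- \<beta>, 1:]) f n = poly_shift_op (pCons 0 q) f n - \<beta> * poly_shift_op q f n"
    by (simp only: poly_shift_op_diff sm)
  also have "\<dots> = poly_shift_op q (\<lambda>m. f (m + 1) - \<beta> * f m) n"
    unfolding * by (simp add: poly_shift_op_def sum_distrib_left sum_subtractf algebra_simps)
  finally show ?thesis .
qed

lemma coeff_monom_pcompose_shift:
  "coeff (monom c d \<circ>\<^sub>p [:1, 1:]) i = c * of_nat (d choose i)" for c :: complex
proof -
  have "monom c d \<circ>\<^sub>p [:1, 1:] = Polynomial.smult c ([:1, 1:] ^ d)"
    by (simp add: monom_altdef pcompose_smult pcompose_hom.hom_power pcompose_pCons)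
  moreover have "coeff ([:1, 1:] ^ d :: complex poly) i = of_nat (d choose i)"
  proof (cases "i \<le> d")
    case False
    have "degree ([:1, 1:] ^ d :: complex poly) \<le> 1 * d" by (rule order_trans[OF degree_power_le]) simp
    then show ?thesis using False by (simp add: coeff_eq_0)
  qed (simp add: coeff_linear_poly_power)
  ultimately show ?thesis by simp
qed

text \<open>The operator is triangular in the degree. If \<alpha> and \<beta> differ, it multiplies
  the leading coefficient by \<alpha> - \<beta>. In the resonant case \<alpha> = \<beta> it lowers a
  positive degree by one and multiplies the leading coefficient by \<alpha> times the degree. So the
  top coefficient of \<open>P\<close> can be matched and the remainder left to induction. Resonance
  is how repeated roots produce higher degrees.\<close>

lemma solve_poly_difference_equation:
  assumes "alg \<alpha>" "alg \<beta>" "\<alpha> \<noteq> 0" "alg_poly P"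
  shows "\<exists>Q. alg_poly Q \<and> Polynomial.smult \<alpha> (Q \<circ>\<^sub>p [:1, 1:]) - Polynomial.smult \<beta> Q = P"
proof -
  define T where "T Q = Polynomial.smult \<alpha> (Q \<circ>\<^sub>p [:1, 1:]) - Polynomial.smult \<beta> Q" for Q
  have Tadd: "T (Q + R) = T Q + T R" for Q R
    by (simp add: T_def pcompose_add smult_add_right)
  have Tmonom: "coeff (T (monom c d)) i = c * (\<alpha> * of_nat (d choose i) - (if i = d then \<beta> else 0))" for c d i
    by (simp add: T_def coeff_monom_pcompose_shift algebra_simps)
  have alg_monom: "alg_poly (monom c d)" if "alg c" for c d using that by (simp add: alg_poly_def)
  have step: "\<exists>Q0. alg_poly Q0 \<and> (\<forall>i\<ge>N. coeff (T Q0) i = coeff P i)"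
    if "alg_poly P" "\<forall>i\<ge>Suc N. coeff P i = 0" for P N
  proof (cases "\<alpha> = \<beta>")
    case True
    \<comment> \<open>Resonant case: degree \<open>N\<close> is produced by a monomial of degree
      \<open>Suc N\<close>.\<close>
    define c where "c = coeff P N / (\<alpha> * of_nat (Suc N))"
    have "alg c" unfolding c_def using assms that(1) by (intro alg_divide alg_mult) (auto simp: alg_poly_def simp del: of_nat_Suc)
    moreover have "coeff (T (monom c (Suc N))) i = coeff P i" if "i \<ge> N" for i
    proof (cases "i = N")
      case True
      have "coeff (T (monom c (Suc N))) N = c * (\<alpha> * of_nat (Suc N))"
        unfolding Tmonom by (simp del: of_nat_Suc)
      also have "\<dots> = coeff P N" using assms(3) by (simp add: c_def del: of_nat_Suc)
      finally show ?thesis using True by simp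
    next
      case False
      then have "i \<ge> Suc N" using \<open>i \<ge> N\<close> by simp
      then have "coeff P i = 0" using \<open>\<forall>i\<ge>Suc N. coeff P i = 0\<close> by blast
      moreover have "\<alpha> * of_nat (Suc N choose i) - (if i = Suc N then \<beta> else 0) = 0"
        using \<open>i \<ge> Suc N\<close> \<open>\<alpha> = \<beta>\<close> by (cases "i = Suc N") (auto simp: binomial_eq_0 simp del: binomial_Suc_Suc)
      ultimately show ?thesis unfolding Tmonom by simp
    qed
    ultimately show ?thesis using alg_monom by blast
  next
    case False
    define c where "c = coeff P N / (\<alpha> - \<beta>)"
    have "alg c" unfolding c_def using assms that(1) by (intro alg_divide alg_diff) (auto simp: alg_poly_def)
    moreover have "coeff (T (monom c N)) i = coeff P i" if "i \<ge> N" for i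
    proof (cases "i = N")
      case True
      then show ?thesis using False unfolding Tmonom by (simp add: c_def)
    next
      case False
      then have "coeff P i = 0" using \<open>\<forall>i\<ge>Suc N. coeff P i = 0\<close> \<open>i \<ge> N\<close> by simp
      then show ?thesis unfolding Tmonom using False \<open>i \<ge> N\<close> by (simp add: binomial_eq_0)
    qed
    ultimately show ?thesis using alg_monom by blast
  qed
  have T_alg: "alg_poly (T Q)" if "alg_poly Q" for Q
    unfolding T_def using that assms by (intro alg_poly_diff alg_poly_smult alg_poly_pcompose_linear) auto
  have "\<exists>Q. alg_poly Q \<and> T Q = P" if "alg_poly P" "\<forall>i\<ge>N. coeff P i = 0" for N P
    using that
  proof (induction N arbitrary: P)
    case 0
    then have "P = 0" by (simp add: poly_eq_iff)
    moreover have "T 0 = 0" by (simp add: T_def)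
    ultimately show ?case using alg_poly_0 by blast
  next
    case (Suc N)
    obtain Q0 where Q0: "alg_poly Q0" "\<forall>i\<ge>N. coeff (T Q0) i = coeff P i"
      using step[OF Suc.prems] by blast
    have "\<exists>Q. alg_poly Q \<and> T Q = P - T Q0"
      by (rule Suc.IH) (use Q0 Suc.prems T_alg in \<open>auto intro: alg_poly_diff\<close>)
    then obtain Q1 where "alg_poly Q1" "T Q1 = P - T Q0" by blast
    then have "alg_poly (Q0 + Q1)" "T (Q0 + Q1) = P" using Q0 by (auto simp: Tadd intro: alg_poly_add)
    then show ?case by blast
  qed
  from this[OF assms(4), of "Suc (degree P)"] show ?thesis
    by (auto simp: T_def coeff_eq_0)
qed

text \<open>Splitting off the last factor X - \<beta> leaves g(m) = f(m + 1) - \<beta> f(m), which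
  the shorter product annihilates. A termwise solution of this first-order equation differs from
  \<open>f\<close> by some \<open>h\<close> with h(m + 1) = \<beta> h(m), a geometric sequence.
  Roots may repeat in the enumeration, while the sum runs over their distinct values.\<close>

lemma recurrence_closed_form:
  fixes root :: "nat \<Rightarrow> complex"
  assumes "\<And>i. i < n \<Longrightarrow> alg (root i)" "\<And>i. i < n \<Longrightarrow> root i \<noteq> 0" "\<And>m. alg (f m)"
    and "\<And>m. poly_shift_op (\<Prod>i<n. [:- root i, 1:]) f m = 0"
  shows "\<exists>P. (\<forall>\<alpha>. alg_poly (P \<alpha>)) \<and> (\<forall>m. f m = (\<Sum>\<alpha>\<in>root ` {..<n}. poly (P \<alpha>) (of_nat m) * \<alpha> ^ m))"
  using assms
proof (induction n arbitrary: f)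
  case 0
  have "f m = 0" for m using "0.prems"(4)[of m] by (simp add: poly_shift_op_def)
  then show ?case by (intro exI[of _ "\<lambda>_. 0"]) auto
next
  case (Suc n)
  define \<beta> where "\<beta> = root n"
  have \<beta>: "alg \<beta>" "\<beta> \<noteq> 0" using Suc.prems by (auto simp: \<beta>_def)
  define g where "g m = f (m + 1) - \<beta> * f m" for m
  have "\<exists>P. (\<forall>\<alpha>. alg_poly (P \<alpha>)) \<and> (\<forall>m. g m = (\<Sum>\<alpha>\<in>root ` {..<n}. poly (P \<alpha>) (of_nat m) * \<alpha> ^ m))"
  proof (rule Suc.IH)
    show "alg (g m)" for m unfolding g_def using Suc.prems(3) \<beta> by (intro alg_diff alg_mult)
    show "poly_shift_op (\<Prod>i<n. [:- root i, 1:]) g m = 0" for m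
      using Suc.prems(4)[of m] unfolding g_def[abs_def] poly_shift_op_linear_mult[symmetric]
      by (simp only: prod.lessThan_Suc \<beta>_def)
  qed (use Suc.prems in auto)
  then obtain P where P: "\<And>\<alpha>. alg_poly (P \<alpha>)" "\<And>m. g m = (\<Sum>\<alpha>\<in>root ` {..<n}. poly (P \<alpha>) (of_nat m) * \<alpha> ^ m)"
    by blast
  define S where "S = root ` {..<n}"
  have S: "finite S" "\<And>\<alpha>. \<alpha> \<in> S \<Longrightarrow> alg \<alpha> \<and> \<alpha> \<noteq> 0" using Suc.prems by (auto simp: S_def)
  have "\<forall>\<alpha>\<in>S. \<exists>Q. alg_poly Q \<and> Polynomial.smult \<alpha> (Q \<circ>\<^sub>p [:1, 1:]) - Polynomial.smult \<beta> Q = P \<alpha>"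
    using solve_poly_difference_equation[OF _ \<beta>(1) _ P(1)] S(2) by blast
  then obtain Q where Q: "\<forall>\<alpha>\<in>S. alg_poly (Q \<alpha>) \<and> Polynomial.smult \<alpha> (Q \<alpha> \<circ>\<^sub>p [:1, 1:]) - Polynomial.smult \<beta> (Q \<alpha>) = P \<alpha>"
    by (auto dest!: bchoice)
  define h where "h m = f m - (\<Sum>\<alpha>\<in>S. poly (Q \<alpha>) (of_nat m) * \<alpha> ^ m)" for m
  have h_step: "h (m + 1) = \<beta> * h m" for m
  proof -
    have "\<alpha> * poly (Q \<alpha>) (of_nat (m + 1)) - \<beta> * poly (Q \<alpha>) (of_nat m) = poly (P \<alpha>) (of_nat m)" if "\<alpha> \<in> S" for \<alpha>
    proof -
      have "poly (P \<alpha>) (of_nat m) = poly (Polynomial.smult \<alpha> (Q \<alpha> \<circ>\<^sub>p [:1, 1:]) - Polynomial.smult \<beta> (Q \<alpha>)) (of_nat m)"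
        using Q that by simp
      then show ?thesis by (simp add: poly_pcompose add.commute)
    qed
    then have "(\<Sum>\<alpha>\<in>S. poly (P \<alpha>) (of_nat m) * \<alpha> ^ m) = (\<Sum>\<alpha>\<in>S. (\<alpha> * poly (Q \<alpha>) (of_nat (m + 1)) - \<beta> * poly (Q \<alpha>) (of_nat m)) * \<alpha> ^ m)"
      by (intro sum.cong) auto
    also have "\<dots> = (\<Sum>\<alpha>\<in>S. poly (Q \<alpha>) (of_nat (m + 1)) * \<alpha> ^ (m + 1)) - \<beta> * (\<Sum>\<alpha>\<in>S. poly (Q \<alpha>) (of_nat m) * \<alpha> ^ m)"
      by (simp add: sum_distrib_left sum_subtractf algebra_simps)
    finally have "f (m + 1) - \<beta> * f m = (\<Sum>\<alpha>\<in>S. poly (Q \<alpha>) (of_nat (m + 1)) * \<alpha> ^ (m + 1)) - \<beta> * (\<Sum>\<alpha>\<in>S. poly (Q \<alpha>) (of_nat m) * \<alpha> ^ m)"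
      using P(2)[of m] by (simp add: g_def S_def)
    then show ?thesis unfolding h_def by (simp only: right_diff_distrib) (simp add: algebra_simps)
  qed
  have h: "h m = h 0 * \<beta> ^ m" for m
    by (induction m) (use h_step in \<open>auto simp: mult_ac\<close>)
  have h0: "alg (h 0)"
  proof -
    have "alg (poly (Q \<alpha>) 0)" if "\<alpha> \<in> S" for \<alpha>
      using Q that by (auto simp: poly_0_coeff_0 alg_poly_def)
    then show ?thesis unfolding h_def using Suc.prems(3) by (auto intro!: alg_diff alg_sum)
  qed
  define R where "R \<alpha> = (if \<alpha> \<in> S then Q \<alpha> else 0) + (if \<alpha> = \<beta> then [:h 0:] else 0)" for \<alpha>
  have R: "alg_poly (R \<alpha>)" for \<alpha>
    using Q h0 by (auto simp: R_def alg_poly_pCons_iff intro!: alg_poly_add)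
  have "f m = (\<Sum>\<alpha>\<in>insert \<beta> S. poly (R \<alpha>) (of_nat m) * \<alpha> ^ m)" for m
  proof -
    have "(\<Sum>\<alpha>\<in>insert \<beta> S. poly (R \<alpha>) (of_nat m) * \<alpha> ^ m) =
      (\<Sum>\<alpha>\<in>insert \<beta> S. (if \<alpha> \<in> S then poly (Q \<alpha>) (of_nat m) * \<alpha> ^ m else 0) + (if \<alpha> = \<beta> then h 0 * \<beta> ^ m else 0))"
      by (rule sum.cong) (auto simp: R_def algebra_simps)
    also have "\<dots> = (\<Sum>\<alpha>\<in>insert \<beta> S. if \<alpha> \<in> S then poly (Q \<alpha>) (of_nat m) * \<alpha> ^ m else 0) + h 0 * \<beta> ^ m"
      using S(1) by (simp add: sum.distrib)
    also have "(\<Sum>\<alpha>\<in>insert \<beta> S. if \<alpha> \<in> S then poly (Q \<alpha>) (of_nat m) * \<alpha> ^ m else 0) = (\<Sum>\<alpha>\<in>S. poly (Q \<alpha>) (of_nat m) * \<alpha> ^ m)"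
      by (rule sum.mono_neutral_cong_right) (use S(1) in auto)
    also have "h 0 * \<beta> ^ m = h m" by (simp add: h[of m])
    finally show ?thesis by (simp add: h_def)
  qed
  moreover have "root ` {..<Suc n} = insert \<beta> S" by (simp add: lessThan_Suc S_def \<beta>_def)
  ultimately show ?case using R by (intro exI[of _ R]) simp
qed

section \<open>Characteristic roots and arithmetic subsequences\<close>

definition char_roots :: "nat \<Rightarrow> (nat \<Rightarrow> int) \<Rightarrow> complex set" where
  "char_roots k a = {z. poly (map_poly of_int (recurrence_char_poly k a)) z = 0}"

lemma recurrence_char_poly_props:
  assumes "integral_linear_recurrence k a F"
  shows "degree (recurrence_char_poly k a) = k" "lead_coeff (recurrence_char_poly k a) = 1"
    and "coeff (recurrence_char_poly k a) 0 \<noteq> 0"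
proof -
  have k: "k \<ge> 1" "a k \<noteq> 0" using assms by (auto simp: integral_linear_recurrence_def)
  define r where "r = (\<Sum>i=1..k. monom (a i) (k - i))"
  have r: "degree r < k"
  proof -
    have "degree r \<le> k - 1" unfolding r_def
      by (rule degree_sum_le) (auto intro: order_trans[OF degree_monom_le])
    then show ?thesis using k by simp
  qed
  have c: "coeff (recurrence_char_poly k a) k = 1"
    unfolding recurrence_char_poly_def r_def[symmetric] using r by (simp add: coeff_eq_0)
  have "degree (recurrence_char_poly k a) \<le> k"
    unfolding recurrence_char_poly_def r_def[symmetric] using r
    by (intro degree_diff_le degree_monom_le) auto
  moreover have "k \<le> degree (recurrence_char_poly k a)" using c by (intro le_degree) simp
  ultimately show "degree (recurrence_char_poly k a) = k" by simp
  then show "lead_coeff (recurrence_char_poly k a) = 1" using c by simp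
  have "coeff r 0 = (\<Sum>i=1..k. if i = k then a k else 0)"
    unfolding r_def coeff_sum by (rule sum.cong) auto
  then have "coeff r 0 = a k" using k by simp
  then show "coeff (recurrence_char_poly k a) 0 \<noteq> 0"
    unfolding recurrence_char_poly_def r_def[symmetric] using k by simp
qed

lemma char_roots_props:
  assumes "integral_linear_recurrence k a F"
  shows "finite (char_roots k a)" "\<And>\<alpha>. \<alpha> \<in> char_roots k a \<Longrightarrow> algebraic_int \<alpha>"
    "\<And>\<alpha>. \<alpha> \<in> char_roots k a \<Longrightarrow> \<alpha> \<noteq> 0"
proof -
  let ?p = "recurrence_char_poly k a"
  note props = recurrence_char_poly_props[OF assms]
  have "?p \<noteq> 0" using props(2) by auto
  then have "map_poly of_int ?p \<noteq> (0 :: complex poly)" by simp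
  then show "finite (char_roots k a)" unfolding char_roots_def by (rule poly_roots_finite)
  show "algebraic_int \<alpha>" if "\<alpha> \<in> char_roots k a" for \<alpha>
    using that props(2) algebraic_int_altdef_ipoly unfolding char_roots_def by blast
  show "\<alpha> \<noteq> 0" if "\<alpha> \<in> char_roots k a" for \<alpha>
    using that props(3) by (auto simp: char_roots_def poly_0_coeff_0 coeff_map_poly)
qed

lemma integral_linear_recurrence_closed_form:
  assumes "integral_linear_recurrence k a F"
  shows "\<exists>P. (\<forall>\<alpha>. alg_poly (P \<alpha>)) \<and>
    (\<forall>n. of_int (F n) = (\<Sum>\<alpha>\<in>char_roots k a. poly (P \<alpha>) (of_nat n) * \<alpha> ^ n))"
proof -
  let ?q = "map_poly of_int (recurrence_char_poly k a) :: complex poly"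
  note props = recurrence_char_poly_props[OF assms]
  have deg: "degree ?q = k" "lead_coeff ?q = 1" using props by (simp_all add: degree_map_poly coeff_map_poly)
  obtain root where root: "Polynomial.smult (lead_coeff ?q) (\<Prod>i<degree ?q. [:- root i, 1:]) = ?q"
    using complex_poly_decompose'[of ?q] by blast
  then have q: "?q = (\<Prod>i<k. [:- root i, 1:])" using deg by simp
  have im: "char_roots k a = root ` {..<k}"
    unfolding char_roots_def q by (auto simp: poly_prod)
  have op: "poly_shift_op ?q (\<lambda>n. of_int (F n)) m = 0" for m
  proof -
    have "?q = monom 1 k - (\<Sum>i=1..k. monom (of_int (a i)) (k - i))"
      by (rule poly_eqI) (simp add: recurrence_char_poly_def coeff_map_poly coeff_sum of_int_sum if_distrib[of of_int] cong: if_cong)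
    then have "poly_shift_op ?q (\<lambda>n. of_int (F n)) m = of_int (F (m + k)) - (\<Sum>i=1..k. of_int (a i) * of_int (F (m + (k - i))))"
      by (simp only: poly_shift_op_diff poly_shift_op_sum poly_shift_op_monom mult_1)
    also have "\<dots> = of_int (F (m + k) - (\<Sum>i=1..k. a i * F (m + (k - i))))" by simp
    also have "F (m + k) = (\<Sum>i=1..k. a i * F (m + k - i))"
      using assms unfolding integral_linear_recurrence_def by simp
    also have "\<dots> = (\<Sum>i=1..k. a i * F (m + (k - i)))" by (rule sum.cong) auto
    finally show ?thesis by simp
  qed
  have mem: "root i \<in> char_roots k a" if "i < k" for i using that im by auto
  have "\<exists>P. (\<forall>\<alpha>. alg_poly (P \<alpha>)) \<and> (\<forall>m. of_int (F m) = (\<Sum>\<alpha>\<in>root ` {..<k}. poly (P \<alpha>) (of_nat m) * \<alpha> ^ m))"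
    by (rule recurrence_closed_form)
       (use mem char_roots_props[OF assms] op in \<open>auto simp: q intro: algebraic_int_imp_alg\<close>)
  then show ?thesis unfolding im .
qed

lemma nondegenerate_exp_poly:
  assumes "integral_linear_recurrence k a F" "nondegenerate_recurrence k a"
  shows "\<exists>\<Gamma> Q. exp_poly \<Gamma> Q F"
proof -
  obtain P where P: "\<And>\<alpha>. alg_poly (P \<alpha>)"
    "\<And>n. of_int (F n) = (\<Sum>\<alpha>\<in>char_roots k a. poly (P \<alpha>) (of_nat n) * \<alpha> ^ n)"
    using integral_linear_recurrence_closed_form[OF assms(1)] by auto
  have "exp_poly (char_roots k a) P F"
  proof
    fix g h :: complex and d :: nat
    assume gh: "g \<in> char_roots k a" "h \<in> char_roots k a" "g \<noteq> h" "d \<ge> 1"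
    have "h \<noteq> 0" using char_roots_props(3)[OF assms(1) gh(2)] .
    show "g ^ d \<noteq> h ^ d"
    proof
      assume "g ^ d = h ^ d"
      then have "(g / h) ^ d = 1" using \<open>h \<noteq> 0\<close> by (simp add: power_divide)
      then have "root_of_unity (g / h)" using gh(4) unfolding root_of_unity_def by blast
      then show False using assms(2) gh unfolding nondegenerate_recurrence_def char_roots_def by blast
    qed
  qed (use P char_roots_props[OF assms(1)] in auto)
  then show ?thesis by blast
qed

lemma ex_common_root_of_unity_order:
  assumes "finite \<Gamma>"
  shows "\<exists>l\<ge>1. \<forall>g\<in>\<Gamma>. \<forall>h\<in>\<Gamma>. root_of_unity (g / h) \<longrightarrow> (g / h) ^ l = 1"
proof -
  define I where "I = {x \<in> \<Gamma> \<times> \<Gamma>. root_of_unity (fst x / snd x)}"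
  have fin: "finite I" using assms by (auto simp: I_def)
  have "\<forall>x\<in>I. \<exists>m::nat. m \<ge> 1 \<and> (fst x / snd x) ^ m = 1" by (auto simp: I_def root_of_unity_def)
  then obtain m :: "complex \<times> complex \<Rightarrow> nat" where m: "\<forall>x\<in>I. m x \<ge> 1 \<and> (fst x / snd x) ^ m x = 1"
    by (auto dest!: bchoice)
  have "(\<Prod>x\<in>I. m x) \<ge> 1" using m fin by (intro prod_ge_1) auto
  moreover have "(g / h) ^ (\<Prod>x\<in>I. m x) = 1" if "g \<in> \<Gamma>" "h \<in> \<Gamma>" "root_of_unity (g / h)" for g h
  proof -
    have x: "(g, h) \<in> I" using that by (auto simp: I_def)
    then have "m (g, h) dvd (\<Prod>x\<in>I. m x)" using fin by (rule_tac dvd_prodI)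
    then obtain j where "(\<Prod>x\<in>I. m x) = m (g, h) * j" by auto
    then show ?thesis using m x by (auto simp: power_mult)
  qed
  ultimately show ?thesis by blast
qed

text \<open>Characteristic roots whose quotient is a root of unity acquire the same l-th power and
  are collected into one base. Distinct bases then stay distinct under all powers: an equality of
  d-th powers would make the quotient of two roots a root of unity, and their l-th powers would
  agree already.\<close>

lemma subsequence_exp_poly:
  assumes "integral_linear_recurrence k a F"
  shows "\<exists>l\<ge>1. \<forall>s. \<exists>\<Gamma> Q. exp_poly \<Gamma> Q (\<lambda>m. F (s + l * m))"
proof -
  define \<Gamma> where "\<Gamma> = char_roots k a"
  note cr = char_roots_props[OF assms, folded \<Gamma>_def]
  obtain P where P: "\<And>\<alpha>. alg_poly (P \<alpha>)"
    "\<And>n. of_int (F n) = (\<Sum>\<alpha>\<in>\<Gamma>. poly (P \<alpha>) (of_nat n) * \<alpha> ^ n)"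
    using integral_linear_recurrence_closed_form[OF assms] unfolding \<Gamma>_def by auto
  obtain l where l: "l \<ge> 1" "\<And>g h. g \<in> \<Gamma> \<Longrightarrow> h \<in> \<Gamma> \<Longrightarrow> root_of_unity (g / h) \<Longrightarrow> (g / h) ^ l = 1"
    using ex_common_root_of_unity_order[OF cr(1)] by blast
  have "exp_poly ((\<lambda>\<alpha>. \<alpha> ^ l) ` \<Gamma>)
     (\<lambda>g. \<Sum>\<alpha>\<in>{\<alpha>\<in>\<Gamma>. \<alpha> ^ l = g}. Polynomial.smult (\<alpha> ^ s) (P \<alpha> \<circ>\<^sub>p [:of_nat s, of_nat l:])) (\<lambda>m. F (s + l * m))" for s
  proof
    show "finite ((\<lambda>\<alpha>. \<alpha> ^ l) ` \<Gamma>)" using cr(1) by simp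
    show "algebraic_int g" "g \<noteq> 0" if "g \<in> (\<lambda>\<alpha>. \<alpha> ^ l) ` \<Gamma>" for g using that cr by auto
    show "g ^ d \<noteq> h ^ d" if gh: "g \<in> (\<lambda>\<alpha>. \<alpha> ^ l) ` \<Gamma>" "h \<in> (\<lambda>\<alpha>. \<alpha> ^ l) ` \<Gamma>" "g \<noteq> h" "d \<ge> 1" for g h d
    proof
      assume eq: "g ^ d = h ^ d"
      obtain \<alpha> \<beta> where ab: "\<alpha> \<in> \<Gamma>" "\<beta> \<in> \<Gamma>" "g = \<alpha> ^ l" "h = \<beta> ^ l" using gh by auto
      have "\<beta> \<noteq> 0" using cr(3) ab by blast
      then have "(\<alpha> / \<beta>) ^ (l * d) = 1" using eq ab by (simp add: power_mult power_divide)
      moreover have "l * d \<ge> 1" using l(1) gh(4) by simp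
      ultimately have "root_of_unity (\<alpha> / \<beta>)" unfolding root_of_unity_def by blast
      then have "(\<alpha> / \<beta>) ^ l = 1" using l(2) ab by blast
      then show False using \<open>\<beta> \<noteq> 0\<close> ab gh(3) by (simp add: power_divide)
    qed
    show "alg_poly (\<Sum>\<alpha>\<in>{\<alpha>\<in>\<Gamma>. \<alpha> ^ l = g}. Polynomial.smult (\<alpha> ^ s) (P \<alpha> \<circ>\<^sub>p [:of_nat s, of_nat l:]))" for g
      using P(1) cr(2) by (intro alg_poly_sum alg_poly_smult alg_poly_pcompose_linear alg_power) (auto intro: algebraic_int_imp_alg)
    show "of_int (F (s + l * m)) = (\<Sum>g\<in>(\<lambda>\<alpha>. \<alpha> ^ l) ` \<Gamma>.
        poly (\<Sum>\<alpha>\<in>{\<alpha>\<in>\<Gamma>. \<alpha> ^ l = g}. Polynomial.smult (\<alpha> ^ s) (P \<alpha> \<circ>\<^sub>p [:of_nat s, of_nat l:])) (of_nat m) * g ^ m)" for m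
    proof -
      have "(\<Sum>g\<in>(\<lambda>\<alpha>. \<alpha> ^ l) ` \<Gamma>. poly (\<Sum>\<alpha>\<in>{\<alpha>\<in>\<Gamma>. \<alpha> ^ l = g}. Polynomial.smult (\<alpha> ^ s) (P \<alpha> \<circ>\<^sub>p [:of_nat s, of_nat l:])) (of_nat m) * g ^ m)
        = (\<Sum>g\<in>(\<lambda>\<alpha>. \<alpha> ^ l) ` \<Gamma>. \<Sum>\<alpha>\<in>{\<alpha>\<in>\<Gamma>. \<alpha> ^ l = g}. poly (P \<alpha>) (of_nat (s + l * m)) * \<alpha> ^ (s + l * m))"
      proof (rule sum.cong[OF refl])
        fix g assume "g \<in> (\<lambda>\<alpha>. \<alpha> ^ l) ` \<Gamma>"
        show "poly (\<Sum>\<alpha>\<in>{\<alpha>\<in>\<Gamma>. \<alpha> ^ l = g}. Polynomial.smult (\<alpha> ^ s) (P \<alpha> \<circ>\<^sub>p [:of_nat s, of_nat l:])) (of_nat m) * g ^ m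
           = (\<Sum>\<alpha>\<in>{\<alpha>\<in>\<Gamma>. \<alpha> ^ l = g}. poly (P \<alpha>) (of_nat (s + l * m)) * \<alpha> ^ (s + l * m))"
          unfolding poly_sum sum_distrib_right
        proof (rule sum.cong[OF refl])
          fix \<alpha> assume "\<alpha> \<in> {\<alpha>\<in>\<Gamma>. \<alpha> ^ l = g}"
          then have "g = \<alpha> ^ l" by simp
          then show "poly (Polynomial.smult (\<alpha> ^ s) (P \<alpha> \<circ>\<^sub>p [:of_nat s, of_nat l:])) (of_nat m) * g ^ m
            = poly (P \<alpha>) (of_nat (s + l * m)) * \<alpha> ^ (s + l * m)"
            by (simp add: poly_pcompose power_add power_mult mult_ac)
        qed
      qed
      also have "\<dots> = (\<Sum>\<alpha>\<in>\<Gamma>. poly (P \<alpha>) (of_nat (s + l * m)) * \<alpha> ^ (s + l * m))"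
        by (rule sum.image_gen[OF cr(1), symmetric])
      finally show ?thesis using P(2)[of "s + l * m"] by simp
    qed
  qed
  then show ?thesis using l(1) by blast
qed

section \<open>Natural density and periodicity\<close>

definition count_upto :: "nat set \<Rightarrow> nat \<Rightarrow> nat" where
  "count_upto S N = card {n \<in> S. 1 \<le> n \<and> n \<le> N}"

lemma finite_count_set [simp]: "finite {n \<in> S. 1 \<le> n \<and> n \<le> (N::nat)}"
  by (rule finite_subset[of _ "{..N}"]) auto

text \<open>Real and integral cut-offs give the same limit because floor(x) / x tends to 1.\<close>

lemma has_natural_density_iff:
  "has_natural_density S \<delta> \<longleftrightarrow> (\<lambda>N. real (count_upto S N) / real N) \<longlonglongrightarrow> \<delta>"
proof
  assume "has_natural_density S \<delta>"
  then have "((\<lambda>x::real. real (card {n \<in> S. 1 \<le> n \<and> real n \<le> x}) / x) \<longlongrightarrow> \<delta>) at_top"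
    by (simp add: has_natural_density_def)
  from filterlim_compose[OF this filterlim_real_sequentially]
  show "(\<lambda>N. real (count_upto S N) / real N) \<longlonglongrightarrow> \<delta>" by (simp add: count_upto_def)
next
  assume lim: "(\<lambda>N. real (count_upto S N) / real N) \<longlonglongrightarrow> \<delta>"
  have fl: "filterlim (\<lambda>x::real. nat \<lfloor>x\<rfloor>) sequentially at_top"
    by (intro filterlim_compose[OF filterlim_nat_sequentially filterlim_floor_sequentially])
  have "((\<lambda>x::real. real (nat \<lfloor>x\<rfloor>) / x) \<longlongrightarrow> 1) at_top"
  proof (rule tendsto_sandwich[of "\<lambda>x. 1 - 1 / x" _ _ "\<lambda>_. 1"])
    show "\<forall>\<^sub>F x::real in at_top. 1 - 1 / x \<le> real (nat \<lfloor>x\<rfloor>) / x"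
    proof (rule eventually_mono[OF eventually_gt_at_top[of 1]])
      fix x :: real assume x: "1 < x"
      have "x - 1 \<le> real (nat \<lfloor>x\<rfloor>)" using x by linarith
      then have "(x - 1) / x \<le> real (nat \<lfloor>x\<rfloor>) / x" using x by (intro divide_right_mono) auto
      then show "1 - 1 / x \<le> real (nat \<lfloor>x\<rfloor>) / x" using x by (simp add: diff_divide_distrib)
    qed
    show "\<forall>\<^sub>F x::real in at_top. real (nat \<lfloor>x\<rfloor>) / x \<le> 1"
    proof (rule eventually_mono[OF eventually_gt_at_top[of 1]])
      fix x :: real assume x: "1 < x"
      have "real (nat \<lfloor>x\<rfloor>) \<le> x" using x by linarith
      then show "real (nat \<lfloor>x\<rfloor>) / x \<le> 1" using x by simp
    qed
    have "((\<lambda>x::real. 1 - 1 / x) \<longlongrightarrow> 1 - 0) at_top"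
      by (intro tendsto_intros tendsto_divide_0[OF tendsto_const]) (simp add: filterlim_at_top_imp_at_infinity filterlim_ident)
    then show "((\<lambda>x::real. 1 - 1 / x) \<longlongrightarrow> 1) at_top" by simp
  qed auto
  from tendsto_mult[OF filterlim_compose[OF lim fl] this]
  have "((\<lambda>x. real (count_upto S (nat \<lfloor>x\<rfloor>)) / real (nat \<lfloor>x\<rfloor>) * (real (nat \<lfloor>x\<rfloor>) / x)) \<longlongrightarrow> \<delta>) at_top"
    by simp
  moreover have "\<forall>\<^sub>F x::real in at_top. real (count_upto S (nat \<lfloor>x\<rfloor>)) / real (nat \<lfloor>x\<rfloor>) * (real (nat \<lfloor>x\<rfloor>) / x)
      = real (card {n \<in> S. 1 \<le> n \<and> real n \<le> x}) / x"
  proof (rule eventually_mono[OF eventually_gt_at_top[of 1]])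
    fix x :: real assume x: "1 < x"
    define r where "r = nat \<lfloor>x\<rfloor>"
    have "real n \<le> x \<longleftrightarrow> n \<le> r" for n using x unfolding r_def by linarith
    then have "card {n \<in> S. 1 \<le> n \<and> real n \<le> x} = count_upto S r"
      by (simp add: count_upto_def)
    moreover have "real r \<noteq> 0" using x unfolding r_def by linarith
    ultimately show "real (count_upto S (nat \<lfloor>x\<rfloor>)) / real (nat \<lfloor>x\<rfloor>) * (real (nat \<lfloor>x\<rfloor>) / x)
      = real (card {n \<in> S. 1 \<le> n \<and> real n \<le> x}) / x" unfolding r_def[symmetric] by simp
  qed
  ultimately show "has_natural_density S \<delta>" unfolding has_natural_density_def
    by (rule Lim_transform_eventually)
qed

lemma count_upto_mono: "A \<subseteq> B \<Longrightarrow> count_upto A N \<le> count_upto B N"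
  unfolding count_upto_def by (intro card_mono) auto

lemma count_upto_Un_le: "count_upto (A \<union> B) N \<le> count_upto A N + count_upto B N"
proof -
  have "{n \<in> A \<union> B. 1 \<le> n \<and> n \<le> N} = {n \<in> A. 1 \<le> n \<and> n \<le> N} \<union> {n \<in> B. 1 \<le> n \<and> n \<le> N}" by auto
  then show ?thesis unfolding count_upto_def by (simp add: card_Un_le)
qed

lemma count_upto_disjoint:
  assumes "A \<inter> B = {}"
  shows "count_upto (A \<union> B) N = count_upto A N + count_upto B N"
proof -
  have "{n \<in> A \<union> B. 1 \<le> n \<and> n \<le> N} = {n \<in> A. 1 \<le> n \<and> n \<le> N} \<union> {n \<in> B. 1 \<le> n \<and> n \<le> N}" by auto
  then show ?thesis unfolding count_upto_def using assms by (simp add: card_Un_disjoint disjoint_iff)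
qed

lemma count_upto_finite: "finite A \<Longrightarrow> count_upto A N \<le> card A"
  unfolding count_upto_def by (intro card_mono) auto

lemma density_disjoint_Un:
  assumes "has_natural_density A \<alpha>" "has_natural_density B \<beta>" "A \<inter> B = {}"
  shows "has_natural_density (A \<union> B) (\<alpha> + \<beta>)"
  using tendsto_add[OF assms(1,2)[unfolded has_natural_density_iff]] count_upto_disjoint[OF assms(3)]
  by (simp add: has_natural_density_iff add_divide_distrib)

lemma density_finite:
  assumes "finite A"
  shows "has_natural_density A 0"
  unfolding has_natural_density_iff
proof (rule tendsto_sandwich[of "\<lambda>_. 0" _ _ "\<lambda>N. real (card A) / real N"])
  show "(\<lambda>N. real (card A) / real N) \<longlonglongrightarrow> 0" by (rule lim_const_over_n)
  show "\<forall>\<^sub>F N in sequentially. real (count_upto A N) / real N \<le> real (card A) / real N"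
    using count_upto_finite[OF assms] by (intro always_eventually allI divide_right_mono) auto
qed auto

lemma density_finite_disjoint_UN:
  assumes "finite I" "\<And>i. i \<in> I \<Longrightarrow> \<exists>\<delta>. has_natural_density (A i) \<delta>"
    "\<And>i j. i \<in> I \<Longrightarrow> j \<in> I \<Longrightarrow> i \<noteq> j \<Longrightarrow> A i \<inter> A j = {}"
  shows "\<exists>\<delta>. has_natural_density (\<Union>i\<in>I. A i) \<delta>"
  using assms
proof (induction I rule: finite_induct)
  case empty
  then show ?case using density_finite[of "{}"] by auto
next
  case (insert i I)
  then obtain \<alpha> \<beta> where "has_natural_density (A i) \<alpha>" "has_natural_density (\<Union>i\<in>I. A i) \<beta>" by force
  moreover have "A i \<inter> (\<Union>i\<in>I. A i) = {}" using insert.prems(2) insert.hyps by blast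
  ultimately have "has_natural_density (A i \<union> (\<Union>i\<in>I. A i)) (\<alpha> + \<beta>)"
    by (rule density_disjoint_Un)
  then show ?case by auto
qed

lemma card_periodic_blocks:
  fixes T n1 :: nat
  assumes per: "\<And>n. n \<ge> n1 \<Longrightarrow> n \<in> S \<longleftrightarrow> n + T \<in> S"
  shows "card (S \<inter> {n1..<n1 + q * T}) = q * card (S \<inter> {n1..<n1 + T})"
proof (induction q)
  case (Suc q)
  have per': "n \<in> S \<longleftrightarrow> n + q * T \<in> S" if "n \<ge> n1" for n q
  proof (induction q)
    case (Suc q)
    then show ?case using per[of "n + q * T"] that by (simp add: add_ac)
  qed simp
  have "S \<inter> {n1 + q * T..<n1 + Suc q * T} = (\<lambda>n. n + q * T) ` (S \<inter> {n1..<n1 + T})"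
  proof (intro equalityI subsetI)
    fix n assume n: "n \<in> S \<inter> {n1 + q * T..<n1 + Suc q * T}"
    then have "n - q * T \<in> S \<inter> {n1..<n1 + T}" using per'[of "n - q * T" q] by auto
    then show "n \<in> (\<lambda>n. n + q * T) ` (S \<inter> {n1..<n1 + T})"
      using n by (intro image_eqI[of _ _ "n - q * T"]) auto
  qed (use per' in auto)
  then have c: "card (S \<inter> {n1 + q * T..<n1 + Suc q * T}) = card (S \<inter> {n1..<n1 + T})"
    by (simp add: card_image inj_on_def)
  have "S \<inter> {n1..<n1 + Suc q * T} = (S \<inter> {n1..<n1 + q * T}) \<union> (S \<inter> {n1 + q * T..<n1 + Suc q * T})"
    by auto
  moreover have "(S \<inter> {n1..<n1 + q * T}) \<inter> (S \<inter> {n1 + q * T..<n1 + Suc q * T}) = {}" by auto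
  ultimately have "card (S \<inter> {n1..<n1 + Suc q * T}) = card (S \<inter> {n1..<n1 + q * T}) + card (S \<inter> {n1 + q * T..<n1 + Suc q * T})"
    by (simp add: card_Un_disjoint)
  then show ?case using Suc c by simp
qed simp

text \<open>The count differs from a linear function by a bounded amount, due to the initial
  stretch, to incomplete periods, and to the number 0, which a block may contain but
  \<open>count_upto\<close> ignores.\<close>

lemma density_eventually_periodic:
  fixes T n1 :: nat
  assumes "T \<ge> 1" and per: "\<And>n. n \<ge> n1 \<Longrightarrow> n \<in> S \<longleftrightarrow> n + T \<in> S"
  shows "has_natural_density S (real (card (S \<inter> {n1..<n1 + T})) / real T)"
proof -
  define R where "R = card (S \<inter> {n1..<n1 + T})"
  have RT: "R \<le> T" unfolding R_def using card_mono[of "{n1..<n1 + T}" "S \<inter> {n1..<n1 + T}"] by simp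
  define K where "K = real n1 + 2 * real T + 1"
  have bd: "\<bar>real (count_upto S N) - real R / real T * real N\<bar> \<le> K" if N: "N \<ge> n1" for N
  proof -
    define q where "q = (N - n1) div T"
    have q: "q * T \<le> N - n1" "N - n1 < (q + 1) * T"
      using assms(1) dividend_less_div_times[of T "N - n1"] by (auto simp: q_def)
    have "S \<inter> {n1..<n1 + q * T} - {0} \<subseteq> {n \<in> S. 1 \<le> n \<and> n \<le> N}" using q(1) N by auto
    then have "card (S \<inter> {n1..<n1 + q * T} - {0}) \<le> count_upto S N"
      unfolding count_upto_def by (intro card_mono) auto
    moreover have "card (S \<inter> {n1..<n1 + q * T}) \<le> card (S \<inter> {n1..<n1 + q * T} - {0}) + 1"
      using diff_card_le_card_Diff[of "{0::nat}" "S \<inter> {n1..<n1 + q * T}"] by simp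
    moreover have "card (S \<inter> {n1..<n1 + q * T}) = q * R"
      unfolding R_def by (rule card_periodic_blocks[OF per])
    ultimately have lo: "q * R \<le> count_upto S N + 1" by linarith
    have "{n \<in> S. 1 \<le> n \<and> n \<le> N} \<subseteq> {..<n1} \<union> (S \<inter> {n1..<n1 + (q + 1) * T})" using q(2) N by auto
    then have "count_upto S N \<le> card ({..<n1} \<union> (S \<inter> {n1..<n1 + (q + 1) * T}))"
      unfolding count_upto_def by (intro card_mono) auto
    also have "\<dots> \<le> card {..<n1} + card (S \<inter> {n1..<n1 + (q + 1) * T})" by (rule card_Un_le)
    also have "\<dots> = n1 + (q + 1) * R" by (simp only: card_periodic_blocks[OF per] R_def card_lessThan)
    finally have hi: "count_upto S N \<le> n1 + (q + 1) * R" .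
    have T: "real T > 0" using assms(1) by simp
    have ratio: "0 \<le> real R / real T" "real R / real T \<le> 1" using RT T by auto
    have "real (q * T) \<le> real N" using q(1) by linarith
    then have "real R / real T * real (q * T) \<le> real R / real T * real N" by (rule mult_left_mono[OF _ ratio(1)])
    then have 1: "real q * real R \<le> real R / real T * real N" using T by (simp add: mult.commute)
    have "real N \<le> real (n1 + (q + 1) * T)" using q(2) N by linarith
    then have "real R / real T * real N \<le> real R / real T * real (n1 + (q + 1) * T)" by (rule mult_left_mono[OF _ ratio(1)])
    also have "\<dots> = real R / real T * real n1 + (real q + 1) * real R" using T by (simp add: field_simps)
    also have "\<dots> \<le> real n1 + (real q + 1) * real R"
      using mult_right_mono[OF ratio(2), of "real n1"] by simp
    finally have 2: "real R / real T * real N \<le> real n1 + (real q + 1) * real R" .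
    have lo': "real q * real R \<le> real (count_upto S N) + 1" using lo by (metis of_nat_1 of_nat_add of_nat_le_iff of_nat_mult)
    have hi': "real (count_upto S N) \<le> real n1 + (real q + 1) * real R"
    proof -
      have "real (count_upto S N) \<le> real (n1 + (q + 1) * R)" using hi by (simp only: of_nat_le_iff)
      then show ?thesis by (simp add: algebra_simps)
    qed
    have RT': "real R \<le> real T" using RT by simp
    have "(real q + 1) * real R = real q * real R + real R" by (simp add: algebra_simps)
    then show ?thesis using 1 2 lo' hi' RT' unfolding K_def abs_le_iff by linarith
  qed
  show ?thesis unfolding has_natural_density_iff R_def[symmetric]
  proof (rule LIM_zero_cancel, rule tendsto_0_le[where f = "\<lambda>N. K / real N" and K = 1])
    show "(\<lambda>N. K / real N) \<longlonglongrightarrow> 0" by (rule lim_const_over_n)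
    show "\<forall>\<^sub>F N in sequentially. norm (real (count_upto S N) / real N - real R / real T) \<le> norm (K / real N) * 1"
    proof (rule eventually_mono[OF eventually_ge_at_top[of "max 1 n1"]])
      fix N assume N: "max 1 n1 \<le> N"
      have "real (count_upto S N) / real N - real R / real T = (real (count_upto S N) - real R / real T * real N) / real N"
        using N by (simp add: field_simps)
      then have "norm (real (count_upto S N) / real N - real R / real T) = \<bar>real (count_upto S N) - real R / real T * real N\<bar> / real N"
        by simp
      also have "\<dots> \<le> K / real N" using bd[of N] N by (intro divide_right_mono) auto
      also have "\<dots> \<le> norm (K / real N) * 1" by (simp only: mult_1_right real_norm_def abs_ge_self)
      finally show "norm (real (count_upto S N) / real N - real R / real T) \<le> norm (K / real N) * 1" .
    qed
  qed
qed

text \<open>No limit has to be guessed: the relative count of \<open>A\<close> is eventually as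
  close as desired to that of a set with a density, hence it is a Cauchy sequence.\<close>

lemma density_by_approximation:
  assumes "\<And>\<epsilon>. \<epsilon> > 0 \<Longrightarrow> \<exists>B \<delta>. has_natural_density B \<delta> \<and> A \<subseteq> B \<and>
     (\<forall>\<^sub>F N in sequentially. real (count_upto (B - A) N) \<le> \<epsilon> * real N)"
  shows "\<exists>\<delta>. has_natural_density A \<delta>"
proof -
  have "Cauchy (\<lambda>N. real (count_upto A N) / real N)"
  proof (rule metric_CauchyI)
    fix \<epsilon> :: real assume \<epsilon>: "\<epsilon> > 0"
    obtain B \<delta> where B: "has_natural_density B \<delta>" "A \<subseteq> B"
      "\<forall>\<^sub>F N in sequentially. real (count_upto (B - A) N) \<le> \<epsilon> / 4 * real N"
      using assms[of "\<epsilon> / 4"] \<epsilon> by auto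
    have "\<forall>\<^sub>F N in sequentially. dist (real (count_upto B N) / real N) \<delta> < \<epsilon> / 4"
      using B(1) \<epsilon> unfolding has_natural_density_iff by (intro tendstoD) auto
    then have "\<forall>\<^sub>F N in sequentially. dist (real (count_upto A N) / real N) \<delta> < \<epsilon> / 2"
      using B(3) eventually_gt_at_top[of 0]
    proof eventually_elim
      case (elim N)
      have "A \<union> (B - A) = B" using B(2) by auto
      then have "count_upto B N = count_upto A N + count_upto (B - A) N"
        using count_upto_disjoint[of A "B - A" N] by auto
      then have eq: "real (count_upto B N) / real N = real (count_upto A N) / real N + real (count_upto (B - A) N) / real N"
        by (simp add: add_divide_distrib)
      have "real (count_upto (B - A) N) / real N \<le> \<epsilon> / 4" using elim by (simp add: field_simps)
      moreover have "real (count_upto (B - A) N) / real N \<ge> 0" by simp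
      ultimately show ?case using elim(1) eq unfolding dist_real_def by linarith
    qed
    then obtain M where M: "\<And>N. N \<ge> M \<Longrightarrow> dist (real (count_upto A N) / real N) \<delta> < \<epsilon> / 2"
      by (auto simp: eventually_at_top_linorder)
    show "\<exists>M. \<forall>m\<ge>M. \<forall>n\<ge>M. dist (real (count_upto A m) / real m) (real (count_upto A n) / real n) < \<epsilon>"
      using M dist_triangle_half_l by blast
  qed
  then show ?thesis unfolding has_natural_density_iff using Cauchy_convergent convergent_def by blast
qed

section \<open>Recurrences modulo an integer\<close>

lemma recurrence_state_repeats:
  fixes F :: "nat \<Rightarrow> int" and M :: nat
  assumes "M \<ge> 1"
  shows "\<exists>i j. i < j \<and> (\<forall>t<k. F (i + t) mod int M = F (j + t) mod int M)"
proof -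
  define st where "st n = map (\<lambda>t. F (n + t) mod int M) [0..<k]" for n
  have "range st \<subseteq> {xs. set xs \<subseteq> {0..<int M} \<and> length xs = k}"
    using assms by (auto simp: st_def)
  then have "finite (range st)" by (rule finite_subset) (rule finite_lists_length_eq, simp)
  then obtain i j where ij: "i \<noteq> j" "st i = st j"
    using finite_imageD[of st UNIV] infinite_UNIV_nat by (auto simp: inj_on_def)
  have "F (i + t) mod int M = F (j + t) mod int M" if "t < k" for t
    using arg_cong[OF ij(2), of "\<lambda>xs. xs ! t"] that by (simp add: st_def)
  note eq = this
  show ?thesis
  proof (cases "i < j")
    case True
    then show ?thesis using eq by blast
  next
    case False
    then have "j < i" using ij(1) by simp
    moreover have "\<forall>t<k. F (j + t) mod int M = F (i + t) mod int M" using eq by simp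
    ultimately show ?thesis by blast
  qed
qed

text \<open>A repeated state of \<open>k\<close> consecutive residues propagates forwards, and also
  backwards if the last coefficient is invertible. Pure periodicity breaks a circle in the
  positivity proof: there a modulus depends on the chosen n0, so n0 cannot be required to lie beyond
  the preperiod for that modulus.\<close>

lemma recurrence_eventually_periodic:
  fixes M :: nat
  assumes rec: "integral_linear_recurrence k a F" and "M \<ge> 1"
  shows "\<exists>n1 T. T \<ge> 1 \<and> (\<forall>n\<ge>n1. [F (n + T) = F n] (mod int M)) \<and> (coprime (a k) (int M) \<longrightarrow> n1 = 0)"
proof -
  have k: "k \<ge> 1" and recF: "\<And>n. n \<ge> k \<Longrightarrow> F n = (\<Sum>i=1..k. a i * F (n - i))"
    using rec by (auto simp: integral_linear_recurrence_def)
  obtain i j where ij: "i < j" "\<And>t. t < k \<Longrightarrow> F (i + t) mod int M = F (j + t) mod int M"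
    using recurrence_state_repeats[OF assms(2), of k F] by blast
  define T where "T = j - i"
  have T: "T \<ge> 1" "j = i + T" using ij(1) by (auto simp: T_def)
  have fwd: "[F (i + t + T) = F (i + t)] (mod int M)" for t
  proof (induction t rule: less_induct)
    case (less t)
    show ?case
    proof (cases "t < k")
      case True
      moreover have "i + t + T = j + t" using T(2) by simp
      ultimately show ?thesis using ij(2)[of t] by (simp only: cong_def)
    next
      case False
      have "[(\<Sum>u=1..k. a u * F (i + t + T - u)) = (\<Sum>u=1..k. a u * F (i + t - u))] (mod int M)"
      proof (rule cong_sum)
        fix u assume u: "u \<in> {1..k}"
        then have e: "i + t + T - u = i + (t - u) + T" "i + t - u = i + (t - u)" using False by auto
        have "t - u < t" using u False k by auto
        from cong_scalar_left[OF less[OF this], of "a u"]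
        show "[a u * F (i + t + T - u) = a u * F (i + t - u)] (mod int M)" unfolding e .
      qed
      then show ?thesis using recF[of "i + t + T"] recF[of "i + t"] False by simp
    qed
  qed
  show ?thesis
  proof (cases "coprime (a k) (int M)")
    case False
    have "[F (n + T) = F n] (mod int M)" if "n \<ge> i" for n
      using fwd[of "n - i"] that by simp
    then show ?thesis using T(1) False by blast
  next
    case True
    have bwd: "\<forall>n\<ge>i - t. [F (n + T) = F n] (mod int M)" for t
    proof (induction t)
      case 0
      show ?case using fwd by (metis diff_zero le_add_diff_inverse)
    next
      case (Suc t)
      show ?case
      proof (cases "t < i")
        case False
        then show ?thesis using Suc by simp
      next
        case True
        define n where "n = i - Suc t"
        have n: "i - t = Suc n" using True by (simp add: n_def)
        have IH: "[F (m + T) = F m] (mod int M)" if "m > n" for m using Suc that n by simp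
        \<comment> \<open>The oldest term is isolated so that \<open>a k\<close> can be
          cancelled.\<close>
        have split: "F (n + k) = a k * F n + (\<Sum>u=1..<k. a u * F (n + k - u))"
          "F (n + T + k) = a k * F (n + T) + (\<Sum>u=1..<k. a u * F (n + T + k - u))"
        proof -
          have "{1..k} = insert k {1..<k}" using k by auto
          then show "F (n + k) = a k * F n + (\<Sum>u=1..<k. a u * F (n + k - u))"
            "F (n + T + k) = a k * F (n + T) + (\<Sum>u=1..<k. a u * F (n + T + k - u))"
            using recF[of "n + k"] recF[of "n + T + k"] by simp_all
        qed
        have s: "[(\<Sum>u=1..<k. a u * F (n + T + k - u)) = (\<Sum>u=1..<k. a u * F (n + k - u))] (mod int M)"
        proof (rule cong_sum)
          fix u assume u: "u \<in> {1..<k}"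
          then have e: "n + T + k - u = (n + k - u) + T" and "n + k - u > n" by auto
          from cong_scalar_left[OF IH[OF this(2)], of "a u"]
          show "[a u * F (n + T + k - u) = a u * F (n + k - u)] (mod int M)" unfolding e .
        qed
        have "[F (n + T + k) = F (n + k)] (mod int M)"
          using IH[of "n + k"] k by (simp add: add_ac)
        from cong_diff[OF this s] have "[a k * F (n + T) = a k * F n] (mod int M)"
          using split by simp
        then have "[F (n + T) = F n] (mod int M)"
          using True \<open>coprime (a k) (int M)\<close> cong_mult_lcancel by blast
        then show ?thesis using IH n by (metis le_neq_implies_less n_def)
      qed
    qed
    from bwd[of i] show ?thesis using T(1) by auto
  qed
qed

lemma periodic_cong_iterate:
  fixes F :: "nat \<Rightarrow> int"
  assumes "\<forall>n\<ge>n1. [F (n + T) = F n] (mod m)" "n \<ge> n1"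
  shows "[F (n + j * T) = F n] (mod m)"
proof (induction j)
  case (Suc j)
  have "[F (n + j * T + T) = F (n + j * T)] (mod m)" using assms by simp
  then show ?case using Suc cong_trans by (fastforce simp: add_ac)
qed simp

section \<open>Existence of the density\<close>

text \<open>The fundamental theorem of algebra splits off one root at a time; being rational, the
  root x / y contributes the integral factor y n - x, and \<open>e\<close> gathers the
  denominators.\<close>

lemma rational_roots_factorization:
  fixes G :: "rat poly"
  assumes "all_complex_roots_rational G"
  shows "\<exists>(e::int) (g::int) rs. e \<noteq> 0 \<and> g \<noteq> 0 \<and> (\<forall>(c, b)\<in>set rs. c > 0) \<and>
    (\<forall>n::int. of_int e * poly G (of_int n) = of_int (g * (\<Prod>(c, b)\<leftarrow>rs. c * n - b)))"
proof -
  interpret of_rat_poly: map_poly_comm_ring_hom "of_rat :: rat \<Rightarrow> complex" ..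
  have "G \<noteq> 0 \<Longrightarrow> \<forall>z::complex. poly (map_poly of_rat G) z = 0 \<longrightarrow> z \<in> \<rat> \<Longrightarrow>
    \<exists>(e::int) (g::int) rs. e \<noteq> 0 \<and> g \<noteq> 0 \<and> (\<forall>(c, b)\<in>set rs. c > 0) \<and>
      (\<forall>n::int. of_int e * poly G (of_int n) = of_int (g * (\<Prod>(c, b)\<leftarrow>rs. c * n - b)))" for G :: "rat poly"
  proof (induction "degree G" arbitrary: G)
    case 0
    then obtain q where q: "G = [:q:]" "q \<noteq> 0" by (metis degree_eq_zeroE pCons_0_0)
    obtain x y :: int where xy: "q = of_int x / of_int y" "y > 0"
      by (metis Rat_cases Fract_of_int_quotient)
    then have "x \<noteq> 0" using q by auto
    show ?case
    proof (rule exI[of _ y], rule exI[of _ x], rule exI[of _ "[]"], intro conjI allI)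
      show "of_int y * poly G (of_int n) = of_int (x * (\<Prod>(c, b)\<leftarrow>[]. c * n - b))" for n :: int
        unfolding q(1) using xy by simp
    qed (use xy(2) \<open>x \<noteq> 0\<close> in auto)
  next
    case (Suc d)
    have deg: "degree (map_poly of_rat G :: complex poly) = degree G" by (simp add: degree_map_poly)
    then have "\<not> constant (poly (map_poly of_rat G :: complex poly))"
      using Suc.hyps(2) by (simp add: constant_degree)
    then obtain z :: complex where z: "poly (map_poly of_rat G) z = 0"
      using fundamental_theorem_of_algebra by blast
    then have "z \<in> \<rat>" using Suc.prems by blast
    then obtain r where r: "z = of_rat r" by (auto elim: Rats_cases)
    have "of_rat (poly G r) = (0 :: complex)" using z r by (simp add: of_rat_hom.poly_map_poly)
    then have "poly G r = 0" by simp
    then obtain H where H: "G = [:- r, 1:] * H" by (auto simp: poly_eq_0_iff_dvd)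
    have Hnz: "H \<noteq> 0" using H Suc.prems by auto
    have "degree G = Suc (degree H)" unfolding H using Hnz by (subst degree_mult_eq) auto
    then have "d = degree H" using Suc.hyps(2) by simp
    moreover have "\<forall>z::complex. poly (map_poly of_rat H) z = 0 \<longrightarrow> z \<in> \<rat>"
      using Suc.prems(2) unfolding H of_rat_poly.hom_mult poly_mult by auto
    ultimately obtain e g rs where IH: "e \<noteq> 0" "g \<noteq> 0" "\<forall>(c, b)\<in>set rs. c > 0"
      "\<forall>n::int. of_int e * poly H (of_int n) = of_int (g * (\<Prod>(c, b)\<leftarrow>rs. c * n - b))"
      using Suc.hyps(1)[of H] Hnz by blast
    obtain x y :: int where xy: "r = of_int x / of_int y" "y > 0"
      by (metis Rat_cases Fract_of_int_quotient)
    have "of_int (y * e) * poly G (of_int n) = of_int (g * (\<Prod>(c, b)\<leftarrow>(y, x) # rs. c * n - b))" for n :: int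
    proof -
      have "of_int (y * e) * poly G (of_int n) = (of_int y * (of_int n - r)) * (of_int e * poly H (of_int n))"
        unfolding H by (simp add: algebra_simps)
      also have "of_int y * (of_int n - r) = of_int (y * n - x)" using xy by (simp add: field_simps)
      also have "of_int e * poly H (of_int n) = of_int (g * (\<Prod>(c, b)\<leftarrow>rs. c * n - b))" using IH(4) by blast
      finally show ?thesis by (simp add: algebra_simps)
    qed
    then show ?case using IH(1,2,3) xy(2)
      by (rule_tac exI[of _ "y * e"], rule_tac exI[of _ g], rule_tac exI[of _ "(y, x) # rs"]) auto
  qed
  moreover have "G \<noteq> 0"
  proof
    assume "G = 0"
    then have "\<i> \<in> \<rat>" using assms by (simp add: all_complex_roots_rational_def)
    then obtain q where q: "\<i> = of_rat q" by (auto elim: Rats_cases)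
    have "of_rat (q\<^sup>2 + 1) = (0 :: complex)" by (simp add: of_rat_add of_rat_power flip: q)
    then have "q\<^sup>2 + 1 = 0" by simp
    then show False using zero_le_power2[of q] by linarith
  qed
  ultimately show ?thesis using assms unfolding all_complex_roots_rational_def by blast
qed

text \<open>The list keeps multiplicities. An integer-valued polynomial such as n(n - 1)/2 need not
  have integer coefficients, so the denominator \<open>e\<close> has to be carried through the
  congruences for \<open>Gv\<close>.\<close>

locale split_poly =
  fixes Gv :: "int \<Rightarrow> int" and e g :: int and rs :: "(int \<times> int) list"
  assumes e: "e \<noteq> 0" and g: "g \<noteq> 0" and pos: "\<And>c b. (c, b) \<in> set rs \<Longrightarrow> c > 0"
    and fact: "\<And>n. e * Gv n = g * (\<Prod>(c, b)\<leftarrow>rs. c * n - b)"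
begin

lemma root_factor_dvd:
  assumes "(c, b) \<in> set rs"
  shows "(c * n - b) dvd e * Gv n"
proof -
  have "(c * n - b) dvd (\<Prod>(c, b)\<leftarrow>rs. c * n - b)"
    using assms by (induction rs) auto
  then show ?thesis unfolding fact by simp
qed

lemma zero_imp_root:
  assumes "Gv n = 0"
  shows "\<exists>(c, b)\<in>set rs. c * n = b"
proof -
  have "(\<Prod>(c, b)\<leftarrow>rs. c * n - b) = 0" using fact[of n] assms g by simp
  then show ?thesis by (auto simp: prod_list_zero_iff)
qed

lemma finite_zeros: "finite {n::nat. Gv (int n) = 0}"
proof (rule finite_subset)
  show "{n. Gv (int n) = 0} \<subseteq> (\<lambda>(c, b). nat (b div c)) ` set rs"
  proof
    fix n assume "n \<in> {n. Gv (int n) = 0}"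
    then have "\<exists>x\<in>set rs. fst x * int n = snd x"
      using zero_imp_root[of "int n"] by (simp add: case_prod_unfold)
    then obtain c b where cb: "(c, b) \<in> set rs" "c * int n = b" by force
    then have "nat (b div c) = n" using pos[OF cb(1)] by auto
    then show "n \<in> (\<lambda>(c, b). nat (b div c)) ` set rs" using cb(1) by force
  qed
qed simp

lemma prime_dvd_imp_root_factor:
  assumes "prime p" "int p dvd Gv n" "\<not> int p dvd g"
  shows "\<exists>(c, b)\<in>set rs. int p dvd c * n - b"
proof -
  have "int p dvd g * (\<Prod>(c, b)\<leftarrow>rs. c * n - b)" using assms(2) fact[of n] by (metis dvd_mult)
  then have "int p dvd (\<Prod>(c, b)\<leftarrow>rs. c * n - b)" using assms(1,3) by (simp add: prime_dvd_mult_iff)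
  then have "int p \<in> {q. \<exists>(c, b)\<in>set rs. q dvd c * n - b}"
    using assms(1)
  proof (induction rs)
    case (Cons x rs)
    then show ?case by (cases x) (auto simp: prime_dvd_mult_iff)
  qed auto
  then show ?thesis by auto
qed

lemma scaled_values_cong:
  assumes "[m = n] (mod k)"
  shows "[e * Gv m = e * Gv n] (mod k)"
proof -
  have "[(\<Prod>(c, b)\<leftarrow>xs. c * m - b) = (\<Prod>(c, b)\<leftarrow>xs. c * n - b)] (mod k)" for xs :: "(int \<times> int) list"
  proof (induction xs)
    case (Cons x xs)
    have "[fst x * m - snd x = fst x * n - snd x] (mod k)"
      using assms by (intro cong_diff cong_scalar_left) auto
    from cong_mult[OF this Cons] show ?case by (simp add: case_prod_unfold)
  qed simp
  from cong_scalar_left[OF this[of rs], of g] show ?thesis by (simp only: fact)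
qed

text \<open>Congruence of the arguments modulo \<open>e * M\<close>, rather than \<open>M\<close>,
  pays for the denominator \<open>e\<close>.\<close>

lemma values_cong:
  assumes "[m = n] (mod (e * M))"
  shows "[Gv m = Gv n] (mod M)"
  using scaled_values_cong[OF assms] e by (simp add: cong_iff_dvd_diff right_diff_distrib[symmetric])

lemma values_cong_prime:
  assumes "[m = n] (mod int q)" "prime q" "\<not> int q dvd e"
  shows "[Gv m = Gv n] (mod int q)"
  using scaled_values_cong[OF assms(1)] assms(2,3)
  by (simp add: cong_iff_dvd_diff right_diff_distrib[symmetric] prime_dvd_mult_iff)

end

text \<open>The \<epsilon> expresses a bound for the upper density without a limes superior.
  \<open>C\<close> and \<eta> are uniform in \<open>z\<close>, while \<open>X0\<close> may depend on
  \<open>z\<close> and \<epsilon>.\<close>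

definition tail_small :: "(nat \<Rightarrow> nat set) \<Rightarrow> bool" where
  "tail_small U \<longleftrightarrow> (\<exists>C \<eta> z0. \<eta> > 0 \<and> (\<forall>z\<ge>z0. \<forall>\<epsilon>>0. \<exists>X0. \<forall>X\<ge>X0.
     real (card {m \<in> U z. m \<le> X}) \<le> (C * real z powr (- \<eta>) + \<epsilon>) * real X))"

lemma finite_le_set [simp]: "finite {m \<in> U. m \<le> (X::nat)}"
  by (rule finite_subset[of _ "{..X}"]) auto

lemma tail_small_empty: "tail_small (\<lambda>_. {})"
  unfolding tail_small_def by (intro exI[of _ 0] exI[of _ 1] exI[of _ 0]) auto

lemma tail_small_Un:
  assumes "tail_small U" "tail_small V"
  shows "tail_small (\<lambda>z. U z \<union> V z)"
proof -
  obtain C \<eta> z0 where U: "\<eta> > 0" "\<And>z \<epsilon>. z \<ge> z0 \<Longrightarrow> \<epsilon> > 0 \<Longrightarrow> \<exists>X0. \<forall>X\<ge>X0.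
     real (card {m \<in> U z. m \<le> X}) \<le> (C * real z powr (- \<eta>) + \<epsilon>) * real X"
    using assms(1) unfolding tail_small_def by blast
  obtain D \<theta> z1 where V: "\<theta> > 0" "\<And>z \<epsilon>. z \<ge> z1 \<Longrightarrow> \<epsilon> > 0 \<Longrightarrow> \<exists>X0. \<forall>X\<ge>X0.
     real (card {m \<in> V z. m \<le> X}) \<le> (D * real z powr (- \<theta>) + \<epsilon>) * real X"
    using assms(2) unfolding tail_small_def by blast
  define \<xi> where "\<xi> = min \<eta> \<theta>"
  have "\<exists>X0. \<forall>X\<ge>X0. real (card {m \<in> U z \<union> V z. m \<le> X}) \<le> ((\<bar>C\<bar> + \<bar>D\<bar>) * real z powr (- \<xi>) + \<epsilon>) * real X"
    if z: "z \<ge> max 1 (max z0 z1)" and \<epsilon>: "\<epsilon> > 0" for z :: nat and \<epsilon> :: real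
  proof -
    obtain X0 where X0: "\<And>X. X \<ge> X0 \<Longrightarrow> real (card {m \<in> U z. m \<le> X}) \<le> (C * real z powr (- \<eta>) + \<epsilon> / 2) * real X"
      using U(2)[of z "\<epsilon> / 2"] z \<epsilon> by auto
    obtain X1 where X1: "\<And>X. X \<ge> X1 \<Longrightarrow> real (card {m \<in> V z. m \<le> X}) \<le> (D * real z powr (- \<theta>) + \<epsilon> / 2) * real X"
      using V(2)[of z "\<epsilon> / 2"] z \<epsilon> by auto
    have pw: "A * real z powr (- a) \<le> \<bar>A\<bar> * real z powr (- \<xi>)" if "\<xi> \<le> a" for A a :: real
    proof -
      have "A * real z powr (- a) \<le> \<bar>A\<bar> * real z powr (- a)" by (intro mult_right_mono) auto
      also have "\<dots> \<le> \<bar>A\<bar> * real z powr (- \<xi>)" using z that by (intro mult_left_mono powr_mono) auto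
      finally show ?thesis .
    qed
    show ?thesis
    proof (intro exI[of _ "max X0 X1"] allI impI)
      fix X assume X: "X \<ge> max X0 X1"
      have "{m \<in> U z \<union> V z. m \<le> X} = {m \<in> U z. m \<le> X} \<union> {m \<in> V z. m \<le> X}" by auto
      then have "card {m \<in> U z \<union> V z. m \<le> X} \<le> card {m \<in> U z. m \<le> X} + card {m \<in> V z. m \<le> X}"
        by (simp only: card_Un_le)
      then have "real (card {m \<in> U z \<union> V z. m \<le> X}) \<le> real (card {m \<in> U z. m \<le> X}) + real (card {m \<in> V z. m \<le> X})"
        by linarith
      also have "\<dots> \<le> (C * real z powr (- \<eta>) + \<epsilon> / 2) * real X + (D * real z powr (- \<theta>) + \<epsilon> / 2) * real X"
        using X0[of X] X1[of X] X by (intro add_mono) auto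
      also have "\<dots> = (C * real z powr (- \<eta>) + D * real z powr (- \<theta>) + \<epsilon>) * real X"
        by (simp add: algebra_simps)
      also have "\<dots> \<le> (\<bar>C\<bar> * real z powr (- \<xi>) + \<bar>D\<bar> * real z powr (- \<xi>) + \<epsilon>) * real X"
        using pw[of \<eta> C] pw[of \<theta> D] by (intro mult_right_mono add_mono) (auto simp: \<xi>_def)
      also have "\<dots> = ((\<bar>C\<bar> + \<bar>D\<bar>) * real z powr (- \<xi>) + \<epsilon>) * real X" by (simp add: algebra_simps)
      finally show "real (card {m \<in> U z \<union> V z. m \<le> X}) \<le> ((\<bar>C\<bar> + \<bar>D\<bar>) * real z powr (- \<xi>) + \<epsilon>) * real X" .
    qed
  qed
  moreover have "\<xi> > 0" using U(1) V(1) by (simp add: \<xi>_def)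
  ultimately show ?thesis unfolding tail_small_def by blast
qed

lemma tail_small_UN:
  assumes "finite I" "\<And>i. i \<in> I \<Longrightarrow> tail_small (U i)"
  shows "tail_small (\<lambda>z. \<Union>i\<in>I. U i z)"
  using assms
proof (induction I rule: finite_induct)
  case empty
  then show ?case using tail_small_empty by simp
next
  case (insert i I)
  then have "tail_small (\<lambda>z. U i z \<union> (\<Union>i\<in>I. U i z))" by (intro tail_small_Un) auto
  then show ?case by simp
qed

text \<open>Transfer from indices to values: as \<phi> m is at least m, the values up to
  \<open>X\<close> come from indices up to \<open>X\<close>.\<close>

lemma tail_small_image:
  assumes "tail_small V" "inj \<phi>" "\<And>m. m \<le> \<phi> m" "\<And>z. z \<ge> z1 \<Longrightarrow> U z \<subseteq> \<phi> ` V z"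
  shows "tail_small U"
proof -
  obtain C \<eta> z0 where V: "\<eta> > 0" "\<And>z \<epsilon>. z \<ge> z0 \<Longrightarrow> \<epsilon> > 0 \<Longrightarrow> \<exists>X0. \<forall>X\<ge>X0.
     real (card {m \<in> V z. m \<le> X}) \<le> (C * real z powr (- \<eta>) + \<epsilon>) * real X"
    using assms(1) unfolding tail_small_def by blast
  have le: "card {m \<in> U z. m \<le> X} \<le> card {m \<in> V z. m \<le> X}" if z: "z \<ge> z1" for z X
  proof -
    have "{m \<in> U z. m \<le> X} \<subseteq> \<phi> ` {m \<in> V z. m \<le> X}"
    proof
      fix u assume u: "u \<in> {m \<in> U z. m \<le> X}"
      then obtain v where v: "v \<in> V z" "u = \<phi> v" using assms(4)[OF z] by auto
      then have "v \<le> X" using u assms(3)[of v] by simp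
      then show "u \<in> \<phi> ` {m \<in> V z. m \<le> X}" using v by auto
    qed
    then have "card {m \<in> U z. m \<le> X} \<le> card (\<phi> ` {m \<in> V z. m \<le> X})" by (intro card_mono) auto
    also have "\<dots> \<le> card {m \<in> V z. m \<le> X}" by (rule card_image_le) simp
    finally show ?thesis .
  qed
  have "\<exists>X0. \<forall>X\<ge>X0. real (card {m \<in> U z. m \<le> X}) \<le> (C * real z powr (- \<eta>) + \<epsilon>) * real X"
    if z: "z \<ge> max z0 z1" and \<epsilon>: "\<epsilon> > 0" for z and \<epsilon> :: real
  proof -
    obtain X0 where X0: "\<And>X. X \<ge> X0 \<Longrightarrow> real (card {m \<in> V z. m \<le> X}) \<le> (C * real z powr (- \<eta>) + \<epsilon>) * real X"
      using V(2)[of z \<epsilon>] z \<epsilon> by auto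
    have "real (card {m \<in> U z. m \<le> X}) \<le> (C * real z powr (- \<eta>) + \<epsilon>) * real X" if "X \<ge> X0" for X
    proof -
      have "real (card {m \<in> U z. m \<le> X}) \<le> real (card {m \<in> V z. m \<le> X})"
        using le[of z X] z by simp
      then show ?thesis using X0[OF that] by linarith
    qed
    then show ?thesis by blast
  qed
  then show ?thesis using V(1) unfolding tail_small_def by blast
qed

text \<open>In terms of the index \<open>m\<close>, the factor c n - b becomes c' m - b'. If at one
  root all coefficient polynomials vanish, then c' m - b' divides multiples of both F(n) and G(n),
  hence D e h, and this bounds \<open>m\<close>. Otherwise every root has its own tail bound, and
  finitely many bounds are added.\<close>

lemma (in split_poly) class_dichotomy:
  fixes F :: "nat \<Rightarrow> int"
  assumes l: "l \<ge> 1" and ep: "exp_poly \<Gamma> Q (\<lambda>m. F (s + l * m))"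
  shows "(\<forall>h>0. finite {n \<in> range (\<lambda>m. s + l * m). gcd (F n) (Gv (int n)) = int h}) \<or>
    tail_small (\<lambda>z. {n \<in> range (\<lambda>m. s + l * m). Gv (int n) \<noteq> 0 \<and>
       (\<exists>p. prime p \<and> z < p \<and> int p dvd F n \<and> int p dvd Gv (int n))})"
proof -
  interpret exp_poly \<Gamma> Q "\<lambda>m. F (s + l * m)" by (rule ep)
  define c' where "c' x = fst x * int l" for x :: "int \<times> int"
  define b' where "b' x = snd x - fst x * int s" for x :: "int \<times> int"
  have cb: "c' x * int m - b' x = fst x * int (s + l * m) - snd x" for x m
    by (simp add: c'_def b'_def algebra_simps)
  have c': "c' x > 0" if "x \<in> set rs" for x using pos[of "fst x" "snd x"] that l by (simp add: c'_def)
  have inj: "inj (\<lambda>m. s + l * m)" using l by (auto simp: inj_on_def)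
  have ge: "m \<le> s + l * m" for m using l by (simp add: trans_le_add2)
  show ?thesis
  proof (cases "\<exists>x\<in>set rs. \<forall>\<gamma>\<in>\<Gamma>. poly (Q \<gamma>) (of_int (b' x) / of_int (c' x)) = 0")
    case True
    then obtain x where x: "x \<in> set rs" "\<And>\<gamma>. \<gamma> \<in> \<Gamma> \<Longrightarrow> poly (Q \<gamma>) (of_int (b' x) / of_int (c' x)) = 0" by blast
    have "c' x \<noteq> 0" using c'[OF x(1)] by simp
    from vanishing_at_root[OF this x(2)] obtain D where D: "D \<noteq> 0" "\<And>m. (c' x * int m - b' x) dvd D * F (s + l * m)"
      by auto
    have "finite {n \<in> range (\<lambda>m. s + l * m). gcd (F n) (Gv (int n)) = int h}" if "h > 0" for h
    proof (rule finite_subset)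
      define K where "K = nat (\<bar>D * e * int h\<bar> + \<bar>b' x\<bar>)"
      show "{n \<in> range (\<lambda>m. s + l * m). gcd (F n) (Gv (int n)) = int h} \<subseteq> (\<lambda>m. s + l * m) ` {..K}"
      proof
        fix n assume "n \<in> {n \<in> range (\<lambda>m. s + l * m). gcd (F n) (Gv (int n)) = int h}"
        then have "n \<in> range (\<lambda>m. s + l * m)" and "gcd (F n) (Gv (int n)) = int h" by blast+
        then obtain m where n: "n = s + l * m" "gcd (F n) (Gv (int n)) = int h" by blast
        have "(c' x * int m - b' x) dvd D * e * F n" using D(2)[of m] n(1)
          by (simp add: mult.assoc mult.left_commute[of D e])
        moreover have "(c' x * int m - b' x) dvd D * e * Gv (int n)"
        proof -
          have "(c' x * int m - b' x) dvd e * Gv (int n)"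
            using root_factor_dvd[of "fst x" "snd x" "int n"] x(1) unfolding cb n(1) by simp
          then show ?thesis by (simp add: mult.assoc)
        qed
        ultimately have "(c' x * int m - b' x) dvd gcd (D * e * F n) (D * e * Gv (int n))" by simp
        also have "gcd (D * e * F n) (D * e * Gv (int n)) = normalize (D * e * gcd (F n) (Gv (int n)))"
          by (simp only: gcd_mult_left)
        finally have "(c' x * int m - b' x) dvd D * e * int h" by (simp add: n(2))
        moreover have "D * e * int h \<noteq> 0" using D(1) e \<open>h > 0\<close> by simp
        ultimately have "\<bar>c' x * int m - b' x\<bar> \<le> \<bar>D * e * int h\<bar>" by (rule dvd_imp_le_int[rotated])
        then have "c' x * int m \<le> \<bar>D * e * int h\<bar> + \<bar>b' x\<bar>" by linarith
        moreover have "1 * int m \<le> c' x * int m" using c'[OF x(1)] by (intro mult_right_mono) auto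
        ultimately have "m \<le> K" by (simp add: K_def)
        then show "n \<in> (\<lambda>m. s + l * m) ` {..K}" using n by auto
      qed
    qed simp
    then show ?thesis by blast
  next
    case False
    define V where "V x z = {m. c' x * int m \<noteq> b' x \<and>
        (\<exists>p. prime p \<and> z < p \<and> int p dvd c' x * int m - b' x \<and> int p dvd F (s + l * m))}" for x z
    have "tail_small (V x)" if x: "x \<in> set rs" for x
    proof -
      obtain \<delta> where \<delta>: "\<delta> \<in> \<Gamma>" "poly (Q \<delta>) (of_int (b' x) / of_int (c' x)) \<noteq> 0" using False x by blast
      have eq: "{m \<in> V x z. m \<le> X} = {m. m \<le> X \<and> c' x * int m \<noteq> b' x \<and>
        (\<exists>p. prime p \<and> z < p \<and> int p dvd c' x * int m - b' x \<and> int p dvd F (s + l * m))}" for z X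
        by (auto simp: V_def)
      show ?thesis unfolding tail_small_def eq by (rule tail_bound_at_root[OF c'[OF x] \<delta>])
    qed
    then have ts: "tail_small (\<lambda>z. \<Union>x\<in>set rs. V x z)" by (intro tail_small_UN) auto
    have "tail_small (\<lambda>z. {n \<in> range (\<lambda>m. s + l * m). Gv (int n) \<noteq> 0 \<and>
       (\<exists>p. prime p \<and> z < p \<and> int p dvd F n \<and> int p dvd Gv (int n))})"
    proof (rule tail_small_image[OF ts inj ge])
      \<comment> \<open>A prime above |g| that divides a value of \<open>Gv\<close> must divide one
        of the linear factors.\<close>
      fix z assume z: "z \<ge> nat \<bar>g\<bar>"
      show "{n \<in> range (\<lambda>m. s + l * m). Gv (int n) \<noteq> 0 \<and>
         (\<exists>p. prime p \<and> z < p \<and> int p dvd F n \<and> int p dvd Gv (int n))} \<subseteq> (\<lambda>m. s + l * m) ` (\<Union>x\<in>set rs. V x z)"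
      proof
        fix n assume "n \<in> {n \<in> range (\<lambda>m. s + l * m). Gv (int n) \<noteq> 0 \<and>
         (\<exists>p. prime p \<and> z < p \<and> int p dvd F n \<and> int p dvd Gv (int n))}"
        then have "n \<in> range (\<lambda>m. s + l * m)" "Gv (int n) \<noteq> 0"
          and "\<exists>p. prime p \<and> z < p \<and> int p dvd F n \<and> int p dvd Gv (int n)" by blast+
        then obtain m p where n: "n = s + l * m" "Gv (int n) \<noteq> 0" and p: "prime p" "z < p" "int p dvd F n" "int p dvd Gv (int n)"
          by blast
        have "\<not> int p dvd g"
        proof
          assume "int p dvd g"
          then have "int p \<le> \<bar>g\<bar>" using dvd_imp_le_int[of g "int p"] g by simp
          then show False using z p(2) by linarith
        qed
        from prime_dvd_imp_root_factor[OF p(1,4) this]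
        obtain c b where x: "(c, b) \<in> set rs" "int p dvd c * int n - b" by auto
        have "c * int n - b \<noteq> 0"
        proof
          assume "c * int n - b = 0"
          then have "e * Gv (int n) = 0" using root_factor_dvd[OF x(1), of "int n"] by simp
          then show False using e n(2) by simp
        qed
        then have "c' (c, b) * int m \<noteq> b' (c, b)" "int p dvd c' (c, b) * int m - b' (c, b)"
          using cb[of "(c, b)" m] x(2) n(1) by auto
        then have "m \<in> V (c, b) z" using p n(1) by (auto simp: V_def)
        then show "n \<in> (\<lambda>m. s + l * m) ` (\<Union>x\<in>set rs. V x z)" using n(1) x(1) by blast
      qed
    qed
    then show ?thesis by blast
  qed
qed

text \<open>If some p <= z divided d / h, then h p would divide both \<open>d\<close> and h z!,
  hence \<open>h\<close>. The gcd with h z! thus tests all primes up to \<open>z\<close> at once,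
  and it depends only on \<open>d\<close> modulo h z!.\<close>

lemma exists_large_prime_factor:
  fixes d :: int
  assumes "gcd d (int h * fact z) = int h" "d \<noteq> int h" "d > 0" "h > 0"
  shows "\<exists>p. prime p \<and> z < p \<and> int p dvd d"
proof -
  have "int h dvd d" using assms(1) by (metis gcd_dvd1)
  then obtain k where k: "d = int h * k" by auto
  have "k > 0" using k assms(3,4) by (simp add: zero_less_mult_iff)
  moreover have "k \<noteq> 1" using k assms(2) by auto
  ultimately have "nat k \<noteq> 1" by auto
  then obtain p where p: "prime p" "p dvd nat k" using prime_factor_nat by blast
  have pk: "int p dvd k" using p(2) \<open>k > 0\<close> by (simp add: int_dvd_int_iff[symmetric])
  have "z < p"
  proof (rule ccontr)
    assume "\<not> z < p"
    then have "p dvd fact z" using prime_ge_1_nat[OF p(1)] by (intro dvd_fact) auto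
    then have "int p dvd fact z" by (metis of_nat_dvd_iff of_nat_fact)
    then have "int h * int p dvd gcd d (int h * fact z)" using pk k by auto
    then have "int h * int p dvd int h * 1" using assms(1) by simp
    then have "int p dvd 1" using assms(4) by (simp only: dvd_times_left_cancel_iff)
    then show False using p(1) by (auto simp: prime_nat_iff)
  qed
  then show ?thesis using p(1) pk k by auto
qed

text \<open>In the infinite case the set is approximated from outside by the eventually periodic set
  \<open>B\<close>, which only tests the gcd against h z!. What \<open>B\<close> adds is contained
  in 0, the zeros of \<open>Gv\<close>, and the numbers whose gcd has a prime factor above
  \<open>z\<close>.\<close>

lemma (in split_poly) class_density:
  assumes rec: "integral_linear_recurrence k a F" and l: "l \<ge> 1" and h: "h > 0"
    and ep: "exp_poly \<Gamma> Q (\<lambda>m. F (s + l * m))"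
  shows "\<exists>\<delta>. has_natural_density {n \<in> range (\<lambda>m. s + l * m). n \<ge> 1 \<and> gcd (F n) (Gv (int n)) = int h} \<delta>"
proof -
  define S where "S = range (\<lambda>m. s + l * m)"
  define A where "A = {n \<in> S. n \<ge> 1 \<and> gcd (F n) (Gv (int n)) = int h}"
  define U where "U z = {n \<in> S. Gv (int n) \<noteq> 0 \<and> (\<exists>p. prime p \<and> z < p \<and> int p dvd F n \<and> int p dvd Gv (int n))}" for z
  consider "finite {n \<in> S. gcd (F n) (Gv (int n)) = int h}" | "tail_small U"
    using class_dichotomy[OF l ep] h unfolding S_def U_def by blast
  then have "\<exists>\<delta>. has_natural_density A \<delta>"
  proof cases
    case 1
    then have "finite A" by (rule rev_finite_subset) (auto simp: A_def)
    then show ?thesis using density_finite by blast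
  next
    case 2
    then obtain C \<eta> z0 where U: "\<eta> > 0" "\<And>z \<epsilon>. z \<ge> z0 \<Longrightarrow> \<epsilon> > 0 \<Longrightarrow> \<exists>X0. \<forall>X\<ge>X0.
       real (card {m \<in> U z. m \<le> X}) \<le> (C * real z powr (- \<eta>) + \<epsilon>) * real X"
      unfolding tail_small_def by blast
    show ?thesis
    proof (rule density_by_approximation)
      fix \<epsilon> :: real assume \<epsilon>: "\<epsilon> > 0"
      have "(\<lambda>z. C * real z powr (- \<eta>)) \<longlonglongrightarrow> C * 0"
        using U(1) by (intro tendsto_intros tendsto_neg_powr filterlim_real_sequentially) auto
      then have "\<forall>\<^sub>F z in sequentially. C * real z powr (- \<eta>) < \<epsilon> / 3"
        using \<epsilon> by (intro order_tendstoD(2)) auto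
      then have "\<forall>\<^sub>F z in sequentially. C * real z powr (- \<eta>) < \<epsilon> / 3 \<and> z \<ge> z0"
        using eventually_conj eventually_ge_at_top by blast
      then obtain z where z: "C * real z powr (- \<eta>) < \<epsilon> / 3" "z \<ge> z0"
        using eventually_happens' sequentially_bot by blast
      define M where "M = h * fact z"
      have M: "M \<ge> 1" using h by (simp add: M_def)
      define B where "B = {n \<in> S. gcd (gcd (F n) (Gv (int n))) (int M) = int h}"
      obtain n1 T where T: "T \<ge> 1" "\<forall>n\<ge>n1. [F (n + T) = F n] (mod int M)"
        using recurrence_eventually_periodic[OF rec M] by blast
      \<comment> \<open>A multiple of \<open>T\<close> for \<open>F\<close>, of \<open>e * M\<close>
        for \<open>Gv\<close>, and of \<open>l\<close> for the residue class.\<close>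
      define P where "P = nat \<bar>e\<bar> * M * T * l"
      have P: "P \<ge> 1" using e M T(1) l by (simp add: P_def)
      \<comment> \<open>Beyond \<open>s\<close> because the class starts there, beyond
        \<open>n1\<close> because of the preperiod of \<open>F\<close>.\<close>
      have per: "n \<in> B \<longleftrightarrow> n + P \<in> B" if n: "n \<ge> max s n1" for n
      proof -
        have "[F (n + nat \<bar>e\<bar> * M * l * T) = F n] (mod int M)"
          by (rule periodic_cong_iterate[OF T(2)]) (use n in auto)
        then have F: "[F (n + P) = F n] (mod int M)" by (simp add: P_def mult_ac)
        have "[int (n + P) = int n] (mod (e * int M))"
          by (simp add: cong_iff_dvd_diff P_def mult_ac)
        from values_cong[OF this] have G: "[Gv (int (n + P)) = Gv (int n)] (mod int M)" .
        have id: "gcd (gcd (F m) (Gv (int m))) (int M) = gcd (gcd (F m) (int M)) (gcd (Gv (int m)) (int M))" for m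
          by (metis gcd.assoc gcd.commute gcd.left_idem)
        have "gcd (gcd (F (n + P)) (Gv (int (n + P)))) (int M) = gcd (gcd (F n) (Gv (int n))) (int M)"
          by (simp only: id cong_gcd_eq[OF F] cong_gcd_eq[OF G])
        moreover have "n \<in> S \<longleftrightarrow> n + P \<in> S"
        proof
          assume "n \<in> S"
          then obtain m where "n = s + l * m" by (auto simp: S_def)
          then have "n + P = s + l * (m + nat \<bar>e\<bar> * M * T)" by (simp add: P_def algebra_simps)
          then show "n + P \<in> S" unfolding S_def by blast
        next
          assume "n + P \<in> S"
          then obtain m where m: "n + P = s + l * m" by (auto simp: S_def)
          then have "n = s + l * m - l * (nat \<bar>e\<bar> * M * T)" by (simp add: P_def mult_ac)
          also have "\<dots> = s + l * (m - nat \<bar>e\<bar> * M * T)"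
          proof -
            have "P \<le> l * m" using m n by linarith
            then have "l * (nat \<bar>e\<bar> * M * T) \<le> l * m" by (simp add: P_def mult_ac)
            then show ?thesis by (simp add: diff_mult_distrib2)
          qed
          finally show "n \<in> S" unfolding S_def by blast
        qed
        ultimately show ?thesis by (simp add: B_def)
      qed
      have dens: "has_natural_density B (real (card (B \<inter> {max s n1..<max s n1 + P})) / real P)"
        by (rule density_eventually_periodic[OF P per])
      have AB: "A \<subseteq> B" by (auto simp: A_def B_def M_def)
      define Z where "Z = {n::nat. Gv (int n) = 0}"
      have finZ: "finite Z" using finite_zeros by (simp add: Z_def)
      have sub: "B - A \<subseteq> insert 0 Z \<union> U z"
      proof
        fix n assume n: "n \<in> B - A"
        show "n \<in> insert 0 Z \<union> U z"
        proof (cases "n = 0 \<or> Gv (int n) = 0")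
          case False
          define d where "d = gcd (F n) (Gv (int n))"
          have "d > 0" using False by (simp add: d_def)
          moreover have "d \<noteq> int h" using n False by (auto simp: A_def B_def d_def)
          moreover have "gcd d (int h * fact z) = int h" using n by (simp add: B_def M_def d_def)
          ultimately obtain p where "prime p" "z < p" "int p dvd d"
            using exists_large_prime_factor h by blast
          then have "n \<in> U z" using n False by (auto simp: U_def B_def d_def)
          then show ?thesis by simp
        qed (auto simp: Z_def)
      qed
      obtain X0 where X0: "\<And>X. X \<ge> X0 \<Longrightarrow> real (card {m \<in> U z. m \<le> X}) \<le> (C * real z powr (- \<eta>) + \<epsilon> / 3) * real X"
        using U(2)[OF z(2), of "\<epsilon> / 3"] \<epsilon> by auto
      define X1 where "X1 = nat \<lceil>3 * real (card (insert 0 Z)) / \<epsilon>\<rceil>"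
      have "\<forall>\<^sub>F N in sequentially. real (count_upto (B - A) N) \<le> \<epsilon> * real N"
      proof (rule eventually_mono[OF eventually_ge_at_top[of "max X0 X1"]])
        fix N assume N: "max X0 X1 \<le> N"
        have "count_upto (B - A) N \<le> count_upto (insert 0 Z \<union> U z) N" by (rule count_upto_mono[OF sub])
        also have "\<dots> \<le> count_upto (insert 0 Z) N + count_upto (U z) N" by (rule count_upto_Un_le)
        also have "\<dots> \<le> card (insert 0 Z) + card {m \<in> U z. m \<le> N}"
        proof (rule add_mono)
          show "count_upto (insert 0 Z) N \<le> card (insert 0 Z)" using finZ by (intro count_upto_finite) auto
          show "count_upto (U z) N \<le> card {m \<in> U z. m \<le> N}" unfolding count_upto_def by (intro card_mono) auto
        qed
        finally have "real (count_upto (B - A) N) \<le> real (card (insert 0 Z)) + real (card {m \<in> U z. m \<le> N})" by linarith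
        moreover have "real (card (insert 0 Z)) \<le> \<epsilon> / 3 * real N"
        proof -
          have "3 * real (card (insert 0 Z)) / \<epsilon> \<le> real N" using N unfolding X1_def by linarith
          then show ?thesis using \<epsilon> by (simp add: field_simps)
        qed
        moreover have "real (card {m \<in> U z. m \<le> N}) \<le> (2 * \<epsilon> / 3) * real N"
        proof -
          have "(C * real z powr (- \<eta>) + \<epsilon> / 3) * real N \<le> (2 * \<epsilon> / 3) * real N"
            using z(1) by (intro mult_right_mono) auto
          then show ?thesis using X0[of N] N by simp
        qed
        moreover have "\<epsilon> / 3 * real N + (2 * \<epsilon> / 3) * real N = \<epsilon> * real N" by (simp add: algebra_simps)
        ultimately show "real (count_upto (B - A) N) \<le> \<epsilon> * real N" by linarith
      qed
      then show "\<exists>B \<delta>. has_natural_density B \<delta> \<and> A \<subseteq> B \<and> (\<forall>\<^sub>F N in sequentially. real (count_upto (B - A) N) \<le> \<epsilon> * real N)"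
        using dens AB by blast
    qed
  qed
  then show ?thesis by (simp add: A_def S_def)
qed

lemma (in split_poly) gcd_density_exists:
  assumes rec: "integral_linear_recurrence k a F" and h: "h > 0"
  shows "\<exists>\<delta>. has_natural_density {n. n \<ge> 1 \<and> gcd (F n) (Gv (int n)) = int h} \<delta>"
proof -
  obtain l where l: "l \<ge> 1" "\<forall>s. \<exists>\<Gamma> Q. exp_poly \<Gamma> Q (\<lambda>m. F (s + l * m))"
    using subsequence_exp_poly[OF rec] by blast
  define A where "A s = {n \<in> range (\<lambda>m. s + l * m). n \<ge> 1 \<and> gcd (F n) (Gv (int n)) = int h}" for s
  have "\<exists>\<delta>. has_natural_density (\<Union>s\<in>{..<l}. A s) \<delta>"
  proof (rule density_finite_disjoint_UN)
    show "\<exists>\<delta>. has_natural_density (A s) \<delta>" for s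
      using l(2) class_density[OF rec l(1) h, of _ _ s] unfolding A_def by blast
    show "A i \<inter> A j = {}" if "i \<in> {..<l}" "j \<in> {..<l}" "i \<noteq> j" for i j
    proof -
      have "n mod l = s" if "n \<in> A s" "s < l" for n s using that by (auto simp: A_def)
      then show ?thesis using that by (metis IntE equals0I lessThan_iff)
    qed
  qed simp
  moreover have "(\<Union>s\<in>{..<l}. A s) = {n. n \<ge> 1 \<and> gcd (F n) (Gv (int n)) = int h}"
  proof (intro equalityI subsetI)
    fix n assume n: "n \<in> {n. n \<ge> 1 \<and> gcd (F n) (Gv (int n)) = int h}"
    have "n = n mod l + l * (n div l)" by simp
    then have "n \<in> range (\<lambda>m. n mod l + l * m)" by blast
    then have "n \<in> A (n mod l)" using n by (simp add: A_def)
    then show "n \<in> (\<Union>s\<in>{..<l}. A s)" using l(1) by auto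
  qed (auto simp: A_def)
  ultimately show ?thesis by simp
qed

section \<open>Positivity of the density\<close>

lemma card_crt_le:
  fixes M p :: nat
  assumes "coprime M p" "X \<subseteq> {..<M}" "Y \<subseteq> {..<p}"
  shows "card X * card Y \<le> card {n. n < M * p \<and> n mod M \<in> X \<and> n mod p \<in> Y}"
proof -
  have "\<forall>w\<in>X \<times> Y. \<exists>n. n < M * p \<and> n mod M = fst w \<and> n mod p = snd w"
  proof
    fix w assume w: "w \<in> X \<times> Y"
    then have lt: "fst w < M" "snd w < p" using assms by auto
    obtain n where "[n = fst w] (mod M)" "[n = snd w] (mod p)"
      using binary_chinese_remainder_nat[OF assms(1)] by blast
    then have "n mod (M * p) < M * p \<and> n mod (M * p) mod M = fst w \<and> n mod (M * p) mod p = snd w"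
      using lt by (auto simp: cong_def mod_mult_right_eq mod_mod_cancel)
    then show "\<exists>n. n < M * p \<and> n mod M = fst w \<and> n mod p = snd w" by blast
  qed
  from bchoice[OF this] obtain \<phi> where \<phi>: "\<forall>w\<in>X \<times> Y. \<phi> w < M * p \<and> \<phi> w mod M = fst w \<and> \<phi> w mod p = snd w" ..
  have "inj_on \<phi> (X \<times> Y)"
    by (rule inj_onI) (metis \<phi> prod_eqI)
  then have "card (X \<times> Y) = card (\<phi> ` (X \<times> Y))" by (simp add: card_image)
  also have "\<dots> \<le> card {n. n < M * p \<and> n mod M \<in> X \<and> n mod p \<in> Y}"
    by (rule card_mono) (use \<phi> in auto)
  finally show ?thesis by (simp add: card_cartesian_product)
qed

text \<open>The Chinese remainder theorem, one prime at a time. Subtraction is truncated, so a prime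
  below \<open>s\<close> merely makes the bound trivial.\<close>

lemma card_sieve_ge:
  fixes M r s :: nat and R :: "nat \<Rightarrow> nat set"
  assumes "finite P" "\<And>p. p \<in> P \<Longrightarrow> prime p \<and> coprime M p" "\<And>p. p \<in> P \<Longrightarrow> finite (R p) \<and> card (R p) \<le> s"
    "r < M"
  shows "(\<Prod>p\<in>P. p - s) \<le> card {n. n < M * \<Prod>P \<and> n mod M = r \<and> (\<forall>p\<in>P. n mod p \<notin> R p)}"
  using assms(1-3)
proof (induction P rule: finite_induct)
  case empty
  have "r \<in> {n. n < M * \<Prod>{} \<and> n mod M = r \<and> (\<forall>p\<in>{}. n mod p \<notin> R p)}" using assms(4) by simp
  then have "card {n. n < M * \<Prod>{} \<and> n mod M = r \<and> (\<forall>p\<in>{}. n mod p \<notin> R p)} > 0"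
    by (subst card_gt_0_iff) auto
  then show ?case by simp
next
  case (insert p P)
  define K where "K = M * \<Prod>P"
  define X where "X = {n. n < K \<and> n mod M = r \<and> (\<forall>q\<in>P. n mod q \<notin> R q)}"
  define Y where "Y = {..<p} - R p"
  have IH: "(\<Prod>q\<in>P. q - s) \<le> card X" using insert unfolding X_def K_def by auto
  have cY: "p - s \<le> card Y"
  proof -
    have "card {..<p} - card (R p) \<le> card Y" unfolding Y_def by (rule diff_card_le_card_Diff) (use insert in auto)
    then show ?thesis using insert.prems(2)[of p] by auto
  qed
  have "coprime p (\<Prod>P)"
    by (rule prod_coprime_right) (use insert in \<open>auto intro!: primes_coprime\<close>)
  then have cop: "coprime K p" using insert.prems(1)[of p] by (simp add: K_def coprime_commute)
  have "(\<Prod>q\<in>insert p P. q - s) = (\<Prod>q\<in>P. q - s) * (p - s)" using insert by (simp add: mult.commute)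
  also have "\<dots> \<le> card X * card Y" by (rule mult_le_mono[OF IH cY])
  also have "\<dots> \<le> card {n. n < K * p \<and> n mod K \<in> X \<and> n mod p \<in> Y}"
    by (rule card_crt_le[OF cop]) (auto simp: X_def Y_def)
  also have "\<dots> \<le> card {n. n < M * \<Prod>(insert p P) \<and> n mod M = r \<and> (\<forall>q\<in>insert p P. n mod q \<notin> R q)}"
  proof (rule card_mono)
    show "{n. n < K * p \<and> n mod K \<in> X \<and> n mod p \<in> Y} \<subseteq> {n. n < M * \<Prod>(insert p P) \<and> n mod M = r \<and> (\<forall>q\<in>insert p P. n mod q \<notin> R q)}"
    proof
      fix n assume n: "n \<in> {n. n < K * p \<and> n mod K \<in> X \<and> n mod p \<in> Y}"
      have "n mod K mod q = n mod q" if "q \<in> P" for q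
        by (rule mod_mod_cancel) (use that insert(1) in \<open>auto simp: K_def intro!: dvd_mult dvd_prodI[where f = id, simplified]\<close>)
      moreover have "n mod K mod M = n mod M" by (rule mod_mod_cancel) (simp add: K_def)
      ultimately show "n \<in> {n. n < M * \<Prod>(insert p P) \<and> n mod M = r \<and> (\<forall>q\<in>insert p P. n mod q \<notin> R q)}"
        using n insert(1,2) by (auto simp: X_def Y_def K_def mult_ac)
    qed
  qed simp
  finally show ?case .
qed

lemma exp_le_one_minus:
  fixes x :: real
  assumes "0 \<le> x" "x \<le> 1 / 2"
  shows "exp (- 2 * x) \<le> 1 - x"
proof -
  have "- x - 2 * x\<^sup>2 \<le> ln (1 - x)" by (rule ln_one_minus_pos_lower_bound) (use assms in auto)
  moreover have "2 * x\<^sup>2 \<le> x"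
    using mult_right_mono[OF assms(2,1)] by (simp add: power2_eq_square)
  ultimately have "- 2 * x \<le> ln (1 - x)" by linarith
  then have "exp (- 2 * x) \<le> exp (ln (1 - x))" by (simp only: exp_le_cancel_iff)
  then show ?thesis using assms by simp
qed

text \<open>For 2 s <= p the factor is at least exp(-2 s / p), and the sum of 1/p up to 2^J is at
  most a constant plus a small multiple of J. With z = 2^J the loss is an arbitrarily small power of
  \<open>z\<close>.\<close>

lemma sieve_product_lower_bound:
  assumes "\<epsilon> > 0"
  shows "\<exists>c>0. \<forall>J P. P \<subseteq> {p. prime p \<and> 2 * s \<le> p \<and> p \<le> 2 ^ J} \<longrightarrow>
     c * exp (- \<epsilon> * real J) \<le> (\<Prod>p\<in>P. 1 - real s / real p)"
proof -
  \<comment> \<open>The summand 1 covers s = 0.\<close>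
  define \<epsilon>' where "\<epsilon>' = \<epsilon> / (2 * real s + 1)"
  have "\<epsilon>' > 0" using assms by (simp add: \<epsilon>'_def)
  then obtain C where C: "\<And>J. (\<Sum>p | prime p \<and> p \<le> 2 ^ J. 1 / real p) \<le> C + \<epsilon>' * real J"
    using sum_inverse_primes_le by blast
  have "exp (- 2 * real s * C) * exp (- \<epsilon> * real J) \<le> (\<Prod>p\<in>P. 1 - real s / real p)"
    if P: "P \<subseteq> {p. prime p \<and> 2 * s \<le> p \<and> p \<le> 2 ^ J}" for J P
  proof -
    have finP: "finite P" by (rule finite_subset[of _ "{..2 ^ J}"]) (use P in auto)
    have "2 * real s * (\<Sum>p\<in>P. 1 / real p) \<le> 2 * real s * (C + \<epsilon>' * real J)"
    proof (rule mult_left_mono)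
      have "(\<Sum>p\<in>P. 1 / real p) \<le> (\<Sum>p | prime p \<and> p \<le> 2 ^ J. 1 / real p)"
        by (rule sum_mono2) (use P in auto)
      then show "(\<Sum>p\<in>P. 1 / real p) \<le> C + \<epsilon>' * real J" using C[of J] by linarith
    qed simp
    also have "\<dots> = 2 * real s * C + 2 * real s * \<epsilon>' * real J" by (simp add: algebra_simps)
    also have "\<dots> \<le> 2 * real s * C + \<epsilon> * real J"
    proof -
      have "2 * real s * \<epsilon>' \<le> \<epsilon>" using assms by (simp add: \<epsilon>'_def field_simps)
      then show ?thesis by (intro add_left_mono mult_right_mono) auto
    qed
    finally have bd: "2 * real s * (\<Sum>p\<in>P. 1 / real p) \<le> 2 * real s * C + \<epsilon> * real J" .
    have "exp (- 2 * real s * C) * exp (- \<epsilon> * real J) = exp (- (2 * real s * C + \<epsilon> * real J))"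
      by (simp add: exp_add[symmetric])
    also have "\<dots> \<le> exp (- (2 * real s * (\<Sum>p\<in>P. 1 / real p)))" using bd by simp
    also have "- (2 * real s * (\<Sum>p\<in>P. 1 / real p)) = (\<Sum>p\<in>P. - 2 * (real s / real p))"
      by (simp add: sum_distrib_left sum_negf[symmetric])
    also have "exp \<dots> = (\<Prod>p\<in>P. exp (- 2 * (real s / real p)))" by (rule exp_sum[OF finP])
    also have "\<dots> \<le> (\<Prod>p\<in>P. 1 - real s / real p)"
    proof (rule prod_mono, safe)
      fix p assume "p \<in> P"
      then have p: "prime p" "2 * s \<le> p" using P by auto
      then have "real (2 * s) \<le> real p" "real p > 0" by (simp_all only: of_nat_le_iff) (simp add: prime_gt_0_nat)
      then have "real s / real p \<le> 1 / 2" by (simp add: field_simps)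
      then show "exp (- 2 * (real s / real p)) \<le> 1 - real s / real p" by (intro exp_le_one_minus) auto
    qed simp
    finally show ?thesis .
  qed
  then show ?thesis by (intro exI[of _ "exp (- 2 * real s * C)"]) simp
qed

text \<open>Modulo \<open>p\<close> each linear factor has an invertible slope, hence at most one
  zero.\<close>

lemma (in split_poly) card_root_residues_le:
  assumes "prime p" "\<not> int p dvd g" "\<And>c b. (c, b) \<in> set rs \<Longrightarrow> \<not> int p dvd c"
  shows "card {n. n < p \<and> int p dvd Gv (int n)} \<le> length rs"
proof -
  have "{n. n < p \<and> int p dvd Gv (int n)} \<subseteq> (\<Union>x\<in>set rs. {n. n < p \<and> int p dvd fst x * int n - snd x})"
    using prime_dvd_imp_root_factor[OF assms(1) _ assms(2)] by (fastforce simp: case_prod_unfold)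
  then have "card {n. n < p \<and> int p dvd Gv (int n)} \<le> card (\<Union>x\<in>set rs. {n. n < p \<and> int p dvd fst x * int n - snd x})"
    by (intro card_mono) auto
  also have "\<dots> \<le> (\<Sum>x\<in>set rs. card {n. n < p \<and> int p dvd fst x * int n - snd x})" by (rule card_UN_le) simp
  also have "\<dots> \<le> (\<Sum>x\<in>set rs. 1)"
  proof (rule sum_mono)
    fix x assume x: "x \<in> set rs"
    have "m = n" if "m \<in> {n. n < p \<and> int p dvd fst x * int n - snd x}" "n \<in> {n. n < p \<and> int p dvd fst x * int n - snd x}" for m n
    proof -
      have "int p dvd (fst x * int m - snd x) - (fst x * int n - snd x)"
        by (rule dvd_diff) (use that in auto)
      then have "int p dvd fst x * (int m - int n)" by (simp add: algebra_simps)
      moreover have "\<not> int p dvd fst x" using assms(3)[of "fst x" "snd x"] x by simp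
      ultimately have "int p dvd int m - int n" using assms(1) by (simp add: prime_dvd_mult_iff)
      then have "int m mod int p = int n mod int p" by (simp add: mod_eq_dvd_iff)
      then show "m = n" using that by simp
    qed
    then show "card {n. n < p \<and> int p dvd fst x * int n - snd x} \<le> 1"
      by (subst One_nat_def, subst card_le_Suc0_iff_eq) auto
  qed
  also have "\<dots> \<le> length rs" by (simp add: card_length)
  finally show ?thesis .
qed

text \<open>Infinitude is used twice: it excludes the finite branch of the dichotomy, so the tail is
  small, and it provides an n0 in the set with G(n0) nonzero, beyond the preperiod of
  \<open>F\<close> modulo the last coefficient. The sieved set around n0 lies in the set apart from
  finitely many numbers and the tail.\<close>

lemma (in split_poly) density_zero_imp_finite:
  assumes rec: "integral_linear_recurrence k a F" and nd: "nondegenerate_recurrence k a"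
    and dens: "has_natural_density {n. n \<ge> 1 \<and> gcd (F n) (Gv (int n)) = 1} 0"
  shows "finite {n. n \<ge> 1 \<and> gcd (F n) (Gv (int n)) = 1}"
proof (rule ccontr)
  define A where "A = {n::nat. n \<ge> 1 \<and> gcd (F n) (Gv (int n)) = 1}"
  assume "infinite {n. n \<ge> 1 \<and> gcd (F n) (Gv (int n)) = 1}"
  then have infA: "infinite A" by (simp add: A_def)
  define U where "U z = {n. Gv (int n) \<noteq> 0 \<and> (\<exists>p. prime p \<and> z < p \<and> int p dvd F n \<and> int p dvd Gv (int n))}" for z
  obtain \<Gamma> Q where "exp_poly \<Gamma> Q F" using nondegenerate_exp_poly[OF rec nd] by blast
  \<comment> \<open>By nondegeneracy the whole sequence is a single class, with s = 0 and l =
    1.\<close>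
  then have ep: "exp_poly \<Gamma> Q (\<lambda>m. F (0 + 1 * m))" by simp
  have nfin: "\<not> finite {n \<in> range (\<lambda>m. 0 + 1 * m). gcd (F n) (Gv (int n)) = int 1}"
  proof
    assume "finite {n \<in> range (\<lambda>m. 0 + 1 * m). gcd (F n) (Gv (int n)) = int 1}"
    then have "finite A" by (rule rev_finite_subset) (auto simp: A_def)
    then show False using infA by simp
  qed
  from class_dichotomy[OF order_refl ep]
  have "tail_small (\<lambda>z. {n \<in> range (\<lambda>m. 0 + 1 * m). Gv (int n) \<noteq> 0 \<and>
       (\<exists>p. prime p \<and> z < p \<and> int p dvd F n \<and> int p dvd Gv (int n))})"
  proof (rule disjE)
    assume "\<forall>h>0. finite {n \<in> range (\<lambda>m. 0 + 1 * m). gcd (F n) (Gv (int n)) = int h}"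
    then have "finite {n \<in> range (\<lambda>m. 0 + 1 * m). gcd (F n) (Gv (int n)) = int 1}"
      by (rule allE[of _ 1]) simp
    with nfin show ?thesis by (rule notE)
  qed
  then have "tail_small U" by (simp add: U_def[abs_def])
  then obtain C \<eta> z0 where U: "\<eta> > 0" "\<And>z \<epsilon>. z \<ge> z0 \<Longrightarrow> \<epsilon> > 0 \<Longrightarrow> \<exists>X0. \<forall>X\<ge>X0.
     real (card {m \<in> U z. m \<le> X}) \<le> (C * real z powr (- \<eta>) + \<epsilon>) * real X"
    unfolding tail_small_def by blast
  define ak where "ak = nat \<bar>a k\<bar>"
  have "a k \<noteq> 0" using rec by (simp add: integral_linear_recurrence_def)
  then have ak: "ak \<ge> 1" by (simp add: ak_def)
  \<comment> \<open>A preperiod can only arise from primes dividing \<open>a k\<close>, and these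
    are known before n0 is chosen.\<close>
  obtain n1 T1 where T1: "T1 \<ge> 1" "\<forall>n\<ge>n1. [F (n + T1) = F n] (mod int ak)"
    using recurrence_eventually_periodic[OF rec ak] by blast
  have "infinite (A - ({n. Gv (int n) = 0} \<union> {..<n1}))"
    by (rule Diff_infinite_finite) (use infA finite_zeros in auto)
  then have "A - ({n. Gv (int n) = 0} \<union> {..<n1}) \<noteq> {}" using finite.emptyI by metis
  then obtain n0 where "n0 \<in> A - ({n. Gv (int n) = 0} \<union> {..<n1})" by blast
  then have n0: "n0 \<in> A" "Gv (int n0) \<noteq> 0" "n0 \<ge> n1" by auto
  define s where "s = length rs"
  \<comment> \<open>Primes above \<open>y\<close> divide none of \<open>g\<close>, \<open>e\<close>,
    \<open>Gv (int n0)\<close> and the leading coefficients in \<open>rs\<close>, and they are at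
    least \<open>2 * s\<close>.\<close>
  define y where "y = nat \<bar>g\<bar> + nat \<bar>e\<bar> + nat \<bar>Gv (int n0)\<bar> + ak + 2 * s + (\<Sum>x\<in>set rs. nat (fst x))"
  have small: "p \<le> y" if "int p dvd d" "d \<noteq> 0" "nat \<bar>d\<bar> \<le> y" for p and d :: int
  proof -
    have "int p \<le> \<bar>d\<bar>" using dvd_imp_le_int[OF that(2,1)] by simp
    then show ?thesis using that(3) by linarith
  qed
  have y_c: "nat c \<le> y" if "(c, b) \<in> set rs" for c b
  proof -
    have "nat (fst (c, b)) \<le> (\<Sum>x\<in>set rs. nat (fst x))" by (rule member_le_sum[OF that]) auto
    then show ?thesis by (simp add: y_def)
  qed
  \<comment> \<open>Modulo this product \<open>F\<close> is purely periodic, so no further condition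
    on the size of n0 arises although \<open>K\<close> depends on it.\<close>
  define K where "K = \<Prod>{p. prime p \<and> p \<le> y \<and> \<not> p dvd ak}"
  have finK: "finite {p. prime p \<and> p \<le> y \<and> \<not> p dvd ak}" by (rule finite_subset[of _ "{..y}"]) auto
  have K1: "K \<ge> 1" unfolding K_def by (rule prod_ge_1) (auto dest!: prime_gt_0_nat)
  have "coprime ak K" unfolding K_def
    by (rule prod_coprime_right) (auto intro: prime_imp_coprime simp: coprime_commute)
  then have "coprime (int ak) (int K)" by simp
  then have copK: "coprime (a k) (int K)" by (simp add: ak_def)
  obtain T2 where T2: "T2 \<ge> 1" "\<forall>n\<ge>0. [F (n + T2) = F n] (mod int K)"
    using recurrence_eventually_periodic[OF rec K1] copK by blast
  \<comment> \<open>Steps of length \<open>M\<close> preserve \<open>F\<close> (through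
    \<open>T1\<close> and \<open>T2\<close>) and \<open>Gv\<close> (through |e| y!) modulo every
    prime up to \<open>y\<close>. So along n0 + M j no such prime divides the gcd.\<close>
  define M where "M = nat \<bar>e\<bar> * fact y * T1 * T2"
  have M: "M \<ge> 1" using e T1(1) T2(1) by (simp add: M_def)
  have cong_M: "[F (n0 + M * j) = F n0] (mod int p) \<and> [Gv (int (n0 + M * j)) = Gv (int n0)] (mod int p)"
    if p: "prime p" "p \<le> y" for p j
  proof
    show "[F (n0 + M * j) = F n0] (mod int p)"
    proof (cases "p dvd ak")
      case True
      have "[F (n0 + (nat \<bar>e\<bar> * fact y * T2 * j) * T1) = F n0] (mod int ak)"
        by (rule periodic_cong_iterate[OF T1(2) n0(3)])
      moreover have "(nat \<bar>e\<bar> * fact y * T2 * j) * T1 = M * j" by (simp add: M_def mult_ac)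
      moreover have "int p dvd int ak" using True by simp
      ultimately show ?thesis using cong_dvd_modulus by metis
    next
      case False
      have "[F (n0 + (nat \<bar>e\<bar> * fact y * T1 * j) * T2) = F n0] (mod int K)"
        by (rule periodic_cong_iterate[OF T2(2)]) simp
      moreover have "(nat \<bar>e\<bar> * fact y * T1 * j) * T2 = M * j" by (simp add: M_def mult_ac)
      moreover have "p dvd K" unfolding K_def using finK p False by (intro dvd_prodI[where f = id, simplified]) auto
      then have "int p dvd int K" by simp
      ultimately show ?thesis using cong_dvd_modulus by metis
    qed
    have "p dvd fact y" using p prime_ge_1_nat[OF p(1)] by (intro dvd_fact) auto
    then obtain w where w: "fact y = p * w" by auto
    have "[int (n0 + M * j) = int n0] (mod (e * int p))"
      by (simp add: cong_iff_dvd_diff M_def w mult_ac)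
    then show "[Gv (int (n0 + M * j)) = Gv (int n0)] (mod int p)" by (rule values_cong)
  qed
  \<comment> \<open>With \<eta> ln 2 / 2 as the small constant the sieve loses only z^(-\<eta>/2),
    the square root of the tail z^(-\<eta>), so the sieved density wins for large
    \<open>J\<close>.\<close>
  have "\<exists>c>0. \<forall>J P. P \<subseteq> {p. prime p \<and> 2 * s \<le> p \<and> p \<le> 2 ^ J} \<longrightarrow>
     c * exp (- (\<eta> * ln 2 / 2) * real J) \<le> (\<Prod>p\<in>P. 1 - real s / real p)"
    by (rule sieve_product_lower_bound) (use U(1) in simp)
  then obtain \<kappa> where \<kappa>: "\<kappa> > 0" "\<And>J P. P \<subseteq> {p. prime p \<and> 2 * s \<le> p \<and> p \<le> 2 ^ J} \<Longrightarrow>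
     \<kappa> * exp (- (\<eta> * ln 2 / 2) * real J) \<le> (\<Prod>p\<in>P. 1 - real s / real p)"
    by blast
  have "(\<lambda>J. C * exp (- (\<eta> * ln 2 / 2) * real J)) \<longlonglongrightarrow> C * 0"
  proof (intro tendsto_intros filterlim_compose[OF exp_at_bot])
    show "filterlim (\<lambda>J. - (\<eta> * ln 2 / 2) * real J) at_bot sequentially"
      using U(1) by (intro filterlim_tendsto_neg_mult_at_bot[OF tendsto_const _ filterlim_real_sequentially]) auto
  qed
  then have "\<forall>\<^sub>F J in sequentially. C * exp (- (\<eta> * ln 2 / 2) * real J) < \<kappa> / real M"
    using \<kappa>(1) M by (intro order_tendstoD(2)) auto
  then have "\<forall>\<^sub>F J in sequentially. C * exp (- (\<eta> * ln 2 / 2) * real J) < \<kappa> / real M \<and> J \<ge> z0"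
    using eventually_conj eventually_ge_at_top by blast
  then obtain J where J: "C * exp (- (\<eta> * ln 2 / 2) * real J) < \<kappa> / real M" "J \<ge> z0"
    using eventually_happens' sequentially_bot by blast
  define z where "z = (2 :: nat) ^ J"
  have zz0: "z \<ge> z0" using J(2) less_exp[of J] unfolding z_def by linarith
  have z_powr: "real z powr (- \<eta>) = exp (- (\<eta> * ln 2 / 2) * real J) * exp (- (\<eta> * ln 2 / 2) * real J)"
  proof -
    have "real z powr (- \<eta>) = exp (- \<eta> * ln (2 ^ J))" by (simp add: z_def powr_def)
    also have "ln ((2::real) ^ J) = real J * ln 2" by (simp add: ln_realpow)
    finally show ?thesis by (simp add: exp_add[symmetric])
  qed
  \<comment> \<open>A prime above \<open>y\<close> may divide \<open>M\<close> through the periods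
    \<open>T1\<close> and \<open>T2\<close>. It needs no sieving: n is congruent to n0 modulo it,
    and it does not divide G(n0).\<close>
  define P where "P = {p. prime p \<and> y < p \<and> p \<le> z \<and> \<not> p dvd M}"
  have finP: "finite P" by (rule finite_subset[of _ "{..z}"]) (auto simp: P_def)
  define R where "R p = {n. n < p \<and> int p dvd Gv (int n)}" for p :: nat
  define T where "T = M * \<Prod>P"
  have prodP: "\<Prod>P \<ge> 1" by (rule prod_ge_1) (auto simp: P_def dest!: prime_gt_0_nat)
  have T: "T \<ge> 1" using M prodP by (simp add: T_def)
  define S where "S = {n. n mod M = n0 mod M \<and> (\<forall>p\<in>P. n mod p \<notin> R p)}"
  have MT: "M dvd T" by (simp add: T_def)
  have pT: "p dvd T" if "p \<in> P" for p
    unfolding T_def using that finP by (intro dvd_mult dvd_prodI[where f = id, simplified]) auto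
  have perS: "n \<in> S \<longleftrightarrow> n + T \<in> S" for n
  proof -
    have "(n + T) mod q = n mod q" if "q dvd T" for q using that by (metis mod_add_right_eq dvd_imp_mod_0 add.right_neutral)
    then show ?thesis using MT pT by (simp add: S_def)
  qed
  have densS: "has_natural_density S (real (card (S \<inter> {0..<0 + T})) / real T)"
    by (rule density_eventually_periodic[OF T]) (rule perS)
  define \<sigma> where "\<sigma> = real (card (S \<inter> {0..<0 + T})) / real T"
  have not_dvd: "\<not> int p dvd g" "\<not> int p dvd e" "\<not> int p dvd Gv (int n0)" "\<And>c b. (c, b) \<in> set rs \<Longrightarrow> \<not> int p dvd c" if "y < p" for p
  proof -
    show "\<not> int p dvd g" using small[of p g] g that by (auto simp: y_def)
    show "\<not> int p dvd e" using small[of p e] e that by (auto simp: y_def)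
    show "\<not> int p dvd Gv (int n0)" using small[of p "Gv (int n0)"] n0(2) that by (auto simp: y_def)
    show "\<not> int p dvd c" if cb: "(c, b) \<in> set rs" for c b
      using small[of p c] pos[OF cb] y_c[OF cb] \<open>y < p\<close> by auto
  qed
  have \<sigma>_ge: "\<sigma> \<ge> \<kappa> / real M * exp (- (\<eta> * ln 2 / 2) * real J)"
  proof -
    have "(\<Prod>p\<in>P. p - s) \<le> card {n. n < M * \<Prod>P \<and> n mod M = n0 mod M \<and> (\<forall>p\<in>P. n mod p \<notin> R p)}"
    proof (rule card_sieve_ge[OF finP])
      show "prime p \<and> coprime M p" if "p \<in> P" for p
        using that prime_imp_coprime[of p M] by (auto simp: P_def coprime_commute)
      show "finite (R p) \<and> card (R p) \<le> s" if "p \<in> P" for p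
        using card_root_residues_le[of p] not_dvd[of p] that by (auto simp: R_def s_def P_def)
    qed (use M in simp)
    also have "{n. n < M * \<Prod>P \<and> n mod M = n0 mod M \<and> (\<forall>p\<in>P. n mod p \<notin> R p)} = S \<inter> {0..<0 + T}"
      by (auto simp: S_def T_def)
    finally have "real (\<Prod>p\<in>P. p - s) \<le> real (card (S \<inter> {0..<0 + T}))" by (simp only: of_nat_le_iff)
    moreover have "real (\<Prod>p\<in>P. p - s) = (\<Prod>p\<in>P. 1 - real s / real p) * real (\<Prod>P)"
    proof -
      have "real (p - s) = (1 - real s / real p) * real p" if "p \<in> P" for p
      proof -
        have "s \<le> p" "p > 0" using that by (auto simp: P_def y_def)
        then show ?thesis by (simp add: field_simps of_nat_diff)
      qed
      then have "(\<Prod>p\<in>P. real (p - s)) = (\<Prod>p\<in>P. (1 - real s / real p) * real p)" by (intro prod.cong) auto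
      then show ?thesis by (simp only: of_nat_prod prod.distrib)
    qed
    ultimately have "(\<Prod>p\<in>P. 1 - real s / real p) * real (\<Prod>P) \<le> \<sigma> * real T" using T by (simp add: \<sigma>_def)
    moreover have "real T = real M * real (\<Prod>P)" by (simp add: T_def)
    ultimately have "(\<Prod>p\<in>P. 1 - real s / real p) * real (\<Prod>P) \<le> (\<sigma> * real M) * real (\<Prod>P)" by (simp only: mult.assoc)
    then have "(\<Prod>p\<in>P. 1 - real s / real p) \<le> \<sigma> * real M"
      by (rule mult_right_le_imp_le) (use prodP in linarith)
    moreover have "\<kappa> * exp (- (\<eta> * ln 2 / 2) * real J) \<le> (\<Prod>p\<in>P. 1 - real s / real p)"
      by (rule \<kappa>(2)) (auto simp: P_def y_def z_def)
    ultimately show ?thesis using M by (simp add: field_simps)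
  qed
  define \<tau> where "\<tau> = \<sigma> - C * real z powr (- \<eta>)"
  have \<tau>: "\<tau> > 0"
  proof -
    define E where "E = exp (- (\<eta> * ln 2 / 2) * real J)"
    have "C * E * E < \<kappa> / real M * E" using J(1) by (intro mult_strict_right_mono) (auto simp: E_def)
    then show ?thesis using \<sigma>_ge unfolding \<tau>_def z_powr E_def[symmetric] by (simp add: mult.assoc)
  qed
  \<comment> \<open>A common prime factor p <= z is refuted by comparison with n0 if p <= y or p
    divides \<open>M\<close>, and by the sieve otherwise.\<close>
  have subS: "S \<subseteq> A \<union> ({n. Gv (int n) = 0} \<union> {..n0} \<union> U z)"
  proof
    fix n assume n: "n \<in> S"
    show "n \<in> A \<union> ({n. Gv (int n) = 0} \<union> {..n0} \<union> U z)"
    proof (cases "n \<le> n0 \<or> Gv (int n) = 0 \<or> gcd (F n) (Gv (int n)) = 1")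
      case True
      then show ?thesis using n0(1) by (auto simp: A_def)
    next
      case False
      then have nn: "n > n0" "Gv (int n) \<noteq> 0" "gcd (F n) (Gv (int n)) \<noteq> 1" by auto
      define d where "d = gcd (F n) (Gv (int n))"
      have "nat d \<noteq> 1" using nn by (simp add: d_def)
      then obtain p where p: "prime p" "p dvd nat d" using prime_factor_nat by blast
      have "int p dvd d" using p(2) by (simp add: d_def int_dvd_int_iff[symmetric])
      then have pd: "int p dvd F n" "int p dvd Gv (int n)" by (auto simp: d_def)
      have "[n = n0] (mod M)" using n by (simp add: S_def cong_def)
      then have "M dvd n - n0" using nn(1) by (simp add: cong_altdef_nat)
      then obtain j where j: "n = n0 + M * j" using nn(1) by (metis dvdE le_add_diff_inverse less_imp_le)
      have "z < p"
      proof (rule ccontr)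
        assume "\<not> z < p"
        consider "p \<le> y" | "y < p" "p \<in> P" | "y < p" "p dvd M" using \<open>\<not> z < p\<close> p(1) by (force simp: P_def)
        then show False
        proof cases
          case 1
          have "int p dvd F n0" "int p dvd Gv (int n0)"
            using cong_M[OF p(1) 1, of j] pd unfolding j by (auto simp: cong_dvd_iff)
          then have "int p dvd gcd (F n0) (Gv (int n0))" by (rule gcd_greatest)
          moreover have "gcd (F n0) (Gv (int n0)) = 1" using n0(1) by (simp add: A_def)
          ultimately have "int p dvd 1" by (simp only:)
          then show False using p(1) by (auto simp: prime_nat_iff)
        next
          case 2
          have "[int n = int (n mod p)] (mod int p)" by (simp add: cong_def zmod_int)
          from values_cong_prime[OF this] have "[Gv (int n) = Gv (int (n mod p))] (mod int p)"
            using p(1) not_dvd(2)[OF 2(1)] by simp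
          then have "n mod p \<in> R p" using pd(2) p(1) by (auto simp: R_def cong_dvd_iff prime_gt_0_nat)
          then show False using n 2(2) by (auto simp: S_def)
        next
          case 3
          have "[int n = int n0] (mod int p)" using 3(2) unfolding j by (auto simp: cong_iff_dvd_diff)
          from values_cong_prime[OF this] have "[Gv (int n) = Gv (int n0)] (mod int p)"
            using p(1) not_dvd(2)[OF 3(1)] by simp
          then show False using pd(2) not_dvd(3)[OF 3(1)] by (simp add: cong_dvd_iff)
        qed
      qed
      then show ?thesis using p(1) pd nn by (auto simp: U_def)
    qed
  qed
  define Z where "Z = {n. Gv (int n) = 0} \<union> {..n0}"
  have finZ: "finite Z" using finite_zeros by (simp add: Z_def)
  \<comment> \<open>Shares of \<tau> / 4 go to the tail, to \<open>A\<close> and to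
    \<open>Z\<close>. Together they put the relative count of \<open>S\<close> below \<sigma> -
    \<tau> + 3 \<tau> / 4, contradicting the lower bound \<sigma> - \<tau> / 4.\<close>
  obtain X0 where X0: "\<And>X. X \<ge> X0 \<Longrightarrow> real (card {m \<in> U z. m \<le> X}) \<le> (C * real z powr (- \<eta>) + \<tau> / 4) * real X"
    using U(2)[OF zz0, of "\<tau> / 4"] \<tau> by auto
  have limS: "\<forall>\<^sub>F N in sequentially. \<sigma> - \<tau> / 4 < real (count_upto S N) / real N"
    using densS \<tau> unfolding has_natural_density_iff \<sigma>_def[symmetric] by (intro order_tendstoD(1)) auto
  have limA: "\<forall>\<^sub>F N in sequentially. real (count_upto A N) / real N < \<tau> / 4"
    using dens \<tau> unfolding has_natural_density_iff A_def[symmetric] by (intro order_tendstoD(2)) auto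
  have limZ: "\<forall>\<^sub>F N in sequentially. real (card Z) / real N < \<tau> / 4"
    using lim_const_over_n[of "real (card Z)"] \<tau> by (intro order_tendstoD(2)) auto
  have "\<forall>\<^sub>F N in sequentially. False"
    using limS limA limZ eventually_ge_at_top[of "max 1 X0"]
  proof eventually_elim
    case (elim N)
    have N: "real N > 0" "N \<ge> X0" using elim(4) by auto
    have "count_upto S N \<le> count_upto (A \<union> (Z \<union> U z)) N"
      by (rule count_upto_mono) (use subS in \<open>auto simp: Z_def\<close>)
    also have "\<dots> \<le> count_upto A N + count_upto (Z \<union> U z) N" by (rule count_upto_Un_le)
    also have "count_upto (Z \<union> U z) N \<le> count_upto Z N + count_upto (U z) N" by (rule count_upto_Un_le)
    also have "count_upto Z N \<le> card Z" by (rule count_upto_finite[OF finZ])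
    also have "count_upto (U z) N \<le> card {m \<in> U z. m \<le> N}" unfolding count_upto_def by (intro card_mono) auto
    finally have "real (count_upto S N) \<le> real (count_upto A N) + (real (card Z) + real (card {m \<in> U z. m \<le> N}))" by linarith
    also have "real (card {m \<in> U z. m \<le> N}) \<le> (C * real z powr (- \<eta>) + \<tau> / 4) * real N" by (rule X0[OF N(2)])
    finally have "real (count_upto S N) / real N \<le> (real (count_upto A N) + (real (card Z) + (C * real z powr (- \<eta>) + \<tau> / 4) * real N)) / real N"
      using N by (intro divide_right_mono) auto
    also have "\<dots> = real (count_upto A N) / real N + real (card Z) / real N + (C * real z powr (- \<eta>) + \<tau> / 4)"
      using N by (simp add: add_divide_distrib)
    finally have "real (count_upto S N) / real N \<le>
      real (count_upto A N) / real N + real (card Z) / real N + (C * real z powr (- \<eta>) + \<tau> / 4)" .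
    moreover have "C * real z powr (- \<eta>) = \<sigma> - \<tau>" by (simp add: \<tau>_def)
    ultimately show False using elim(1-3) by linarith
  qed
  then show False by simp
qed

theorem theorem1p4:
  fixes k h :: nat and a F :: "nat \<Rightarrow> int" and G :: "rat poly"
  assumes "integral_linear_recurrence k a F"
    and "integer_valued_poly G"
    and "all_complex_roots_rational G"
    and "h > 0"
  shows "(\<exists>\<delta>. has_natural_density (gcd_set F G h) \<delta>) \<and>
    (nondegenerate_recurrence k a \<and> \<not> has_fixed_divisor G \<longrightarrow>
       (has_natural_density (gcd_set F G 1) 0 \<longleftrightarrow> finite (gcd_set F G 1)))"
proof -
  obtain e g :: int and rs where G: "e \<noteq> 0" "g \<noteq> 0" "\<forall>(c, b)\<in>set rs. c > 0"
    "\<forall>n::int. of_int e * poly G (of_int n) = of_int (g * (\<Prod>(c, b)\<leftarrow>rs. c * n - b))"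
    using rational_roots_factorization[OF assms(3)] by blast
  interpret split_poly "int_value G" e g rs
  proof
    fix n :: int
    have "of_int (int_value G n) = poly G (of_int n)"
      using assms(2) by (auto simp: integer_valued_poly_def int_value_def elim!: Ints_cases)
    then have "of_int (e * int_value G n) = (of_int (g * (\<Prod>(c, b)\<leftarrow>rs. c * n - b)) :: rat)"
      using G(4) by simp
    then show "e * int_value G n = g * (\<Prod>(c, b)\<leftarrow>rs. c * n - b)" by (simp only: of_int_eq_iff)
  qed (use G in auto)
  have 1: "\<exists>\<delta>. has_natural_density (gcd_set F G h) \<delta>"
    unfolding gcd_set_def by (rule gcd_density_exists[OF assms(1,4)])
  moreover have "has_natural_density (gcd_set F G 1) 0 \<longleftrightarrow> finite (gcd_set F G 1)"
    if "nondegenerate_recurrence k a"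
    using density_zero_imp_finite[OF assms(1) that] density_finite unfolding gcd_set_def by auto
  ultimately show ?thesis by blast
qed

end
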